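(* Let $L\ge 0$ be an integer and $\psi\in\mathbb{R}^{L+1}$. Let $\{Y_n\}$ be a causal stationary autoregressive process of order $L$ with filter $\psi$, i.e. $Y_n=\underline{Y}_n^{\mathrm{T}}\psi+\varepsilon_n$, where $\underline{Y}_n=[1,Y_{n-1},\ldots,Y_{n-L}]^{\mathrm{T}}$ (and $\underline{Y}_n=1$ if $L=0$), and the noises $\varepsilon_n$ are i.i.d. with mean $0$ and finite variance $\sigma^2>0$. For each $N$ let $N_1=N_1(N)$ and $N_2=N-N_1$ with $N_1,N_2\to\infty$ as $N\to\infty$. Let $\hat\psi_1\in\mathbb{R}^{L+1}$ and $\hat\psi_2\in\mathbb{R}^{L+1}$ be the least squares estimates of the filter computed from $\{Y_1,\ldots,Y_{N_1}\}$ and from $\{Y_{N_1+1},\ldots,Y_N\}$, respectively. Assume (A.1) $E[\max\{\log|\varepsilon_n|,0\}]<\infty$ and the distribution of $\varepsilon_n$ has a nontrivial absolutely continuous component. Then $\sqrt{N_1}(\hat\psi_1-\psi)$ and $\sqrt{N_2}(\hat\psi_2-\psi)$ converge (jointly, in distribution) to two Gaussian random vectors that are independent.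
   Context: Least squares estimation of the filter from a stretch $Y_a,\ldots,Y_b$ means minimizing $\sum_n (Y_n-\underline{Y}_n^{\mathrm T}\psi)^2$ over $\psi\in\mathbb{R}^{L+1}$, the sum running over those $n$ in the stretch for which the regressors $Y_{n-1},\ldots,Y_{n-L}$ also lie in the stretch. *)

theory Defs
  imports "HOL-Probability.Probability"
begin

text \<open>Vectors of R^(L+1) are represented as functions nat => real whose
  coordinates with index > L vanish; coordinate 0 is the intercept.\<close>

definition supp_le :: "nat \<Rightarrow> (nat \<Rightarrow> real) \<Rightarrow> bool" where
  "supp_le L v \<longleftrightarrow> (\<forall>i>L. v i = 0)"

text \<open>Residual sum of squares of filter phi on the stretch y_a,...,y_b:
  sum over those n in the stretch whose regressors y_(n-1),...,y_(n-L) also lie in it.\<close>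

definition rss :: "nat \<Rightarrow> (int \<Rightarrow> real) \<Rightarrow> int \<Rightarrow> int \<Rightarrow> (nat \<Rightarrow> real) \<Rightarrow> real" where
  "rss L y a b phi =
     (\<Sum>n\<in>{a + int L..b}. (y n - (phi 0 + (\<Sum>j=1..L. phi j * y (n - int j))))\<^sup>2)"

definition lse :: "nat \<Rightarrow> (int \<Rightarrow> real) \<Rightarrow> int \<Rightarrow> int \<Rightarrow> (nat \<Rightarrow> real) set" where
  "lse L y a b = {phi. supp_le L phi \<and>
      (\<forall>phi'. supp_le L phi' \<longrightarrow> rss L y a b phi \<le> rss L y a b phi')}"

definition strictly_stationary :: "'a measure \<Rightarrow> (int \<Rightarrow> 'a \<Rightarrow> real) \<Rightarrow> bool" where
  "strictly_stationary M Y \<longleftrightarrow>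
     (\<forall>h::int. \<forall>I. finite I \<longrightarrow>
        distr M (PiM I (\<lambda>_. borel)) (\<lambda>x. \<lambda>i\<in>I. Y (i + h) x)
      = distr M (PiM I (\<lambda>_. borel)) (\<lambda>x. \<lambda>i\<in>I. Y i x))"

text \<open>Causality (Brockwell--Davis): Y_n = mu + sum_(j>=0) c_j eps_(n-j) with absolutely
  summable coefficients (almost surely).\<close>

definition causal :: "'a measure \<Rightarrow> (int \<Rightarrow> 'a \<Rightarrow> real) \<Rightarrow> (int \<Rightarrow> 'a \<Rightarrow> real) \<Rightarrow> bool" where
  "causal M Y eps \<longleftrightarrow>
     (\<exists>c::nat \<Rightarrow> real. \<exists>mu::real. summable (\<lambda>j. \<bar>c j\<bar>) \<and>
        (\<forall>n. AE x in M. (\<lambda>j. c j * eps (n - int j) x) sums (Y n x - mu)))"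

definition has_nontrivial_ac_component :: "real measure \<Rightarrow> bool" where
  "has_nontrivial_ac_component nu \<longleftrightarrow>
     (\<exists>f::real \<Rightarrow> ennreal. f \<in> borel_measurable borel \<and> (\<integral>\<^sup>+x. f x \<partial>lborel) > 0 \<and>
        (\<forall>A\<in>sets borel. (\<integral>\<^sup>+x\<in>A. f x \<partial>lborel) \<le> emeasure nu A))"

definition conv_distr :: "'a measure \<Rightarrow> (nat \<Rightarrow> 'a \<Rightarrow> 'b::topological_space) \<Rightarrow> 'b measure \<Rightarrow> bool" where
  "conv_distr M X mu \<longleftrightarrow>
     prob_space mu \<and> sets mu = sets borel \<and> (\<forall>N. X N \<in> borel_measurable M) \<and>
     (\<forall>g::'b \<Rightarrow> real. continuous_on UNIV g \<and> bounded (range g) \<longrightarrow>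
        (\<lambda>N. \<integral>x. g (X N x) \<partial>M) \<longlonglongrightarrow> (\<integral>y. g y \<partial>mu))"

definition gaussian_vec :: "nat \<Rightarrow> (nat \<Rightarrow> real) measure \<Rightarrow> bool" where
  "gaussian_vec L nu \<longleftrightarrow>
     (AE y in nu. supp_le L y) \<and>
     (\<forall>a::nat \<Rightarrow> real.
        (\<exists>c. distr nu borel (\<lambda>y. \<Sum>i\<le>L. a i * y i) = return borel c) \<or>
        (\<exists>m s. s > 0 \<and> distr nu borel (\<lambda>y. \<Sum>i\<le>L. a i * y i) = density lborel (normal_density m s)))"

end

theory Submission
  imports Defs
begin

text \<open>The normal equations express the estimation error of a stretch as the inverse of its empirical
  second moment matrix applied to the score, the sum of regressors times noise. The empirical matrix
  converges in mean to the second moment matrix \<open>Gam\<close> of the regressors, which is positive definite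
  because each observation carries a fresh innovation; so up to a term that vanishes in probability
  the error is \<open>Gam\<close> inverse applied to the score.

  For the scores of both stretches at once, truncate the regressors so that they are bounded and depend
  on finitely many noises. With \<open>phi\<close> the characteristic function of the noise and predictable weights
  \<open>w n\<close>, the expectation of the product of \<open>exp (i * w n * eps n) / phi (w n)\<close> is 1,
  while the product of the \<open>phi (w n)\<close> is asymptotically deterministic as soon as the sum of the squared
  weights is. Weights from different stretches add up in that sum, so the limiting characteristic
  function factorises, which is the asymptotic independence.

  Characteristic functions and tightness yield convergence in distribution: inside a large box a
  bounded continuous function factors through the sines of the rescaled coordinates, and the
  Stone-Weierstrass theorem applies to that factor.\<close>

text \<open>Dividing by \<open>phi (w n)\<close> dictates the truncation. The quotient needs
  \<open>phi\<close> bounded away from 0 along the weights, which is derived from small weights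
  together with a deterministic bound on the sum of their squares; unbounded regressors offer
  neither. Truncation also replaces ergodic theory: with a window of \<open>L + m\<close> noises
  distant terms are independent, and a variance count gives the law of large numbers. The level
  \<open>m\<close> is removed last, which is legitimate because the truncation errors are bounded
  through \<open>rho m\<close> uniformly in the sample size.

  A least squares minimiser may fail to be unique and the empirical matrix may be singular.
  Closeness is therefore measured by the expectation of a distance capped at 1: where the empirical
  matrix is far from \<open>Gam\<close> the cap suffices, elsewhere the error is absorbed into
  itself. Gram-Schmidt supplies the inverse of \<open>Gam\<close> together with a factor of it, and
  that factor produces the limit law, with covariance \<open>s2\<close> times the inverse for either
  stretch, as a linear image of independent standard normals.\<close>

section \<open>Inverting a positive definite matrix\<close>

text \<open>Gram-Schmidt for the bilinear form \<open>A\<close>: row \<open>w k\<close> is supported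
  on coordinates up to \<open>k\<close> and the rows are \<open>A\<close>-orthonormal, so the
  transpose of \<open>w\<close> times \<open>w\<close> inverts the leading block. The factor
  \<open>w\<close> is returned because a Gaussian vector with the inverse as covariance is later
  built from it.\<close>

lemma gram_schmidt_inverse:
  fixes A :: "nat \<Rightarrow> nat \<Rightarrow> real"
  assumes sym: "\<And>i j. A i j = A j i"
    and pos: "\<And>k v. k < n \<Longrightarrow> v k = 1 \<Longrightarrow> (\<Sum>i\<le>k. \<Sum>j\<le>k. v i * v j * A i j) > 0"
  shows "\<exists>w. (\<forall>k i. k < i \<longrightarrow> w k i = 0) \<and>
    (\<forall>i<n. \<forall>l<n. (\<Sum>j<n. (\<Sum>k<n. w k i * w k j) * A j l) = (if i = l then 1 else 0 :: real))"
  using pos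
proof (induction n)
  case 0
  show ?case by (intro exI[of _ "\<lambda>_ _. 0"]) auto
next
  case (Suc n)
  obtain w where w: "\<forall>k i. k < i \<longrightarrow> w k i = 0"
    "\<forall>i<n. \<forall>l<n. (\<Sum>j<n. (\<Sum>k<n. w k i * w k j) * A j l) = (if i = l then 1 else 0)"
    using Suc.IH[OF Suc.prems] by auto
  have w0: "w k i = 0" if "k < i" for k i
    using w(1) that by blast
  have w1: "(\<Sum>j<n. (\<Sum>k<n. w k i * w k j) * A j l) = (if i = l then 1 else 0)" if "i < n" "l < n" for i l
    using w(2) that by blast
  define B where "B i j = (\<Sum>k<n. w k i * w k j)" for i j
  have Bsym: "B i j = B j i" for i j unfolding B_def by (simp add: mult.commute)
  have B0: "B n j = 0" "B j n = 0" for j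
    unfolding B_def by (auto intro!: sum.neutral simp: w0)
  define c where "c i = (\<Sum>j<n. B i j * A j n)" for i
  \<comment> \<open>The solution \<open>c\<close> of the leading system, negated and completed by 1:
    \<open>A\<close> applied to \<open>u\<close> vanishes in the coordinates below \<open>n\<close>
    and equals the Schur complement \<open>s\<close> in coordinate \<open>n\<close>. Adding
    \<open>u i * u j / s\<close> to \<open>B\<close> therefore inverts the bordered matrix.\<close>
  define u where "u i = (if i < n then - c i else if i = n then 1 else 0)" for i
  define s where "s = (\<Sum>j\<le>n. u j * A j n)"
  have split: "{..n} = insert n {..<n}" by auto
  have cA: "(\<Sum>j<n. c j * A j l) = A l n" if l: "l < n" for l
  proof -
    have "(\<Sum>j<n. c j * A j l) = (\<Sum>j<n. \<Sum>i<n. B j i * A i n * A j l)"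
      by (simp add: c_def sum_distrib_right)
    also have "\<dots> = (\<Sum>i<n. \<Sum>j<n. B j i * A i n * A j l)"
      by (rule sum.swap)
    also have "\<dots> = (\<Sum>i<n. A i n * (\<Sum>j<n. B i j * A j l))"
      unfolding sum_distrib_left by (intro sum.cong refl) (simp add: Bsym mult.commute)
    also have "\<dots> = (\<Sum>i<n. A i n * (if i = l then 1 else 0))"
      using w1[OF _ l] by (intro sum.cong) (auto simp: B_def)
    also have "\<dots> = A l n" using l by (simp add: if_distrib[of "\<lambda>z. _ * z"] cong: if_cong)
    finally show ?thesis .
  qed
  have uA: "(\<Sum>j\<le>n. u j * A j l) = (if l = n then s else 0)" if "l \<le> n" for l
  proof (cases "l = n")
    case False
    then have l: "l < n" using that by simp
    have "(\<Sum>j\<le>n. u j * A j l) = A n l - (\<Sum>j<n. c j * A j l)"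
      unfolding split by (simp add: u_def sum_negf)
    then show ?thesis using cA[OF l] False sym by simp
  qed (simp add: s_def)
  have "(\<Sum>i\<le>n. \<Sum>j\<le>n. u i * u j * A i j) = (\<Sum>j\<le>n. u j * (\<Sum>i\<le>n. u i * A i j))"
    by (subst sum.swap) (simp add: sum_distrib_left mult_ac)
  also have "\<dots> = (\<Sum>j\<le>n. u j * (if j = n then s else 0))"
    using uA by (intro sum.cong) auto
  also have "\<dots> = s" by (simp add: u_def if_distrib[of "\<lambda>z. _ * z"] cong: if_cong)
  finally have spos: "s > 0"
    using Suc.prems[of n u] by (simp add: u_def)
  define w' where "w' k i = (if k = n then u i / sqrt s else w k i)" for k i
  have B': "(\<Sum>k<Suc n. w' k i * w' k j) = B i j + u i * u j / s" for i j
    using spos by (simp add: w'_def B_def)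
  have "(\<Sum>j<Suc n. (\<Sum>k<Suc n. w' k i * w' k j) * A j l) = (if i = l then 1 else 0)"
    if i: "i < Suc n" and l: "l < Suc n" for i l
  proof -
    have "(\<Sum>j<Suc n. (\<Sum>k<Suc n. w' k i * w' k j) * A j l)
        = (\<Sum>j<Suc n. B i j * A j l) + u i / s * (\<Sum>j\<le>n. u j * A j l)"
      unfolding B' by (simp only: lessThan_Suc_atMost)
        (simp add: sum_distrib_left sum.distrib algebra_simps)
    also have "\<dots> = (\<Sum>j<n. B i j * A j l) + (if l = n then u i else 0)"
      using uA[of l] l spos by (simp add: B0)
    also have "\<dots> = (if i = l then 1 else 0)"
    proof (cases "i = n")
      case True then show ?thesis by (simp add: B0 u_def)
    next
      case False
      then have "i < n" using i by simp
      then show ?thesis using w1[of i l] l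
        by (cases "l = n") (auto simp: u_def c_def B_def)
    qed
    finally show ?thesis .
  qed
  moreover have "w' k i = 0" if "k < i" for k i
    using that by (auto simp: w'_def u_def w0)
  ultimately show ?case by blast
qed

section \<open>Characteristic functions of pairs of random vectors\<close>

text \<open>Tychonoff's theorem, as functions carry the product topology.\<close>

lemma compact_function_box:
  fixes K :: "'i \<Rightarrow> 'b::topological_space set"
  assumes "\<And>i. compact (K i)"
  shows "compact {x. \<forall>i. x i \<in> K i}"
proof -
  have "compactin (product_topology (\<lambda>i. euclidean) UNIV) (PiE UNIV K)"
    unfolding compactin_PiE using assms by auto
  moreover have "PiE UNIV K = {x. \<forall>i. x i \<in> K i}" by auto
  ultimately show ?thesis by (simp add: euclidean_product_topology)
qed

definition lincomb :: "nat \<Rightarrow> (nat \<Rightarrow> real) \<Rightarrow> (nat \<Rightarrow> real) \<Rightarrow> real" where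
  "lincomb L s x = (\<Sum>i\<le>L. s i * x i)"

lemma continuous_on_fst_coordinate [continuous_intros]:
  "continuous_on S (\<lambda>p. (fst p :: nat \<Rightarrow> real) i)"
  by (rule continuous_on_product_then_coordinatewise) (intro continuous_intros)

lemma continuous_on_snd_coordinate [continuous_intros]:
  "continuous_on S (\<lambda>p. (snd p :: nat \<Rightarrow> real) i)"
  by (rule continuous_on_product_then_coordinatewise) (intro continuous_intros)

lemma continuous_on_lincomb [continuous_intros]:
  "continuous_on S f \<Longrightarrow> continuous_on S (\<lambda>x. lincomb L s (f x))"
  unfolding lincomb_def
  by (intro continuous_on_sum continuous_on_mult continuous_on_const) (rule continuous_on_product_then_coordinatewise)

lemma measurable_lincomb [measurable (raw)]:
  "f \<in> borel_measurable M \<Longrightarrow> (\<lambda>x. lincomb L s (f x)) \<in> borel_measurable M"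
  unfolding lincomb_def
  by (intro borel_measurable_sum borel_measurable_times borel_measurable_const) (rule measurable_product_then_coordinatewise)

lemma lincomb_scale: "lincomb L (\<lambda>i. a * s i) x = a * lincomb L s x"
  by (simp add: lincomb_def sum_distrib_left mult_ac)

lemma lincomb_add: "lincomb L (\<lambda>i. s i + t i) x = lincomb L s x + lincomb L t x"
  by (simp add: lincomb_def sum.distrib algebra_simps)

lemma lincomb_diff: "lincomb L (\<lambda>i. s i - t i) x = lincomb L s x - lincomb L t x"
  by (simp add: lincomb_def sum_subtractf algebra_simps)

lemma lincomb_0: "lincomb L (\<lambda>i. 0) x = 0"
  by (simp add: lincomb_def)

lemma lincomb_single: "i \<le> L \<Longrightarrow> lincomb L (\<lambda>j. if j = i then a else 0) x = a * x i"
  by (simp add: lincomb_def if_distrib[where f="\<lambda>a. a * _"] cong: if_cong)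

text \<open>Real span of phase-shifted cosines of linear forms. The phase makes sines available and
  keeps the span closed under products; the expectation of each member is determined by the joint
  characteristic function.\<close>

inductive_set trig :: "nat \<Rightarrow> ((nat \<Rightarrow> real) \<times> (nat \<Rightarrow> real) \<Rightarrow> real) set" for L where
  trig_cos: "(\<lambda>p. cos (lincomb L s (fst p) + lincomb L t (snd p) + b)) \<in> trig L"
| trig_scale: "f \<in> trig L \<Longrightarrow> (\<lambda>p. a * f p) \<in> trig L"
| trig_add: "f \<in> trig L \<Longrightarrow> g \<in> trig L \<Longrightarrow> (\<lambda>p. f p + g p) \<in> trig L"

lemma trig_const: "(\<lambda>p. c) \<in> trig L"
  using trig_scale[OF trig_cos[of L "\<lambda>_. 0" "\<lambda>_. 0" 0], of c] by (simp add: lincomb_0)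

text \<open>The product-to-sum formula for two cosines, extended bilinearly by a nested
  induction.\<close>

lemma trig_mult:
  assumes "f \<in> trig L" "g \<in> trig L"
  shows "(\<lambda>p. f p * g p) \<in> trig L"
  using assms
proof (induction f)
  case (trig_cos s t b)
  from trig_cos show ?case
  proof (induction g)
    case (trig_cos s' t' b')
    have "(\<lambda>p. 1/2 * cos (lincomb L (\<lambda>i. s i - s' i) (fst p) + lincomb L (\<lambda>i. t i - t' i) (snd p) + (b - b'))
        + 1/2 * cos (lincomb L (\<lambda>i. s i + s' i) (fst p) + lincomb L (\<lambda>i. t i + t' i) (snd p) + (b + b'))) \<in> trig L"
      by (intro trig.intros)
    also have "(\<lambda>p. 1/2 * cos (lincomb L (\<lambda>i. s i - s' i) (fst p) + lincomb L (\<lambda>i. t i - t' i) (snd p) + (b - b'))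
        + 1/2 * cos (lincomb L (\<lambda>i. s i + s' i) (fst p) + lincomb L (\<lambda>i. t i + t' i) (snd p) + (b + b')))
      = (\<lambda>p. cos (lincomb L s (fst p) + lincomb L t (snd p) + b) * cos (lincomb L s' (fst p) + lincomb L t' (snd p) + b'))"
      unfolding cos_times_cos lincomb_add lincomb_diff
      by (intro ext) (simp add: algebra_simps add_divide_distrib)
    finally show ?case .
  next
    case (trig_scale g a)
    then show ?case using trig.trig_scale[of _ L a] by (simp add: mult_ac)
  next
    case (trig_add g g')
    then show ?case using trig.trig_add by (simp add: distrib_left)
  qed
next
  case (trig_scale f a)
  then show ?case using trig.trig_scale[of _ L a] by (simp add: mult_ac)
next
  case (trig_add f f')
  then show ?case using trig.trig_add by (simp add: distrib_right)
qed

lemma trig_continuous: "f \<in> trig L \<Longrightarrow> continuous_on UNIV f"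
  by (induction rule: trig.induct) (auto intro!: continuous_intros)

lemma trig_bounded: "f \<in> trig L \<Longrightarrow> \<exists>C. \<forall>p. \<bar>f p\<bar> \<le> C"
proof (induction rule: trig.induct)
  case (trig_cos s t b)
  then show ?case by (intro exI[of _ 1]) auto
next
  case (trig_scale f a)
  then obtain C where "\<And>p. \<bar>f p\<bar> \<le> C" by auto
  then show ?case by (intro exI[of _ "\<bar>a\<bar> * C"]) (auto simp: abs_mult mult_left_mono)
next
  case (trig_add f g)
  then obtain C D where "\<And>p. \<bar>f p\<bar> \<le> C" "\<And>p. \<bar>g p\<bar> \<le> D" by auto
  then show ?case
    by (intro exI[of _ "C + D"]) (meson abs_triangle_ineq add_mono order_trans)
qed

definition box_compl :: "nat \<Rightarrow> real \<Rightarrow> ((nat \<Rightarrow> real) \<times> (nat \<Rightarrow> real)) set" where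
  "box_compl L R = {p. \<exists>i\<le>L. \<bar>fst p i\<bar> > R \<or> \<bar>snd p i\<bar> > R}"

text \<open>Rescaled by \<open>R\<close>, the sine is injective on \<open>[-R, R]\<close>, so there \<open>g\<close> factors through
  the sines of the coordinates; approximating the factor by polynomials on the cube \<open>[-1, 1]\<close>
  keeps the error under control outside the box as well.\<close>

lemma trig_approximation:
  fixes g :: "(nat \<Rightarrow> real) \<times> (nat \<Rightarrow> real) \<Rightarrow> real"
  assumes g: "continuous_on UNIV g" and C: "\<And>p. \<bar>g p\<bar> \<le> C" and "R > 0" "e > 0"
  shows "\<exists>h\<in>trig L. \<forall>p. supp_le L (fst p) \<and> supp_le L (snd p) \<longrightarrow>
    \<bar>g p - h p\<bar> \<le> e + 2 * C * indicator (box_compl L R) p"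
proof -
  \<comment> \<open>Collapsing the coordinates above \<open>L\<close> to a point makes distinct
    points of the cube differ in some coordinate \<open>i \<le> L\<close>, the only ones that the
    ring \<open>RR\<close> has to separate.\<close>
  define K where "K i = (if i \<le> L then {-1..1} else {0::real})" for i
  define A where "A = {x. \<forall>i. x i \<in> K i}"
  define S where "S = A \<times> A"
  define sn where "sn p = ((\<lambda>i. sin (fst p i / R)), (\<lambda>i. sin (snd p i / R)))"
    for p :: "(nat \<Rightarrow> real) \<times> (nat \<Rightarrow> real)"
  define G where "G s = g ((\<lambda>i. R * arcsin (fst s i)), (\<lambda>i. R * arcsin (snd s i)))"
    for s :: "(nat \<Rightarrow> real) \<times> (nat \<Rightarrow> real)"
  \<comment> \<open>Pulling back along \<open>sn\<close> turns polynomials in the coordinates into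
    trigonometric polynomials, so this is the ring for Stone-Weierstrass.\<close>
  define RR where "RR = {f. continuous_on S f \<and> (\<lambda>p. f (sn p)) \<in> trig L}"
  have A01: "-1 \<le> x i" "x i \<le> 1" if "x \<in> A" for x i
  proof -
    have "x i \<in> K i" using that by (auto simp: A_def)
    then show "-1 \<le> x i" "x i \<le> 1" by (auto simp: K_def split: if_splits)
  qed
  have "compact A" unfolding A_def by (rule compact_function_box) (simp add: K_def)
  then have compS: "compact S" unfolding S_def by (intro compact_Times)
  have contG: "continuous_on S G"
    unfolding G_def
    by (rule continuous_on_compose2[OF g])
       (auto intro!: continuous_intros simp: S_def A01)
  have shift: "sin y = cos (y + (- (pi/2)))" for y :: real
    by (simp add: cos_diff)
  have coord1: "(\<lambda>s. fst s i) \<in> RR" if "i \<le> L" for i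
  proof -
    have "(\<lambda>p. fst (sn p) i) \<in> trig L"
      using trig_cos[of L "\<lambda>j. if j = i then 1/R else 0" "\<lambda>_. 0" "-(pi/2)"] that
      by (simp add: sn_def shift lincomb_single lincomb_0)
    then show ?thesis by (auto simp: RR_def intro!: continuous_intros)
  qed
  have coord2: "(\<lambda>s. snd s i) \<in> RR" if "i \<le> L" for i
  proof -
    have "(\<lambda>p. snd (sn p) i) \<in> trig L"
      using trig_cos[of L "\<lambda>_. 0" "\<lambda>j. if j = i then 1/R else 0" "-(pi/2)"] that
      by (simp add: sn_def shift lincomb_single lincomb_0)
    then show ?thesis by (auto simp: RR_def intro!: continuous_intros)
  qed
  interpret function_ring_on RR S
  proof
    show "compact S" by fact
    show "continuous_on S f" if "f \<in> RR" for f using that by (simp add: RR_def)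
    show "(\<lambda>x. f x + g x) \<in> RR" if "f \<in> RR" "g \<in> RR" for f g
      using that by (auto simp: RR_def intro: continuous_intros trig_add)
    show "(\<lambda>x. f x * g x) \<in> RR" if "f \<in> RR" "g \<in> RR" for f g
      using that by (auto simp: RR_def intro!: continuous_intros trig_mult)
    show "(\<lambda>_. c) \<in> RR" for c by (auto simp: RR_def trig_const)
    show "\<exists>f\<in>RR. f x \<noteq> f y" if "x \<in> S" "y \<in> S" "x \<noteq> y" for x y
    proof -
      have "(\<exists>i. fst x i \<noteq> fst y i) \<or> (\<exists>i. snd x i \<noteq> snd y i)"
        using \<open>x \<noteq> y\<close> by (auto simp: prod_eq_iff fun_eq_iff)
      then show ?thesis
      proof (elim disjE exE)
        fix i assume i: "fst x i \<noteq> fst y i"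
        have "fst x i \<in> K i" "fst y i \<in> K i" using that by (auto simp: S_def A_def)
        then have "i \<le> L" using i by (auto simp: K_def split: if_splits)
        then show ?thesis using coord1[of i] i by (intro bexI[of _ "\<lambda>s. fst s i"])
      next
        fix i assume i: "snd x i \<noteq> snd y i"
        have "snd x i \<in> K i" "snd y i \<in> K i" using that by (auto simp: S_def A_def)
        then have "i \<le> L" using i by (auto simp: K_def split: if_splits)
        then show ?thesis using coord2[of i] i by (intro bexI[of _ "\<lambda>s. snd s i"])
      qed
    qed
  qed
  obtain f where f: "f \<in> RR" "\<And>s. s \<in> S \<Longrightarrow> \<bar>G s - f s\<bar> < e"
    using Stone_Weierstrass_basic[OF contG \<open>e > 0\<close>] by blast
  have "\<bar>g p - f (sn p)\<bar> \<le> e + 2 * C * indicator (box_compl L R) p"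
    if p: "supp_le L (fst p)" "supp_le L (snd p)" for p
  proof -
    have "sn p \<in> S" using p by (auto simp: sn_def S_def A_def K_def supp_le_def)
    from f(2)[OF this] have *: "\<bar>G (sn p) - f (sn p)\<bar> < e" .
    show ?thesis
    proof (cases "p \<in> box_compl L R")
      case True
      \<comment> \<open>\<open>G\<close> takes only values of \<open>g\<close>, so the approximant
        stays below \<open>C + e\<close> in modulus even outside the box, where nothing else relates
        it to \<open>g p\<close>.\<close>
      have "\<bar>G (sn p)\<bar> \<le> C" unfolding G_def by (rule C)
      with * C[of p] True show ?thesis by simp
    next
      case False
      have inv: "R * arcsin (sin (y / R)) = y" if "\<bar>y\<bar> \<le> R" for y
      proof -
        have "\<bar>y / R\<bar> \<le> 1" using that \<open>R > 0\<close> by (simp add: abs_divide)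
        then have "- (pi/2) \<le> y / R" "y / R \<le> pi/2" using pi_gt3 by linarith+
        then show ?thesis using \<open>R > 0\<close> by (simp add: arcsin_sin)
      qed
      have le: "\<bar>fst p i\<bar> \<le> R" "\<bar>snd p i\<bar> \<le> R" for i
      proof -
        have "\<bar>fst p i\<bar> \<le> R \<and> \<bar>snd p i\<bar> \<le> R"
        proof (cases "i \<le> L")
          case True
          then show ?thesis using False unfolding box_compl_def by (simp add: not_less)
        next
          case nL: False
          then have "fst p i = 0" "snd p i = 0" using p unfolding supp_le_def by simp_all
          then show ?thesis using \<open>R > 0\<close> by simp
        qed
        then show "\<bar>fst p i\<bar> \<le> R" "\<bar>snd p i\<bar> \<le> R" by simp_all
      qed
      have "G (sn p) = g (fst p, snd p)"
        unfolding G_def sn_def by (simp add: inv le)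
      then show ?thesis using * False by simp
    qed
  qed
  moreover have "(\<lambda>p. f (sn p)) \<in> trig L" using f(1) by (simp add: RR_def)
  ultimately show ?thesis by (intro bexI[of _ "\<lambda>p. f (sn p)"] allI impI) blast+
qed

lemma box_compl_sets [measurable]: "box_compl L R \<in> sets borel"
proof -
  have "box_compl L R = (\<Union>i\<le>L. {p \<in> space borel. \<bar>fst p i\<bar> > R \<or> \<bar>snd p i\<bar> > R})"
    by (auto simp: box_compl_def)
  moreover have "\<dots> \<in> sets borel"
  proof (intro sets.finite_UN)
    fix i
    have [measurable]: "(\<lambda>p. fst p i) \<in> borel_measurable (borel :: ((nat \<Rightarrow> real) \<times> (nat \<Rightarrow> real)) measure)"
      "(\<lambda>p. snd p i) \<in> borel_measurable (borel :: ((nat \<Rightarrow> real) \<times> (nat \<Rightarrow> real)) measure)"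
      by (intro borel_measurable_continuous_onI continuous_intros)+
    show "{p \<in> space borel. \<bar>fst p i\<bar> > R \<or> \<bar>snd p i\<bar> > R} \<in> sets borel"
      by measurable
  qed simp
  ultimately show ?thesis by simp
qed

lemma box_compl_antimono: "R \<le> R' \<Longrightarrow> box_compl L R' \<subseteq> box_compl L R"
  by (force simp: box_compl_def)

text \<open>Only finitely many coordinates are tested, so every point lies in some box and the
  complements decrease to the empty set.\<close>

lemma prob_box_compl_small:
  assumes "prob_space mu" "sets mu = sets borel" "e > 0"
  shows "\<exists>R. measure mu (box_compl L R) \<le> e"
proof -
  interpret prob_space mu by fact
  have "(\<lambda>n. measure mu (box_compl L (real n))) \<longlonglongrightarrow> measure mu (\<Inter>n. box_compl L (real n))"
    using assms by (intro finite_Lim_measure_decseq)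
      (auto simp: decseq_def image_subset_iff box_compl_sets intro!: box_compl_antimono)
  moreover have "(\<Inter>n. box_compl L (real n)) = {}"
  proof -
    { fix p assume p: "\<And>n. p \<in> box_compl L (real n)"
      obtain n where n: "(\<Sum>i\<le>L. \<bar>fst p i\<bar> + \<bar>snd p i\<bar>) < real n" using reals_Archimedean2 by blast
      obtain i where i: "i \<le> L" "\<bar>fst p i\<bar> > n \<or> \<bar>snd p i\<bar> > n" using p[of n] by (auto simp: box_compl_def)
      have "\<bar>fst p i\<bar> + \<bar>snd p i\<bar> \<le> (\<Sum>i\<le>L. \<bar>fst p i\<bar> + \<bar>snd p i\<bar>)"
        using i by (intro member_le_sum[where f="\<lambda>i. \<bar>fst p i\<bar> + \<bar>snd p i\<bar>"]) auto
      then have False using n i by auto }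
    then show ?thesis by blast
  qed
  ultimately have "(\<lambda>n. measure mu (box_compl L (real n))) \<longlonglongrightarrow> 0" by simp
  then have "eventually (\<lambda>n. measure mu (box_compl L (real n)) < e) sequentially"
    using \<open>e > 0\<close> by (rule order_tendstoD)
  then obtain n where "measure mu (box_compl L (real n)) < e"
    unfolding eventually_sequentially by blast
  then show ?thesis by (intro exI[of _ "real n"]) simp
qed

lemma expectation_trig_approximation:
  fixes g h :: "(nat \<Rightarrow> real) \<times> (nat \<Rightarrow> real) \<Rightarrow> real"
  assumes "prob_space M" and [measurable]: "P \<in> borel_measurable M"
    and supp: "AE x in M. supp_le L (fst (P x)) \<and> supp_le L (snd (P x))"
    and g: "continuous_on UNIV g" and C: "\<And>p. \<bar>g p\<bar> \<le> C" and h: "h \<in> trig L"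
    and gh: "\<And>p. supp_le L (fst p) \<and> supp_le L (snd p) \<Longrightarrow>
      \<bar>g p - h p\<bar> \<le> e + 2 * C * indicator (box_compl L R) p"
  shows "\<bar>(\<integral>x. g (P x) \<partial>M) - (\<integral>x. h (P x) \<partial>M)\<bar>
    \<le> e + 2 * C * measure M {x\<in>space M. P x \<in> box_compl L R}"
proof -
  interpret prob_space M by fact
  have [measurable]: "g \<in> borel_measurable borel" "h \<in> borel_measurable borel"
    using g trig_continuous[OF h] by (auto intro: borel_measurable_continuous_onI)
  obtain D where D: "\<And>p. \<bar>h p\<bar> \<le> D" using trig_bounded[OF h] by blast
  have int: "integrable M (\<lambda>x. g (P x))" "integrable M (\<lambda>x. h (P x))"
    by (rule integrable_const_bound[where B=C], simp add: C, measurable,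
        rule integrable_const_bound[where B=D], simp add: D, measurable)
  have ii: "integrable M (indicator {x\<in>space M. P x \<in> box_compl L R} :: 'a \<Rightarrow> real)"
    by (intro integrable_real_indicator) (auto simp: less_top[symmetric])
  have "\<bar>(\<integral>x. g (P x) \<partial>M) - (\<integral>x. h (P x) \<partial>M)\<bar> = \<bar>\<integral>x. g (P x) - h (P x) \<partial>M\<bar>"
    using int by simp
  also have "\<dots> \<le> (\<integral>x. \<bar>g (P x) - h (P x)\<bar> \<partial>M)"
    by (rule integral_abs_bound)
  also have "\<dots> \<le> (\<integral>x. e + 2 * C * indicator {x\<in>space M. P x \<in> box_compl L R} x \<partial>M)"
  proof (rule integral_mono_AE)
    show "AE x in M. \<bar>g (P x) - h (P x)\<bar> \<le> e + 2 * C * indicator {x\<in>space M. P x \<in> box_compl L R} x"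
      using supp AE_space
    proof eventually_elim
      case (elim x)
      then show ?case using gh[of "P x"] by (simp add: indicator_def)
    qed
  qed (use int ii in auto)
  also have "\<dots> = e + 2 * C * measure M {x\<in>space M. P x \<in> box_compl L R}"
    using ii by (subst Bochner_Integration.integral_add) (auto simp: prob_space)
  finally show ?thesis .
qed

text \<open>Trigonometric polynomials converge by the assumption on characteristic functions.
  Tightness confines the laws to one box up to small mass, and the approximation there transfers the
  limit to \<open>g\<close>.\<close>

lemma levy_continuity_pairs:
  fixes X :: "nat \<Rightarrow> 'a \<Rightarrow> (nat \<Rightarrow> real) \<times> (nat \<Rightarrow> real)"
  assumes "prob_space M" and "prob_space mu" and sets_mu: "sets mu = sets borel"
    and X [measurable]: "\<And>N. X N \<in> borel_measurable M"
    and supp: "\<And>N x. x \<in> space M \<Longrightarrow> supp_le L (fst (X N x)) \<and> supp_le L (snd (X N x))"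
    and supp_mu: "AE p in mu. supp_le L (fst p) \<and> supp_le L (snd p)"
    and char: "\<And>s t. (\<lambda>N. \<integral>x. iexp (lincomb L s (fst (X N x)) + lincomb L t (snd (X N x))) \<partial>M)
      \<longlonglongrightarrow> (\<integral>p. iexp (lincomb L s (fst p) + lincomb L t (snd p)) \<partial>mu)"
    and tight: "\<And>e. e > 0 \<Longrightarrow> \<exists>R. \<forall>\<^sub>F N in sequentially. measure M {x\<in>space M. X N x \<in> box_compl L R} \<le> e"
    and g: "continuous_on UNIV g" and gb: "bounded (range g)"
  shows "(\<lambda>N. \<integral>x. g (X N x) \<partial>M) \<longlonglongrightarrow> (\<integral>p. g p \<partial>mu :: real)"
proof -
  interpret M: prob_space M by fact
  interpret mu: prob_space mu by fact
  have sets_mu' [measurable_cong]: "sets mu = sets borel" by (rule sets_mu)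
  have space_mu: "space mu = UNIV" using sets_eq_imp_space_eq[OF sets_mu] by simp
  obtain C where C: "\<And>p. \<bar>g p\<bar> \<le> C" using gb by (auto simp: bounded_iff)
  have C0: "C \<ge> 0" using C[of undefined] by linarith
  have fs [measurable]: "fst \<in> borel_measurable (borel :: ((nat\<Rightarrow>real)\<times>(nat\<Rightarrow>real)) measure)"
    "snd \<in> borel_measurable (borel :: ((nat\<Rightarrow>real)\<times>(nat\<Rightarrow>real)) measure)"
    by (auto intro!: borel_measurable_continuous_onI continuous_intros)
  have trig_conv: "(\<lambda>N. \<integral>x. h (X N x) \<partial>M) \<longlonglongrightarrow> (\<integral>p. h p \<partial>mu)" if "h \<in> trig L" for h
    using that
  proof (induction rule: trig.induct)
    case (trig_cos s t b)
    \<comment> \<open>The phase leaves the integral as a constant factor: the cosine is the real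
      part of \<open>iexp b\<close> times the exponential.\<close>
    have cosiexp: "(\<integral>x. cos (f x + b) \<partial>N) = Re (iexp b * (\<integral>x. iexp (f x) \<partial>N))"
      if N: "prob_space N" and [measurable]: "f \<in> borel_measurable N" for f :: "'b \<Rightarrow> real" and N
    proof -
      interpret N: prob_space N by fact
      have i: "integrable N (\<lambda>x. iexp (f x))"
        by (rule N.integrable_const_bound[where B=1]) auto
      have "Re (iexp b * (\<integral>x. iexp (f x) \<partial>N)) = Re (\<integral>x. iexp b * iexp (f x) \<partial>N)" by simp
      also have "\<dots> = (\<integral>x. Re (iexp b * iexp (f x)) \<partial>N)"
        using i by (intro integral_Re[symmetric] integrable_mult_right)
      also have "(\<lambda>x. Re (iexp b * iexp (f x))) = (\<lambda>x. cos (f x + b))"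
        by (simp add: exp_add[symmetric] distrib_left[symmetric] add.commute Re_exp)
      finally show ?thesis by simp
    qed
    have "(\<lambda>N. Re (iexp b * (\<integral>x. iexp (lincomb L s (fst (X N x)) + lincomb L t (snd (X N x))) \<partial>M)))
      \<longlonglongrightarrow> Re (iexp b * (\<integral>p. iexp (lincomb L s (fst p) + lincomb L t (snd p)) \<partial>mu))"
      by (intro tendsto_Re tendsto_mult tendsto_const char)
    moreover have "(\<integral>x. cos (lincomb L s (fst (X N x)) + lincomb L t (snd (X N x)) + b) \<partial>M)
        = Re (iexp b * (\<integral>x. iexp (lincomb L s (fst (X N x)) + lincomb L t (snd (X N x))) \<partial>M))" for N
      by (rule cosiexp[OF \<open>prob_space M\<close>]) measurable
    moreover have "(\<integral>p. cos (lincomb L s (fst p) + lincomb L t (snd p) + b) \<partial>mu)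
        = Re (iexp b * (\<integral>p. iexp (lincomb L s (fst p) + lincomb L t (snd p)) \<partial>mu))"
      by (rule cosiexp[OF \<open>prob_space mu\<close>]) measurable
    ultimately show ?case by simp
  next
    case (trig_scale f a)
    then show ?case by (auto intro!: tendsto_intros)
  next
    case (trig_add f f')
    have i: "integrable N (\<lambda>x. k (Q x))"
      if N: "prob_space N" and [measurable]: "Q \<in> borel_measurable N" and k: "k \<in> trig L" for k Q and N :: "'b measure"
    proof -
      interpret N: prob_space N by fact
      have [measurable]: "k \<in> borel_measurable borel"
        using trig_continuous[OF k] by (auto intro: borel_measurable_continuous_onI)
      obtain D where D: "\<And>p. \<bar>k p\<bar> \<le> D" using trig_bounded[OF k] by blast
      show ?thesis by (rule N.integrable_const_bound[where B=D], simp add: D, measurable)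
    qed
    have "integrable mu (\<lambda>p. f p)" "integrable mu (\<lambda>p. f' p)"
      using i[of mu "\<lambda>p. p"] \<open>prob_space mu\<close> trig_add by auto
    moreover have "integrable M (\<lambda>x. f (X N x))" "integrable M (\<lambda>x. f' (X N x))" for N
      using i[of M] \<open>prob_space M\<close> trig_add by auto
    ultimately show ?case using trig_add.IH by (auto intro!: tendsto_intros)
  qed
  show ?thesis
  proof (rule LIMSEQ_I)
    fix r :: real assume "r > 0"
    \<comment> \<open>Two approximation errors of \<open>e + 2 * C * e\<close> and one convergence
      error \<open>e\<close> stay below \<open>r\<close>.\<close>
    define e where "e = r / (4 + 4 * C)"
    have e: "e > 0" using \<open>r > 0\<close> C0 by (simp add: e_def)
    obtain R1 where R1: "\<forall>\<^sub>F N in sequentially. measure M {x\<in>space M. X N x \<in> box_compl L R1} \<le> e"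
      using tight[OF e] by blast
    obtain R2 where R2: "measure mu (box_compl L R2) \<le> e"
      using prob_box_compl_small[OF \<open>prob_space mu\<close> sets_mu e] by blast
    define R where "R = max 1 (max R1 R2)"
    have R: "R > 0" "R1 \<le> R" "R2 \<le> R" by (auto simp: R_def)
    have mu_e: "measure mu {p\<in>space mu. p \<in> box_compl L R} \<le> e"
      using mu.finite_measure_mono[OF box_compl_antimono[OF R(3), of L]] R2 by (simp add: space_mu sets_mu box_compl_sets)
    obtain h where h: "h \<in> trig L" and gh: "\<And>p. supp_le L (fst p) \<and> supp_le L (snd p) \<Longrightarrow>
      \<bar>g p - h p\<bar> \<le> e + 2 * C * indicator (box_compl L R) p"
      using trig_approximation[OF g C R(1) e, of L] by blast
    have *: "\<bar>(\<integral>p. g p \<partial>mu) - (\<integral>p. h p \<partial>mu)\<bar> \<le> e + 2 * C * e"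
    proof -
      have "\<bar>(\<integral>p. g p \<partial>mu) - (\<integral>p. h p \<partial>mu)\<bar> \<le> e + 2 * C * measure mu {p\<in>space mu. p \<in> box_compl L R}"
        by (rule expectation_trig_approximation[OF \<open>prob_space mu\<close> _ _ g C h gh]) (use supp_mu in auto)
      also have "\<dots> \<le> e + 2 * C * e" using mu_e C0 by (intro add_left_mono mult_left_mono) auto
      finally show ?thesis .
    qed
    have "\<forall>\<^sub>F N in sequentially. \<bar>(\<integral>x. h (X N x) \<partial>M) - (\<integral>p. h p \<partial>mu)\<bar> < e"
      using tendstoD[OF trig_conv[OF h] e] by (simp add: dist_real_def)
    with R1 have "\<forall>\<^sub>F N in sequentially. norm ((\<integral>x. g (X N x) \<partial>M) - (\<integral>p. g p \<partial>mu)) < r"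
    proof eventually_elim
      fix N assume a: "measure M {x\<in>space M. X N x \<in> box_compl L R1} \<le> e"
        and b: "\<bar>(\<integral>x. h (X N x) \<partial>M) - (\<integral>p. h p \<partial>mu)\<bar> < e"
      have "measure M {x\<in>space M. X N x \<in> box_compl L R} \<le> measure M {x\<in>space M. X N x \<in> box_compl L R1}"
        using box_compl_antimono[OF R(2), of L] by (intro M.finite_measure_mono) auto
      then have c: "2 * C * measure M {x\<in>space M. X N x \<in> box_compl L R} \<le> 2 * C * e"
        using a C0 by (intro mult_left_mono) auto
      have "\<bar>(\<integral>x. g (X N x) \<partial>M) - (\<integral>x. h (X N x) \<partial>M)\<bar> \<le> e + 2 * C * measure M {x\<in>space M. X N x \<in> box_compl L R}"
        by (rule expectation_trig_approximation[OF \<open>prob_space M\<close> X _ g C h gh]) (use supp in auto)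
      with c b * have "\<bar>(\<integral>x. g (X N x) \<partial>M) - (\<integral>p. g p \<partial>mu)\<bar> < 3 * e + 4 * (C * e)" by linarith
      also have "\<dots> \<le> (4 + 4 * C) * e" using e by (simp add: algebra_simps)
      also have "\<dots> = r" using C0 by (simp add: e_def)
      finally show "norm ((\<integral>x. g (X N x) \<partial>M) - (\<integral>p. g p \<partial>mu)) < r" by simp
    qed
    then show "\<exists>no. \<forall>n\<ge>no. norm ((\<integral>x. g (X n x) \<partial>M) - (\<integral>p. g p \<partial>mu)) < r"
      by (simp add: eventually_sequentially)
  qed
qed

section \<open>Gaussian laws\<close>

text \<open>Image of \<open>L + 1\<close> independent standard normals under the transpose of
  \<open>w\<close>; the covariance entries are the sums over \<open>k\<close> of
  \<open>w k i * w k j\<close>.\<close>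

lemma gaussian_law_exists:
  fixes w :: "nat \<Rightarrow> nat \<Rightarrow> real"
  shows "\<exists>nu. prob_space nu \<and> sets nu = sets borel \<and> (AE y in nu. supp_le L y) \<and>
    (\<forall>s. (\<integral>y. iexp (lincomb L s y) \<partial>nu) =
      complex_of_real (exp (- (\<Sum>k\<le>L. (\<Sum>i\<le>L. s i * w k i)\<^sup>2) / 2)))"
proof -
  interpret sn: real_distribution std_normal_distribution by (rule real_dist_normal_dist)
  interpret PP: product_sigma_finite "\<lambda>_::nat. std_normal_distribution" ..
  interpret PPP: product_prob_space "\<lambda>_::nat. std_normal_distribution" "{..L}" ..
  define P where "P = PiM {..L} (\<lambda>_. std_normal_distribution)"
  have [measurable_cong]: "sets P = sets (PiM {..L} (\<lambda>_. borel))"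
    unfolding P_def by (intro sets_PiM_cong) auto
  have "prob_space P" unfolding P_def by (rule PPP.prob_space_axioms)
  define f where "f z i = (if i \<le> L then (\<Sum>k\<le>L. w k i * z k) else 0)" for z :: "nat \<Rightarrow> real" and i
  have f [measurable]: "f \<in> borel_measurable P"
  proof (rule measurable_coordinatewise_then_product)
    show "(\<lambda>z. f z i) \<in> borel_measurable P" for i unfolding f_def by (cases "i \<le> L") simp_all
  qed
  define nu where "nu = distr P borel f"
  have "(\<integral>y. iexp (lincomb L s y) \<partial>nu) =
      complex_of_real (exp (- (\<Sum>k\<le>L. (\<Sum>i\<le>L. s i * w k i)\<^sup>2) / 2))" for s
  proof -
    have "lincomb L s (f z) = (\<Sum>k\<le>L. (\<Sum>i\<le>L. s i * w k i) * z k)" for z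
    proof -
      have "lincomb L s (f z) = (\<Sum>i\<le>L. \<Sum>k\<le>L. s i * w k i * z k)"
        by (simp add: lincomb_def f_def sum_distrib_left mult_ac)
      also have "\<dots> = (\<Sum>k\<le>L. \<Sum>i\<le>L. s i * w k i * z k)" by (rule sum.swap)
      finally show ?thesis by (simp add: sum_distrib_right)
    qed
    then have "(\<integral>y. iexp (lincomb L s y) \<partial>nu) = (\<integral>z. iexp (\<Sum>k\<le>L. (\<Sum>i\<le>L. s i * w k i) * z k) \<partial>P)"
      unfolding nu_def by (subst integral_distr) auto
    also have "\<dots> = (\<integral>z. (\<Prod>k\<le>L. iexp ((\<Sum>i\<le>L. s i * w k i) * z k)) \<partial>P)"
      by (simp only: of_real_sum sum_distrib_left exp_sum finite_atMost)
    also have "\<dots> = (\<Prod>k\<le>L. char std_normal_distribution (\<Sum>i\<le>L. s i * w k i))"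
      unfolding P_def char_def
      by (rule PP.product_integral_prod) (auto intro!: sn.integrable_const_bound[where B=1])
    also have "\<dots> = complex_of_real (\<Prod>k\<le>L. exp (- (\<Sum>i\<le>L. s i * w k i)\<^sup>2 / 2))"
      by (simp add: char_std_normal_distribution)
    also have "(\<Prod>k\<le>L. exp (- (\<Sum>i\<le>L. s i * w k i)\<^sup>2 / 2)) = exp (- (\<Sum>k\<le>L. (\<Sum>i\<le>L. s i * w k i)\<^sup>2) / 2)"
      by (simp add: exp_sum[symmetric] sum_divide_distrib sum_negf)
    finally show ?thesis .
  qed
  moreover have "prob_space nu"
    unfolding nu_def using \<open>prob_space P\<close> f by (rule prob_space.prob_space_distr)
  moreover have "AE y in nu. supp_le L y"
  proof -
    have [measurable]: "(\<lambda>y. y i) \<in> borel_measurable (borel :: (nat \<Rightarrow> real) measure)" for i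
      by (rule measurable_product_coordinates)
    have "{y \<in> space borel. supp_le L y} \<in> sets borel"
      unfolding supp_le_def by measurable
    then show ?thesis
      unfolding nu_def by (subst AE_distr_iff) (auto simp: supp_le_def f_def)
  qed
  ultimately show ?thesis by (intro exI[of _ nu]) (auto simp: nu_def)
qed

lemma char_centered_normal:
  assumes "s > 0"
  shows "char (density lborel (normal_density 0 s)) t = complex_of_real (exp (- (t\<^sup>2 * s\<^sup>2) / 2))"
    and "real_distribution (density lborel (normal_density 0 s))"
proof -
  interpret sn: real_distribution std_normal_distribution by (rule real_dist_normal_dist)
  have "distributed std_normal_distribution lborel (\<lambda>x. x) (normal_density 0 1)"
    by (auto simp: distributed_def distr_id2)
  from sn.normal_density_affine[OF this, of s 0] assms
  have "distributed std_normal_distribution lborel (\<lambda>x. s * x) (normal_density 0 s)" by simp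
  then have "distr std_normal_distribution lborel (\<lambda>x. s * x) = density lborel (normal_density 0 s)"
    by (simp add: distributed_def)
  then have eq: "density lborel (normal_density 0 s) = distr std_normal_distribution borel (\<lambda>x. s * x)"
    by (simp cong: distr_cong)
  show "char (density lborel (normal_density 0 s)) t = complex_of_real (exp (- (t\<^sup>2 * s\<^sup>2) / 2))"
    unfolding eq char_def
    using fun_cong[OF char_std_normal_distribution, of "t * s"]
    by (subst integral_distr) (auto simp: char_def power_mult_distrib mult_ac)
  show "real_distribution (density lborel (normal_density 0 s))"
    unfolding eq by (rule sn.real_distribution_distr) simp
qed

text \<open>Along the ray through a direction \<open>a\<close>, homogeneity of \<open>q\<close>
  makes the characteristic function of the linear form that of a centred normal with variance
  \<open>q a\<close>, or of the point mass at 0 when \<open>q a\<close> vanishes. Levy uniqueness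
  identifies the law.\<close>

lemma gaussian_vecI:
  fixes nu :: "(nat \<Rightarrow> real) measure"
  assumes "prob_space nu" and sets_nu: "sets nu = sets borel" and supp: "AE y in nu. supp_le L y"
    and char: "\<And>s. (\<integral>y. iexp (lincomb L s y) \<partial>nu) = complex_of_real (exp (- q s / 2))"
    and q: "\<And>s. q s \<ge> 0" "\<And>t s. q (\<lambda>i. t * s i) = t\<^sup>2 * q s"
  shows "gaussian_vec L nu"
proof -
  interpret prob_space nu by fact
  have [measurable_cong]: "sets nu = sets borel" by fact
  have "(\<exists>c. distr nu borel (\<lambda>y. \<Sum>i\<le>L. a i * y i) = return borel c) \<or>
        (\<exists>m s. s > 0 \<and> distr nu borel (\<lambda>y. \<Sum>i\<le>L. a i * y i) = density lborel (normal_density m s))" for a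
  proof -
    have [measurable]: "lincomb L a \<in> borel_measurable nu"
      using measurable_lincomb[of "\<lambda>y. y" nu L a] by simp
    define D where "D = distr nu borel (lincomb L a)"
    have D: "real_distribution D" unfolding D_def by (rule real_distribution_distr) simp
    have chD: "char D t = complex_of_real (exp (- (t\<^sup>2 * q a) / 2))" for t
      using char[of "\<lambda>i. t * a i"] unfolding D_def char_def
      by (subst integral_distr) (simp_all add: q lincomb_scale)
    have eq: "(\<lambda>y. \<Sum>i\<le>L. a i * y i) = lincomb L a" by (simp add: lincomb_def fun_eq_iff)
    show ?thesis
    proof (cases "q a = 0")
      case True
      have "real_distribution (return borel (0::real))"
        by (auto simp: real_distribution_def real_distribution_axioms_def prob_space_return)
      then have "D = return borel 0"
        by (rule Levy_uniqueness[OF D])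
           (simp add: fun_eq_iff chD True, simp add: char_def integral_return)
      then show ?thesis unfolding eq D_def by blast
    next
      case False
      then have s: "sqrt (q a) > 0" using q(1)[of a] by simp
      have "D = density lborel (normal_density 0 (sqrt (q a)))"
        by (rule Levy_uniqueness[OF D char_centered_normal(2)[OF s]])
           (use q(1) in \<open>auto simp: fun_eq_iff chD char_centered_normal(1)[OF s]\<close>)
      then show ?thesis unfolding eq D_def using s by blast
    qed
  qed
  then show ?thesis unfolding gaussian_vec_def using supp by blast
qed

text \<open>The candidate limit: a product measure makes its two coordinates independent, and Fubini
  factorises its characteristic function.\<close>

lemma gaussian_pair_law:
  fixes nu :: "(nat \<Rightarrow> real) measure"
  assumes "prob_space nu" and sets_nu: "sets nu = sets borel" and supp: "AE y in nu. supp_le L y"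
  shows "prob_space (nu \<Otimes>\<^sub>M nu)" and "sets (nu \<Otimes>\<^sub>M nu) = sets borel"
    and "distr (nu \<Otimes>\<^sub>M nu) borel fst = nu" and "distr (nu \<Otimes>\<^sub>M nu) borel snd = nu"
    and "prob_space.indep_var (nu \<Otimes>\<^sub>M nu) borel fst borel snd"
    and "AE p in nu \<Otimes>\<^sub>M nu. supp_le L (fst p) \<and> supp_le L (snd p)"
    and "(\<integral>p. iexp (lincomb L s (fst p) + lincomb L t (snd p)) \<partial>(nu \<Otimes>\<^sub>M nu))
      = (\<integral>y. iexp (lincomb L s y) \<partial>nu) * (\<integral>y. iexp (lincomb L t y) \<partial>nu)"
proof -
  interpret nu: prob_space nu by fact
  interpret pair_prob_space nu nu ..
  have sets_nu' [measurable_cong]: "sets nu = sets borel" by fact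
  show p: "prob_space (nu \<Otimes>\<^sub>M nu)" by (rule prob_space_axioms)
  have bp: "sets (nu \<Otimes>\<^sub>M nu) = sets (borel \<Otimes>\<^sub>M borel)" by (intro sets_pair_measure_cong sets_nu)
  then show "sets (nu \<Otimes>\<^sub>M nu) = sets borel" by (metis borel_prod)
  show f: "distr (nu \<Otimes>\<^sub>M nu) borel fst = nu"
    using nu.distr_pair_fst[of nu] by (simp add: sets_nu cong: distr_cong)
  show s: "distr (nu \<Otimes>\<^sub>M nu) borel snd = nu"
  proof -
    have "distr (nu \<Otimes>\<^sub>M nu) borel snd = distr (distr (nu \<Otimes>\<^sub>M nu) (nu \<Otimes>\<^sub>M nu) (\<lambda>(x, y). (y, x))) borel snd"
      by (subst distr_pair_swap[symmetric]) simp
    also have "\<dots> = distr (nu \<Otimes>\<^sub>M nu) borel fst"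
      by (subst distr_distr) (auto simp: comp_def intro!: distr_cong)
    finally show ?thesis using f by simp
  qed
  show iv: "prob_space.indep_var (nu \<Otimes>\<^sub>M nu) borel fst borel snd"
    unfolding indep_var_distribution_eq f s
    using bp by (auto simp: distr_id2)
  have AE1: "AE p in nu \<Otimes>\<^sub>M nu. supp_le L (fst p)"
  proof (rule AE_distrD[where M'=borel and P="supp_le L"])
    show "fst \<in> measurable (nu \<Otimes>\<^sub>M nu) borel" by measurable
    show "AE y in distr (nu \<Otimes>\<^sub>M nu) borel fst. supp_le L y" unfolding f by (rule supp)
  qed
  have AE2: "AE p in nu \<Otimes>\<^sub>M nu. supp_le L (snd p)"
  proof (rule AE_distrD[where M'=borel and P="supp_le L"])
    show "snd \<in> measurable (nu \<Otimes>\<^sub>M nu) borel" by measurable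
    show "AE y in distr (nu \<Otimes>\<^sub>M nu) borel snd. supp_le L y" unfolding s by (rule supp)
  qed
  from AE1 AE2 show "AE p in nu \<Otimes>\<^sub>M nu. supp_le L (fst p) \<and> supp_le L (snd p)" by auto
  have "(\<integral>p. iexp (lincomb L s (fst p) + lincomb L t (snd p)) \<partial>(nu \<Otimes>\<^sub>M nu))
     = (\<integral>p. iexp (lincomb L s (fst p)) * iexp (lincomb L t (snd p)) \<partial>(nu \<Otimes>\<^sub>M nu))"
    by (simp add: distrib_left exp_add)
  also have "\<dots> = (\<integral>x. (\<integral>y. iexp (lincomb L s x) * iexp (lincomb L t y) \<partial>nu) \<partial>nu)"
    by (subst integral_fst'[symmetric]) (auto intro!: integrable_const_bound[where B=1] simp: norm_mult)
  also have "\<dots> = (\<integral>y. iexp (lincomb L s y) \<partial>nu) * (\<integral>y. iexp (lincomb L t y) \<partial>nu)"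
    by simp
  finally show "(\<integral>p. iexp (lincomb L s (fst p) + lincomb L t (snd p)) \<partial>(nu \<Otimes>\<^sub>M nu))
      = (\<integral>y. iexp (lincomb L s y) \<partial>nu) * (\<integral>y. iexp (lincomb L t y) \<partial>nu)" .
qed

section \<open>Independent noise and the central limit theorem for predictable weights\<close>

lemma abs_exp_minus_diff_le:
  fixes a b :: real
  assumes "a \<ge> 0" "b \<ge> 0"
  shows "\<bar>exp (- a) - exp (- b)\<bar> \<le> \<bar>a - b\<bar>"
proof -
  have *: "exp (- a) - exp (- b) \<le> b - a" if "0 \<le> a" "a \<le> b" for a b :: real
  proof -
    have "exp (- a) - exp (- b) = exp (- a) * (1 - exp (- (b - a)))"
      by (simp add: algebra_simps exp_add[symmetric])
    also have "\<dots> \<le> 1 * (b - a)"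
    proof (rule mult_mono)
      show "1 - exp (- (b - a)) \<le> b - a" using exp_ge_add_one_self[of "- (b - a)"] by linarith
    qed (use that in auto)
    finally show ?thesis by simp
  qed
  show ?thesis using *[of a b] *[of b a] assms by (cases "a \<le> b") (auto simp: abs_if)
qed

lemmas integrable_linear =
  Bochner_Integration.integrable_add
  Bochner_Integration.integrable_diff
  Bochner_Integration.integrable_sum

section \<open>Second moment inequalities\<close>

context prob_space
begin

lemma integrable_product_of_squares:
  fixes f g :: "'a \<Rightarrow> real"
  assumes [measurable]: "f \<in> borel_measurable M" "g \<in> borel_measurable M"
    and "integrable M (\<lambda>x. (f x)\<^sup>2)" "integrable M (\<lambda>x. (g x)\<^sup>2)"
  shows "integrable M (\<lambda>x. f x * g x)"
proof (rule Bochner_Integration.integrable_bound)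
  show "integrable M (\<lambda>x. (f x)\<^sup>2 + (g x)\<^sup>2)" using assms by auto
  have "\<bar>a * b\<bar> \<le> a\<^sup>2 + b\<^sup>2" for a b :: real
  proof -
    have "2 * (\<bar>a\<bar> * \<bar>b\<bar>) \<le> a\<^sup>2 + b\<^sup>2" using sum_squares_bound[of "\<bar>a\<bar>" "\<bar>b\<bar>"] by (simp add: mult.assoc)
    moreover have "0 \<le> \<bar>a\<bar> * \<bar>b\<bar>" by simp
    ultimately show ?thesis unfolding abs_mult by linarith
  qed
  then show "AE x in M. norm (f x * g x) \<le> norm ((f x)\<^sup>2 + (g x)\<^sup>2)" by simp
qed measurable

lemma square_integrable_add:
  fixes f g :: "'a \<Rightarrow> real"
  assumes [measurable]: "f \<in> borel_measurable M" "g \<in> borel_measurable M"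
    and "integrable M (\<lambda>x. (f x)\<^sup>2)" "integrable M (\<lambda>x. (g x)\<^sup>2)"
  shows "integrable M (\<lambda>x. (f x + g x)\<^sup>2)"
  unfolding power2_sum using assms integrable_product_of_squares[OF assms]
  by (auto simp: mult.assoc)

text \<open>The variance of the modulus is nonnegative.\<close>

lemma expectation_abs_le_sqrt:
  fixes f :: "'a \<Rightarrow> real"
  assumes [measurable]: "f \<in> borel_measurable M" and "integrable M (\<lambda>x. (f x)\<^sup>2)"
  shows "expectation (\<lambda>x. \<bar>f x\<bar>) \<le> sqrt (expectation (\<lambda>x. (f x)\<^sup>2))"
proof (rule real_le_rsqrt)
  have "integrable M f" using square_integrable_imp_integrable[OF _ assms(2)] by simp
  then have "variance (\<lambda>x. \<bar>f x\<bar>) = expectation (\<lambda>x. (f x)\<^sup>2) - (expectation (\<lambda>x. \<bar>f x\<bar>))\<^sup>2"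
    using assms by (subst variance_eq) auto
  then show "(expectation (\<lambda>x. \<bar>f x\<bar>))\<^sup>2 \<le> expectation (\<lambda>x. (f x)\<^sup>2)"
    using variance_positive[of "\<lambda>x. \<bar>f x\<bar>"] by simp
qed

end

section \<open>The noise, its filtration and conditioning on the past\<close>

locale iid_noise = prob_space M for M :: "'a measure" +
  fixes eps :: "int \<Rightarrow> 'a \<Rightarrow> real"
  assumes eps_measurable [measurable]: "\<And>n. eps n \<in> borel_measurable M"
    and eps_indep: "indep_vars (\<lambda>_. borel) eps UNIV"
    and eps_distr: "\<And>n. distr M borel (eps n) = distr M borel (eps 0)"
    and eps_square: "integrable M (\<lambda>x. (eps 0 x)\<^sup>2)"
    and eps_mean: "expectation (eps 0) = 0"
begin

definition "s2 = expectation (\<lambda>x. (eps 0 x)\<^sup>2)"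

text \<open>The sigma-algebra generated by the noises with index in \<open>I\<close>, pulled back
  from the product space. As a measure object it can stand directly in measurability statements;
  \<open>G {..<n}\<close> is the strict past of time \<open>n\<close>.\<close>

definition "G I = vimage_algebra (space M) (\<lambda>x. \<lambda>k\<in>I. eps k x) (PiM I (\<lambda>_. borel))"

lemma s2_nonneg: "s2 \<ge> 0" unfolding s2_def by simp

lemma eps_moments:
  "integrable M (\<lambda>x. (eps n x)\<^sup>2)" "expectation (\<lambda>x. (eps n x)\<^sup>2) = s2"
  "integrable M (eps n)" "expectation (eps n) = 0"
proof -
  have "integrable (distr M borel (eps 0)) (\<lambda>y. y\<^sup>2)" using eps_square by (simp add: integrable_distr_eq)
  then show 1: "integrable M (\<lambda>x. (eps n x)\<^sup>2)"
    by (subst (asm) eps_distr[of n, symmetric]) (simp add: integrable_distr_eq)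
  have "(\<integral>y. y\<^sup>2 \<partial>distr M borel (eps n)) = (\<integral>y. y\<^sup>2 \<partial>distr M borel (eps 0))" by (simp add: eps_distr[of n])
  then show "expectation (\<lambda>x. (eps n x)\<^sup>2) = s2" by (simp add: integral_distr s2_def)
  show "integrable M (eps n)" using square_integrable_imp_integrable[OF _ 1] by simp
  have "(\<integral>y. y \<partial>distr M borel (eps n)) = (\<integral>y. y \<partial>distr M borel (eps 0))" by (simp add: eps_distr[of n])
  then show "expectation (eps n) = 0" by (simp add: integral_distr eps_mean)
qed

lemma space_G [simp]: "space (G I) = space M"
  by (simp add: G_def)

lemma restrict_eps_measurable: "(\<lambda>x. \<lambda>k\<in>I. eps k x) \<in> measurable M (PiM I (\<lambda>_. borel))"
  by (rule measurable_restrict) simp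

lemma measurable_G_M: "f \<in> measurable (G I) N \<Longrightarrow> f \<in> measurable M N"
proof -
  have "sets (G I) \<subseteq> sets M"
    unfolding G_def using restrict_eps_measurable[of I]
    by (subst sets_vimage_algebra2) (auto simp: measurable_def)
  then show "f \<in> measurable (G I) N \<Longrightarrow> f \<in> measurable M N"
    by (auto simp: measurable_def)
qed

lemma eps_measurable_G: "k \<in> I \<Longrightarrow> eps k \<in> borel_measurable (G I)"
proof -
  assume k: "k \<in> I"
  have "(\<lambda>x. \<lambda>k\<in>I. eps k x) \<in> measurable (G I) (PiM I (\<lambda>_. borel))"
    unfolding G_def by (rule measurable_vimage_algebra1) (use measurable_space[OF restrict_eps_measurable] in auto)
  from measurable_compose[OF this measurable_component_singleton[OF k]] k
  show ?thesis by simp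
qed

lemma measurable_G_mono:
  assumes "I \<subseteq> J" "f \<in> measurable (G I) N"
  shows "f \<in> measurable (G J) N"
proof -
  have "(\<lambda>x. x) \<in> measurable (G J) (G I)"
    unfolding G_def[of I]
    by (rule measurable_vimage_algebra2)
       (use assms(1) in \<open>auto intro!: measurable_restrict eps_measurable_G\<close>)
  from measurable_compose[OF this assms(2)] show ?thesis by simp
qed

lemma indep_set_G: "I \<inter> J = {} \<Longrightarrow> indep_set (sets (G I)) (sets (G J))"
  using indep_var_restrict[OF eps_indep, of I J] unfolding indep_var_eq G_def sets_vimage_algebra by auto

lemma indep_var_G:
  assumes IJ: "I \<inter> J = {}" and f: "f \<in> measurable (G I) S" and g: "g \<in> measurable (G J) T"
  shows "indep_var S f T g"
proof -
  note indep_set_G[OF IJ]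
  moreover have "sigma_sets (space M) {f -` A \<inter> space M |A. A \<in> sets S} \<subseteq> sets (G I)"
    using measurable_sets[OF f] sets.top[of "G I"] by (intro sets.sigma_sets_subset') auto
  moreover have "sigma_sets (space M) {g -` A \<inter> space M |A. A \<in> sets T} \<subseteq> sets (G J)"
    using measurable_sets[OF g] sets.top[of "G J"] by (intro sets.sigma_sets_subset') auto
  ultimately show ?thesis
    unfolding indep_var_eq using measurable_G_M[OF f] measurable_G_M[OF g]
    by (auto simp: indep_sets2_eq) blast+
qed

lemma indep_var_past_eps:
  "f \<in> borel_measurable (G {..<n}) \<Longrightarrow> indep_var borel f borel (eps n)"
  by (rule indep_var_G[of "{..<n}" "{n}"]) (auto intro: eps_measurable_G)

text \<open>Conditioning on the past amounts to integrating out \<open>eps n\<close> with the past frozen.\<close>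

lemma expectation_freeze:
  fixes H :: "'a \<times> real \<Rightarrow> complex"
  assumes H [measurable]: "H \<in> borel_measurable (G {..<n} \<Otimes>\<^sub>M borel)"
    and bound: "\<And>x e. x \<in> space M \<Longrightarrow> norm (H (x, e)) \<le> B"
  shows "expectation (\<lambda>x. H (x, eps n x)) = expectation (\<lambda>x. \<integral>e. H (x, e) \<partial>distr M borel (eps 0))"
proof -
  have id [measurable]: "(\<lambda>x. x) \<in> measurable M (G {..<n})" by (rule measurable_G_M[of _ "{..<n}"]) simp
  interpret p1: prob_space "distr M (G {..<n}) (\<lambda>x. x)" by (rule prob_space_distr) simp
  interpret p2: prob_space "distr M borel (eps 0)" by (rule prob_space_distr) simp
  interpret pp: pair_prob_space "distr M (G {..<n}) (\<lambda>x. x)" "distr M borel (eps 0)" ..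
  \<comment> \<open>The joint law of the past and the present noise is a product: on rectangles this
    is the independence of disjoint noise blocks.\<close>
  have eq: "distr M (G {..<n} \<Otimes>\<^sub>M borel) (\<lambda>x. (x, eps n x)) = distr M (G {..<n}) (\<lambda>x. x) \<Otimes>\<^sub>M distr M borel (eps 0)"
  proof (rule pair_measure_eqI[symmetric])
    show "sigma_finite_measure (distr M (G {..<n}) (\<lambda>x. x))" "sigma_finite_measure (distr M borel (eps 0))" ..
    show "sets (distr M (G {..<n}) (\<lambda>x. x) \<Otimes>\<^sub>M distr M borel (eps 0))
      = sets (distr M (G {..<n} \<Otimes>\<^sub>M borel) (\<lambda>x. (x, eps n x)))"
      by (simp cong: sets_pair_measure_cong)
    fix A B assume "A \<in> sets (distr M (G {..<n}) (\<lambda>x. x))" "B \<in> sets (distr M borel (eps 0))"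
    then have A: "A \<in> sets (G {..<n})" and B [measurable]: "B \<in> sets borel" by auto
    have AM: "A \<subseteq> space M" using sets.sets_into_space[OF A] by simp
    have E: "eps n -` B \<inter> space M \<in> sets (G {n})"
      using measurable_sets[OF eps_measurable_G[of n "{n}"] B] by simp
    have "prob (A \<inter> (eps n -` B \<inter> space M)) = prob A * prob (eps n -` B \<inter> space M)"
      using indep_set_G[of "{..<n}" "{n}"] A E unfolding indep_sets2_eq by auto
    moreover have "emeasure (distr M borel (eps 0)) B = emeasure M (eps n -` B \<inter> space M)"
      unfolding eps_distr[of n, symmetric] by (rule emeasure_distr) simp_all
    moreover have "emeasure (distr M (G {..<n}) (\<lambda>x. x)) A = emeasure M A"
      using A AM by (subst emeasure_distr) (auto intro: arg_cong[where f="emeasure M"] simp: Int_absorb2)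
    moreover have "emeasure (distr M (G {..<n} \<Otimes>\<^sub>M borel) (\<lambda>x. (x, eps n x))) (A \<times> B)
        = emeasure M (A \<inter> (eps n -` B \<inter> space M))"
      using A AM by (subst emeasure_distr) (auto intro!: arg_cong[where f="emeasure M"])
    ultimately show "emeasure (distr M (G {..<n}) (\<lambda>x. x)) A * emeasure (distr M borel (eps 0)) B =
        emeasure (distr M (G {..<n} \<Otimes>\<^sub>M borel) (\<lambda>x. (x, eps n x))) (A \<times> B)"
      by (simp add: emeasure_eq_measure ennreal_mult'')
  qed
  have "expectation (\<lambda>x. H (x, eps n x)) = (\<integral>z. H z \<partial>distr M (G {..<n} \<Otimes>\<^sub>M borel) (\<lambda>x. (x, eps n x)))"
    by (rule integral_distr[symmetric]) measurable
  also have "\<dots> = (\<integral>x. (\<integral>e. H (x, e) \<partial>distr M borel (eps 0)) \<partial>distr M (G {..<n}) (\<lambda>x. x))"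
    unfolding eq
    by (rule pp.integral_fst'[symmetric])
       (auto intro!: pp.integrable_const_bound[where B=B] AE_I2 bound simp: space_pair_measure)
  also have "\<dots> = expectation (\<lambda>x. \<integral>e. H (x, e) \<partial>distr M borel (eps 0))"
    by (rule integral_distr) measurable
  finally show ?thesis .
qed

text \<open>Orthogonality of martingale differences, by induction on the largest time
  \<open>b\<close>: all that multiplies \<open>eps b\<close> in the cross term belongs to the past
  of \<open>b\<close>, so the cross term has mean 0, and the squares of \<open>f b\<close> and
  \<open>eps b\<close> are independent.\<close>

lemma orthogonal_increments:
  assumes "finite A" and f: "\<And>n. n \<in> A \<Longrightarrow> f n \<in> borel_measurable (G {..<n})"
    and sq: "\<And>n. n \<in> A \<Longrightarrow> integrable M (\<lambda>x. (f n x)\<^sup>2)"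
  shows "integrable M (\<lambda>x. (\<Sum>n\<in>A. f n x * eps n x)\<^sup>2) \<and>
    expectation (\<lambda>x. (\<Sum>n\<in>A. f n x * eps n x)\<^sup>2) = s2 * (\<Sum>n\<in>A. expectation (\<lambda>x. (f n x)\<^sup>2))"
  using assms
proof (induction A rule: finite_linorder_max_induct)
  case empty
  then show ?case by simp
next
  case (insert b A)
  define S where "S x = (\<Sum>n\<in>A. f n x * eps n x)" for x
  have IH: "integrable M (\<lambda>x. (S x)\<^sup>2)" "expectation (\<lambda>x. (S x)\<^sup>2) = s2 * (\<Sum>n\<in>A. expectation (\<lambda>x. (f n x)\<^sup>2))"
    using insert by (auto simp: S_def)
  have bA: "b \<notin> A" using insert by auto
  have SG [measurable]: "S \<in> borel_measurable (G {..<b})"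
    unfolding S_def
  proof (intro borel_measurable_sum borel_measurable_times)
    fix n assume n: "n \<in> A"
    then have "n < b" using insert by auto
    then show "f n \<in> borel_measurable (G {..<b})" "eps n \<in> borel_measurable (G {..<b})"
      using insert.prems(1)[of n] n by (auto intro: measurable_G_mono[of "{..<n}"] eps_measurable_G)
  qed
  have fG [measurable]: "f b \<in> borel_measurable (G {..<b})" using insert by auto
  have SM: "S \<in> borel_measurable M" and fM: "f b \<in> borel_measurable M"
    using measurable_G_M[OF SG] measurable_G_M[OF fG] .
  have fb: "integrable M (\<lambda>x. (f b x)\<^sup>2)" using insert by auto
  have Sf: "integrable M (\<lambda>x. S x * f b x)" by (rule integrable_product_of_squares[OF SM fM IH(1) fb])
  have i1: "indep_var borel (\<lambda>x. S x * f b x) borel (eps b)"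
    by (rule indep_var_past_eps) measurable
  have i2: "indep_var borel (\<lambda>x. (f b x)\<^sup>2) borel (\<lambda>x. (eps b x)\<^sup>2)"
  proof (rule indep_var_G[of "{..<b}" "{b}"])
    have [measurable]: "eps b \<in> borel_measurable (G {b})" by (rule eps_measurable_G) simp
    show "(\<lambda>x. (eps b x)\<^sup>2) \<in> borel_measurable (G {b})" by measurable
    show "(\<lambda>x. (f b x)\<^sup>2) \<in> borel_measurable (G {..<b})" by measurable
  qed simp
  note c1 = indep_var_lebesgue_integral[OF i1 Sf eps_moments(3)] indep_var_integrable[OF i1 Sf eps_moments(3)]
  note c2 = indep_var_lebesgue_integral[OF i2 fb eps_moments(1)] indep_var_integrable[OF i2 fb eps_moments(1)]
  have exp: "(\<Sum>n\<in>insert b A. f n x * eps n x)\<^sup>2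
      = (S x)\<^sup>2 + 2 * (S x * f b x * eps b x) + (f b x)\<^sup>2 * (eps b x)\<^sup>2" for x
    using bA insert.hyps(1) by (simp add: S_def power2_eq_square algebra_simps)
  have i3: "integrable M (\<lambda>x. (S x)\<^sup>2 + 2 * (S x * f b x * eps b x))"
    by (intro integrable_linear integrable_mult_right IH c1)
  have "expectation (\<lambda>x. (S x)\<^sup>2 + 2 * (S x * f b x * eps b x) + (f b x)\<^sup>2 * (eps b x)\<^sup>2)
    = expectation (\<lambda>x. (S x)\<^sup>2) + 2 * expectation (\<lambda>x. S x * f b x * eps b x) + expectation (\<lambda>x. (f b x)\<^sup>2 * (eps b x)\<^sup>2)"
    using IH(1) c1(2) c2(2) i3 by simp
  also have "\<dots> = s2 * (\<Sum>n\<in>A. expectation (\<lambda>x. (f n x)\<^sup>2)) + expectation (\<lambda>x. (f b x)\<^sup>2) * s2"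
    unfolding c1(1) c2(1) IH(2) eps_moments by simp
  also have "\<dots> = s2 * (\<Sum>n\<in>insert b A. expectation (\<lambda>x. (f n x)\<^sup>2))"
    using bA insert.hyps(1) by (simp add: distrib_left mult.commute)
  finally show ?case
    unfolding exp using Bochner_Integration.integrable_add[OF i3 c2(2)] by blast
qed

section \<open>Exponential martingale and central limit theorem\<close>

definition "phi = char (distr M borel (eps 0))"

lemma phi_measurable [measurable]: "phi \<in> borel_measurable borel" and phi_le_1: "norm (phi t) \<le> 1"
proof -
  interpret e: real_distribution "distr M borel (eps 0)" by (rule real_distribution_distr) simp
  show "phi \<in> borel_measurable borel" unfolding phi_def by (rule e.char_measurable)
  show "norm (phi t) \<le> 1" unfolding phi_def by (rule e.cmod_char_le_1)
qed

text \<open>Given the past, \<open>iexp (w b x * eps b x)\<close> has mean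
  \<open>phi (w b x)\<close>, so the factor of the latest time integrates to 1 and the product is
  stripped backwards in time. The lower bound \<open>k\<close> keeps the product bounded, as
  freezing the past requires.\<close>

lemma exponential_martingale:
  assumes "finite A" and w: "\<And>n. n \<in> A \<Longrightarrow> w n \<in> borel_measurable (G {..<n})"
    and k: "k > 0" "\<And>n x. n \<in> A \<Longrightarrow> x \<in> space M \<Longrightarrow> norm (phi (w n x)) \<ge> k"
  shows "expectation (\<lambda>x. \<Prod>n\<in>A. iexp (w n x * eps n x) / phi (w n x)) = 1"
  using assms(1) w k(2)
proof (induction A rule: finite_linorder_max_induct)
  case empty
  then show ?case by (simp add: prob_space)
next
  case (insert b A)
  define T where "T x = (\<Prod>n\<in>A. iexp (w n x * eps n x) / phi (w n x))" for x
  have IH: "expectation T = 1" using insert by (auto simp: T_def[abs_def])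
  have bA: "b \<notin> A" using insert by auto
  have TG [measurable]: "T \<in> borel_measurable (G {..<b})"
    unfolding T_def
  proof (intro borel_measurable_prod)
    fix n assume n: "n \<in> A"
    then have "n < b" using insert by auto
    then have [measurable]: "w n \<in> borel_measurable (G {..<b})" "eps n \<in> borel_measurable (G {..<b})"
      using insert.prems(1)[of n] n by (auto intro: measurable_G_mono[of "{..<n}"] eps_measurable_G)
    show "(\<lambda>x. iexp (w n x * eps n x) / phi (w n x)) \<in> borel_measurable (G {..<b})" by measurable
  qed
  have wG [measurable]: "w b \<in> borel_measurable (G {..<b})" using insert by auto
  have Tb: "norm (T x) \<le> (1/k) ^ card A" if "x \<in> space M" for x
  proof -
    have "norm (T x) = (\<Prod>n\<in>A. 1 / norm (phi (w n x)))"
      unfolding T_def by (simp add: prod_norm[symmetric] norm_divide)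
    also have "\<dots> \<le> (\<Prod>n\<in>A. 1 / k)"
      using insert.prems(2) that k(1) by (intro prod_mono) (auto intro!: divide_left_mono mult_pos_pos dest: less_le_trans[OF k(1)])
    finally show ?thesis by simp
  qed
  define H where "H z = T (fst z) * (iexp (w b (fst z) * snd z) / phi (w b (fst z)))" for z :: "'a \<times> real"
  have [measurable]: "H \<in> borel_measurable (G {..<b} \<Otimes>\<^sub>M borel)" unfolding H_def[abs_def] by measurable
  have Hb: "norm (H (x, e)) \<le> (1/k) ^ card A * (1/k)" if x: "x \<in> space M" for x e
  proof -
    have "k \<le> norm (phi (w b x))" using insert.prems(2)[of b x] x by auto
    then have "1 / norm (phi (w b x)) \<le> 1 / k" using k(1) by (intro divide_left_mono mult_pos_pos) auto
    then have "norm (T x) * (1 / norm (phi (w b x))) \<le> (1/k) ^ card A * (1/k)"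
      using Tb[OF x] k(1) by (intro mult_mono) auto
    then show ?thesis unfolding H_def by (simp add: norm_mult norm_divide)
  qed
  have "expectation (\<lambda>x. \<Prod>n\<in>insert b A. iexp (w n x * eps n x) / phi (w n x)) = expectation (\<lambda>x. H (x, eps b x))"
    using bA insert.hyps(1) by (simp add: H_def T_def mult.commute)
  also have "\<dots> = expectation (\<lambda>x. \<integral>e. H (x, e) \<partial>distr M borel (eps 0))"
    by (rule expectation_freeze[where B="(1/k) ^ card A * (1/k)"]) (measurable, rule Hb)
  also have "\<dots> = expectation T"
  proof (rule Bochner_Integration.integral_cong[OF refl])
    fix x assume x: "x \<in> space M"
    have "phi (w b x) \<noteq> 0" using insert.prems(2)[of b x] x k(1) by auto
    moreover have "(\<integral>e. H (x, e) \<partial>distr M borel (eps 0)) = T x * (phi (w b x) / phi (w b x))"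
      unfolding H_def fst_conv snd_conv phi_def char_def integral_mult_right_zero integral_divide_zero by simp
    ultimately show "(\<integral>e. H (x, e) \<partial>distr M borel (eps 0)) = T x" by simp
  qed
  finally show ?case using IH by simp
qed

text \<open>With \<open>P\<close> the product of the \<open>phi (w n)\<close> and \<open>v\<close>
  the target, the martingale identity writes \<open>v\<close> as the expectation of
  \<open>v * (iexp (W x) / P x)\<close>, so only the error of \<open>P\<close> relative to
  \<open>v\<close> matters. \<open>P\<close> is uniformly close to the exponential of the random sum
  of squares, and that is close to \<open>v\<close> in mean.\<close>

lemma clt_error_bound:
  assumes "finite A" and w: "\<And>n. n \<in> A \<Longrightarrow> w n \<in> borel_measurable (G {..<n})"
    and weta: "\<And>n x. n \<in> A \<Longrightarrow> x \<in> space M \<Longrightarrow> \<bar>w n x\<bar> \<le> eta"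
    and phi: "\<And>u. \<bar>u\<bar> \<le> eta \<Longrightarrow> norm (phi u - exp (- s2 * u\<^sup>2 / 2)) \<le> d * u\<^sup>2"
    and B: "\<And>x. x \<in> space M \<Longrightarrow> (\<Sum>n\<in>A. (w n x)\<^sup>2) \<le> B"
    and d: "B * d \<le> exp (- s2 * B / 2) / 2" "d \<ge> 0" and "V \<ge> 0"
  shows "norm (expectation (\<lambda>x. iexp (\<Sum>n\<in>A. w n x * eps n x)) - exp (- s2 * V / 2))
    \<le> 2 * exp (s2 * B / 2) * (B * d + s2 / 2 * expectation (\<lambda>x. \<bar>(\<Sum>n\<in>A. (w n x)\<^sup>2) - V\<bar>))"
proof -
  define Q where "Q x = (\<Sum>n\<in>A. (w n x)\<^sup>2)" for x
  define P where "P x = (\<Prod>n\<in>A. phi (w n x))" for x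
  define W where "W x = (\<Sum>n\<in>A. w n x * eps n x)" for x
  define b0 where "b0 = exp (- s2 * B / 2)"
  define v where "v = exp (- s2 * V / 2)"
  have b0: "b0 > 0" by (simp add: b0_def)
  have [measurable]: "w n \<in> borel_measurable M" if "n \<in> A" for n using w[OF that] by (rule measurable_G_M)
  have [measurable]: "Q \<in> borel_measurable M" "P \<in> borel_measurable M" "W \<in> borel_measurable M"
    unfolding Q_def P_def W_def by (auto intro!: borel_measurable_sum borel_measurable_prod measurable_compose[OF _ phi_measurable])
  have Q0: "0 \<le> Q x" for x unfolding Q_def by (simp add: sum_nonneg)
  have QB: "Q x \<le> B" if "x \<in> space M" for x using B[OF that] by (simp add: Q_def)
  \<comment> \<open>All factors have modulus at most 1, so the error of the product is at most the
    sum of the factorwise errors.\<close>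
  have PQ: "norm (P x - exp (- s2 * Q x / 2)) \<le> B * d" if x: "x \<in> space M" for x
  proof -
    have "exp (- s2 * Q x / 2) = (\<Prod>n\<in>A. exp (- s2 * (w n x)\<^sup>2 / 2))"
      using assms(1) by (simp add: Q_def exp_sum[symmetric] sum_distrib_left sum_divide_distrib sum_negf)
    then have "complex_of_real (exp (- s2 * Q x / 2)) = (\<Prod>n\<in>A. complex_of_real (exp (- s2 * (w n x)\<^sup>2 / 2)))"
      by (simp only: of_real_prod)
    then have "norm (P x - exp (- s2 * Q x / 2)) \<le> (\<Sum>n\<in>A. norm (phi (w n x) - exp (- s2 * (w n x)\<^sup>2 / 2)))"
      unfolding P_def
      by (simp only:) (rule norm_prod_diff, auto simp: phi_le_1 s2_nonneg norm_of_real simp del: of_real_exp)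
    also have "\<dots> \<le> (\<Sum>n\<in>A. d * (w n x)\<^sup>2)"
      by (intro sum_mono phi weta x)
    also have "\<dots> = d * Q x" by (simp add: Q_def sum_distrib_left)
    also have "\<dots> \<le> B * d" using mult_right_mono[OF QB[OF x] d(2)] by (simp add: mult.commute)
    finally show ?thesis .
  qed
  \<comment> \<open>The assumption on \<open>B * d\<close> is tailored to this: the error may
    consume at most half of \<open>b0\<close>.\<close>
  have Plow: "norm (P x) \<ge> b0 / 2" if x: "x \<in> space M" for x
  proof -
    have "b0 \<le> exp (- s2 * Q x / 2)"
      unfolding b0_def using QB[OF x] s2_nonneg by (simp add: mult_left_mono)
    also have "\<dots> = norm (complex_of_real (exp (- s2 * Q x / 2)))" by (simp del: of_real_exp)
    also have "\<dots> \<le> norm (P x) + norm (P x - exp (- s2 * Q x / 2))"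
      using norm_triangle_sub[of "complex_of_real (exp (- s2 * Q x / 2))" "P x"] by (simp add: norm_minus_commute)
    finally show ?thesis using PQ[OF x] d(1) by (simp add: b0_def)
  qed
  \<comment> \<open>The remaining factors have modulus at most 1, so a single factor is at least as
    large as the product.\<close>
  have phi_low: "norm (phi (w n x)) \<ge> b0 / 2" if "n \<in> A" "x \<in> space M" for n x
  proof -
    have "norm (P x) = norm (phi (w n x)) * norm (\<Prod>m\<in>A-{n}. phi (w m x))"
      unfolding P_def using that(1) assms(1) by (subst prod.remove[of A n]) (auto simp: norm_mult)
    also have "\<dots> \<le> norm (phi (w n x)) * 1"
      unfolding prod_norm[symmetric] by (intro mult_left_mono prod_le_1) (auto simp: phi_le_1)
    finally show ?thesis using Plow[OF that(2)] by simp
  qed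
  have T: "(\<Prod>n\<in>A. iexp (w n x * eps n x) / phi (w n x)) = iexp (W x) / P x" for x
    using assms(1) by (simp add: prod_dividef W_def P_def exp_sum[symmetric] sum_distrib_left)
  have mart: "expectation (\<lambda>x. iexp (W x) / P x) = 1"
    using exponential_martingale[OF assms(1) w _ phi_low] b0 unfolding T by auto
  have int1: "integrable M (\<lambda>x. iexp (W x) / P x)"
  proof (rule integrable_const_bound[where B="2/b0"])
    show "AE x in M. norm (iexp (W x) / P x) \<le> 2 / b0"
    proof (rule AE_I2)
      fix x assume x: "x \<in> space M"
      have "0 < norm (P x)" using Plow[OF x] b0 by linarith
      then show "norm (iexp (W x) / P x) \<le> 2 / b0"
        using Plow[OF x] b0 by (simp add: norm_divide divide_simps mult.commute)
    qed
  qed measurable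
  have int2: "integrable M (\<lambda>x. iexp (W x))" by (rule integrable_const_bound[where B=1]) auto
  have intQ: "integrable M Q"
    by (rule integrable_const_bound[where B=B]) (auto simp: Q0 QB)
  have pw: "norm (iexp (W x) - v * (iexp (W x) / P x)) \<le> 2 / b0 * (B * d + s2 / 2 * \<bar>Q x - V\<bar>)" if x: "x \<in> space M" for x
  proof -
    have P0: "P x \<noteq> 0" using Plow[OF x] b0 by auto
    have "iexp (W x) - v * (iexp (W x) / P x) = iexp (W x) * ((P x - v) / P x)"
      using P0 by (simp add: field_simps)
    then have "norm (iexp (W x) - v * (iexp (W x) / P x)) = norm (P x - v) / norm (P x)"
      by (simp add: norm_mult norm_divide)
    also have "\<dots> \<le> norm (P x - v) / (b0 / 2)"
      using Plow[OF x] b0 by (intro divide_left_mono mult_pos_pos) auto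
    also have "norm (P x - v) \<le> B * d + s2 / 2 * \<bar>Q x - V\<bar>"
    proof -
      have "norm (P x - v) \<le> norm (P x - exp (- s2 * Q x / 2)) + norm (complex_of_real (exp (- s2 * Q x / 2)) - complex_of_real v)"
        using norm_triangle_ineq[of "P x - exp (- s2 * Q x / 2)" "complex_of_real (exp (- s2 * Q x / 2)) - complex_of_real v"] by simp
      also have "norm (complex_of_real (exp (- s2 * Q x / 2)) - complex_of_real v) = \<bar>exp (- (s2 * Q x / 2)) - exp (- (s2 * V / 2))\<bar>"
        unfolding of_real_diff[symmetric] norm_of_real v_def by simp
      also have "\<dots> \<le> \<bar>s2 * Q x / 2 - s2 * V / 2\<bar>"
        by (rule abs_exp_minus_diff_le) (auto simp: s2_nonneg Q0 \<open>V \<ge> 0\<close>)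
      also have "\<dots> = s2 / 2 * \<bar>Q x - V\<bar>"
        using s2_nonneg by (simp add: abs_mult right_diff_distrib[symmetric] diff_divide_distrib[symmetric])
      finally show ?thesis using PQ[OF x] by simp
    qed
    finally show ?thesis using b0 by (simp add: field_simps)
  qed
  have "expectation (\<lambda>x. iexp (W x)) - v = expectation (\<lambda>x. iexp (W x) - v * (iexp (W x) / P x))"
    using int1 int2 by (simp add: mart del: times_divide_eq_right)
  then have "norm (expectation (\<lambda>x. iexp (W x)) - v) \<le> expectation (\<lambda>x. norm (iexp (W x) - v * (iexp (W x) / P x)))"
    by (simp only: integral_norm_bound)
  also have "\<dots> \<le> expectation (\<lambda>x. 2 / b0 * (B * d + s2 / 2 * \<bar>Q x - V\<bar>))"
    using int1 int2 intQ pw by (intro integral_mono) (auto simp del: times_divide_eq_right)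
  also have "\<dots> = 2 / b0 * (B * d + s2 / 2 * expectation (\<lambda>x. \<bar>Q x - V\<bar>))"
    using intQ by (simp add: prob_space)
  also have "2 / b0 = 2 * exp (s2 * B / 2)" by (simp add: b0_def exp_minus field_simps)
  finally show ?thesis by (simp add: W_def Q_def v_def)
qed

text \<open>Second order expansion from a finite variance: the cubic remainder is capped by a
  quadratic one, and the capped mean tends to 0 by dominated convergence.\<close>

lemma phi_expansion:
  assumes "d > 0"
  shows "\<exists>eta>0. \<forall>u. \<bar>u\<bar> \<le> eta \<longrightarrow> norm (phi u - exp (- s2 * u\<^sup>2 / 2)) \<le> d * u\<^sup>2"
proof -
  define m where "m n = expectation (\<lambda>x. min (6 * (eps 0 x)\<^sup>2) (1 / real (Suc n) * \<bar>eps 0 x\<bar>^3))" for n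
  have min_le: "\<bar>min a b\<bar> \<le> a" if "0 \<le> a" "0 \<le> b" for a b :: real using that by linarith
  have "m \<longlonglongrightarrow> expectation (\<lambda>x. 0)"
    unfolding m_def
  proof (rule integral_dominated_convergence[where w="\<lambda>x. 6 * (eps 0 x)\<^sup>2"])
    show "AE x in M. (\<lambda>n. min (6 * (eps 0 x)\<^sup>2) (1 / real (Suc n) * \<bar>eps 0 x\<bar>^3)) \<longlonglongrightarrow> 0"
    proof (rule AE_I2)
      fix x
      have "(\<lambda>n. 1 / real (Suc n) * \<bar>eps 0 x\<bar>^3) \<longlonglongrightarrow> 0 * \<bar>eps 0 x\<bar>^3"
        by (intro tendsto_intros LIMSEQ_Suc[OF lim_1_over_n])
      then have "(\<lambda>n. min (6 * (eps 0 x)\<^sup>2) (1 / real (Suc n) * \<bar>eps 0 x\<bar>^3)) \<longlonglongrightarrow> min (6 * (eps 0 x)\<^sup>2) 0"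
        by (intro tendsto_intros) simp
      then show "(\<lambda>n. min (6 * (eps 0 x)\<^sup>2) (1 / real (Suc n) * \<bar>eps 0 x\<bar>^3)) \<longlonglongrightarrow> 0" by simp
    qed
    show "AE x in M. norm (min (6 * (eps 0 x)\<^sup>2) (1 / real (Suc n) * \<bar>eps 0 x\<bar> ^ 3)) \<le> 6 * (eps 0 x)\<^sup>2" for n
      by (rule AE_I2, unfold real_norm_def, rule min_le) auto
  qed (use eps_moments(1) in auto)
  then have "m \<longlonglongrightarrow> 0" by simp
  then have "eventually (\<lambda>n. m n < d) sequentially" using \<open>d > 0\<close> by (rule order_tendstoD)
  then obtain n where n: "m n < d" unfolding eventually_sequentially by blast
  \<comment> \<open>The first bound limits the Taylor remainder of \<open>phi\<close> to
    \<open>d * u\<^sup>2 / 6\<close>, the second the gap between \<open>exp (- y)\<close> and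
    \<open>1 - y\<close> to \<open>d * u\<^sup>2 / 8\<close>, where
    \<open>y = s2 * u\<^sup>2 / 2\<close>.\<close>
  define eta where "eta = min (1 / real (Suc n)) (sqrt (d / (s2\<^sup>2 + 1)))"
  have "eta > 0" unfolding eta_def using \<open>d > 0\<close> by (simp add: add_nonneg_pos)
  moreover have "norm (phi u - exp (- s2 * u\<^sup>2 / 2)) \<le> d * u\<^sup>2" if u: "\<bar>u\<bar> \<le> eta" for u
  proof -
    have "norm (phi u - (1 - u\<^sup>2 * s2 / 2)) \<le> u\<^sup>2 / 6 * expectation (\<lambda>x. min (6 * (eps 0 x)\<^sup>2) (\<bar>u\<bar> * \<bar>eps 0 x\<bar>^3))"
      unfolding phi_def
      by (rule char_approx3'[OF _ eps_moments(3,1) _ _ refl]) (auto simp: eps_mean s2_def)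
    also have "\<dots> \<le> u\<^sup>2 / 6 * m n"
    proof (rule mult_left_mono)
      have int: "integrable M (\<lambda>x. min (6 * (eps 0 x)\<^sup>2) (c * \<bar>eps 0 x\<bar>^3))" if "c \<ge> 0" for c
      proof (rule Bochner_Integration.integrable_bound[of M "\<lambda>x. 6 * (eps 0 x)\<^sup>2"])
        show "AE x in M. norm (min (6 * (eps 0 x)\<^sup>2) (c * \<bar>eps 0 x\<bar>^3)) \<le> norm (6 * (eps 0 x)\<^sup>2)"
          using that min_le by simp
      qed (use eps_moments(1) in auto)
      show "expectation (\<lambda>x. min (6 * (eps 0 x)\<^sup>2) (\<bar>u\<bar> * \<bar>eps 0 x\<bar>^3)) \<le> m n"
        unfolding m_def
      proof (intro integral_mono int)
        fix x
        have "\<bar>u\<bar> * \<bar>eps 0 x\<bar>^3 \<le> 1 / real (Suc n) * \<bar>eps 0 x\<bar>^3"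
          using u by (intro mult_right_mono) (auto simp: eta_def)
        then show "min (6 * (eps 0 x)\<^sup>2) (\<bar>u\<bar> * \<bar>eps 0 x\<bar>^3) \<le> min (6 * (eps 0 x)\<^sup>2) (1 / real (Suc n) * \<bar>eps 0 x\<bar>^3)"
          by linarith
      qed auto
    qed simp
    also have "\<dots> \<le> u\<^sup>2 / 6 * d" using n by (intro mult_left_mono) auto
    finally have 1: "norm (phi u - (1 - u\<^sup>2 * s2 / 2)) \<le> d * u\<^sup>2 / 6" by (simp add: mult.commute)
    define y where "y = s2 * u\<^sup>2 / 2"
    have y0: "y \<ge> 0" using s2_nonneg by (simp add: y_def)
    have "exp (- y) \<ge> 1 - y" using exp_ge_add_one_self[of "-y"] by simp
    \<comment> \<open>Inverting the quadratic lower bound for \<open>exp y\<close> works because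
      \<open>(1 - y + y\<^sup>2 / 2) * (1 + y + y\<^sup>2 / 2)\<close> is at least 1.\<close>
    moreover have "exp (- y) \<le> 1 - y + y\<^sup>2 / 2"
    proof -
      have "1 + y + y\<^sup>2 / 2 \<le> exp y" using exp_lower_Taylor_quadratic[OF y0] by simp
      then have "exp (- y) \<le> 1 / (1 + y + y\<^sup>2 / 2)"
        using y0 by (simp add: exp_minus inverse_eq_divide)
           (intro divide_left_mono mult_pos_pos add_pos_nonneg, auto)
      also have "\<dots> \<le> 1 - y + y\<^sup>2 / 2"
      proof -
        have "(1 - y + y\<^sup>2 / 2) * (1 + y + y\<^sup>2 / 2) = 1 + (y\<^sup>2)\<^sup>2 / 4"
          by (simp add: power2_eq_square algebra_simps)
        moreover have "1 + y + y\<^sup>2 / 2 > 0" using y0 by (simp add: add_pos_nonneg)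
        ultimately show ?thesis by (simp add: pos_divide_le_eq)
      qed
      finally show ?thesis .
    qed
    ultimately have "\<bar>(1 - u\<^sup>2 * s2 / 2) - exp (- s2 * u\<^sup>2 / 2)\<bar> \<le> y\<^sup>2 / 2"
      by (auto simp: y_def mult_ac abs_if)
    then have 2: "norm (complex_of_real (1 - u\<^sup>2 * s2 / 2) - complex_of_real (exp (- s2 * u\<^sup>2 / 2))) \<le> y\<^sup>2 / 2"
      unfolding of_real_diff[symmetric] norm_of_real .
    have "u\<^sup>2 \<le> (sqrt (d / (s2\<^sup>2 + 1)))\<^sup>2"
      using u by (intro power2_le_iff_abs_le[THEN iffD2]) (use \<open>d > 0\<close> in \<open>auto simp: eta_def intro!: divide_nonneg_nonneg add_nonneg_nonneg\<close>)
    then have "u\<^sup>2 \<le> d / (s2\<^sup>2 + 1)" using \<open>d > 0\<close> by (simp add: add_nonneg_nonneg)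
    then have "(s2\<^sup>2 + 1) * u\<^sup>2 \<le> d"
      by (simp add: pos_le_divide_eq add_nonneg_pos mult.commute)
    then have "s2\<^sup>2 * u\<^sup>2 \<le> d" using zero_le_power2[of u] unfolding distrib_right mult_1 by linarith
    then have "s2\<^sup>2 * u\<^sup>2 * u\<^sup>2 \<le> d * u\<^sup>2" by (intro mult_right_mono) auto
    then have "y\<^sup>2 / 2 \<le> d * u\<^sup>2 / 8" by (simp add: y_def power2_eq_square algebra_simps)
    moreover have "d * u\<^sup>2 \<ge> 0" using \<open>d > 0\<close> by simp
    moreover have "norm (phi u - exp (- s2 * u\<^sup>2 / 2)) \<le> norm (phi u - complex_of_real (1 - u\<^sup>2 * s2 / 2))
        + norm (complex_of_real (1 - u\<^sup>2 * s2 / 2) - complex_of_real (exp (- s2 * u\<^sup>2 / 2)))"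
      using norm_triangle_ineq[of "phi u - complex_of_real (1 - u\<^sup>2 * s2 / 2)" "complex_of_real (1 - u\<^sup>2 * s2 / 2) - complex_of_real (exp (- s2 * u\<^sup>2 / 2))"] by simp
    moreover have "norm (phi u - complex_of_real (1 - u\<^sup>2 * s2 / 2)) \<le> d * u\<^sup>2 / 6" using 1 by simp
    ultimately show ?thesis using 2 by linarith
  qed
  ultimately show ?thesis by blast
qed

text \<open>The tolerance \<open>d\<close> is fixed from \<open>B\<close> and \<open>r\<close>; the
  weights eventually enter the range where the expansion of \<open>phi\<close> holds with that
  \<open>d\<close>. The variance \<open>V\<close> may vary with \<open>N\<close>, so that it need
  not converge while a truncation level is held fixed.\<close>

lemma clt_bounded_array:
  fixes w :: "nat \<Rightarrow> int \<Rightarrow> 'a \<Rightarrow> real"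
  assumes fin: "\<And>N. finite (A N)" and w: "\<And>N n. n \<in> A N \<Longrightarrow> w N n \<in> borel_measurable (G {..<n})"
    and weta: "\<And>N n x. n \<in> A N \<Longrightarrow> x \<in> space M \<Longrightarrow> \<bar>w N n x\<bar> \<le> eta N" and eta: "eta \<longlonglongrightarrow> 0"
    and B: "\<And>N x. x \<in> space M \<Longrightarrow> (\<Sum>n\<in>A N. (w N n x)\<^sup>2) \<le> B"
    and V: "\<And>N. V N \<ge> 0"
    and QV: "(\<lambda>N. expectation (\<lambda>x. \<bar>(\<Sum>n\<in>A N. (w N n x)\<^sup>2) - V N\<bar>)) \<longlonglongrightarrow> 0"
  shows "(\<lambda>N. expectation (\<lambda>x. iexp (\<Sum>n\<in>A N. w N n x * eps n x)) - exp (- s2 * V N / 2)) \<longlonglongrightarrow> 0"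
proof (rule LIMSEQ_I)
  fix r :: real assume r: "r > 0"
  let ?E = "\<lambda>N. expectation (\<lambda>x. \<bar>(\<Sum>n\<in>A N. (w N n x)\<^sup>2) - V N\<bar>)"
  let ?F = "\<lambda>N. expectation (\<lambda>x. iexp (\<Sum>n\<in>A N. w N n x * eps n x)) - exp (- s2 * V N / 2)"
  define c where "c = 2 * exp (s2 * B / 2)"
  \<comment> \<open>The first term keeps the contribution of \<open>B * d\<close> below
    \<open>r / 2\<close>, the second keeps the product of characteristic functions away from 0.
    Adding 1 avoids a zero denominator.\<close>
  define d where "d = min (r / (2 * c * (\<bar>B\<bar> + 1))) (exp (- s2 * B / 2) / (2 * (\<bar>B\<bar> + 1)))"
  have c: "c > 0" by (simp add: c_def)
  have d: "d > 0" unfolding d_def using r c by simp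
  have Bd: "B * d \<le> (\<bar>B\<bar> + 1) * d" using d by (intro mult_right_mono) auto
  also have "\<dots> \<le> exp (- s2 * B / 2) / 2"
  proof -
    have "(\<bar>B\<bar> + 1) * d \<le> (\<bar>B\<bar> + 1) * (exp (- s2 * B / 2) / (2 * (\<bar>B\<bar> + 1)))"
      by (intro mult_left_mono) (auto simp: d_def)
    also have "\<dots> = exp (- s2 * B / 2) / 2"
      using abs_ge_zero[of B] by (simp add: divide_simps)
    finally show ?thesis .
  qed
  finally have d1: "B * d \<le> exp (- s2 * B / 2) / 2" .
  have d2: "c * (B * d) \<le> r / 2"
  proof -
    have "c * (B * d) \<le> c * ((\<bar>B\<bar> + 1) * d)" using Bd c by (intro mult_left_mono) auto
    also have "\<dots> \<le> c * ((\<bar>B\<bar> + 1) * (r / (2 * c * (\<bar>B\<bar> + 1))))"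
      using c by (intro mult_left_mono) (auto simp: d_def)
    also have "\<dots> = r / 2"
      using c abs_ge_zero[of B] by (simp add: divide_simps)
    finally show ?thesis .
  qed
  obtain e0 where e0: "e0 > 0" "\<And>u. \<bar>u\<bar> \<le> e0 \<Longrightarrow> norm (phi u - exp (- s2 * u\<^sup>2 / 2)) \<le> d * u\<^sup>2"
    using phi_expansion[OF d] by blast
  have "(\<lambda>N. c * (s2 / 2 * ?E N)) \<longlonglongrightarrow> c * (s2 / 2 * 0)"
    by (intro tendsto_intros QV)
  then have "eventually (\<lambda>N. c * (s2 / 2 * ?E N) < r / 2) sequentially"
    by (rule order_tendstoD) (use r in simp)
  moreover have "eventually (\<lambda>N. eta N < e0) sequentially" using eta e0(1) by (rule order_tendstoD)
  ultimately have "eventually (\<lambda>N. norm (?F N - 0) < r) sequentially"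
  proof eventually_elim
    fix N
    assume a: "c * (s2 / 2 * ?E N) < r / 2" and b: "eta N < e0"
    have "norm (?F N)
      \<le> 2 * exp (s2 * B / 2) * (B * d + s2 / 2 * ?E N)"
    proof (rule clt_error_bound[where eta=e0])
      show "\<bar>w N n x\<bar> \<le> e0" if "n \<in> A N" "x \<in> space M" for n x using weta[OF that] b by linarith
    qed (use fin w B V d1 d e0 in auto)
    also have "\<dots> = c * (B * d) + c * (s2 / 2 * ?E N)"
      by (simp only: c_def distrib_left)
    also have "\<dots> < r" using a d2 by linarith
    finally show "norm (?F N - 0) < r" by simp
  qed
  then show "\<exists>no. \<forall>N\<ge>no. norm (?F N - 0) < r"
    by (simp add: eventually_sequentially)
qed

text \<open>Terms more than \<open>m\<close> apart use disjoint noises and are uncorrelated, so each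
  term has at most \<open>2 * m + 1\<close> partners, with covariances of at most
  \<open>4 * K\<^sup>2\<close>. The variance is thus linear in the number of terms, and the mean
  modulus is bounded by its root.\<close>

lemma finitely_dependent_sum_bound:
  assumes fin: "finite A" and f: "\<And>n. f n \<in> borel_measurable (G {n - int m..<n})"
    and K: "\<And>n x. x \<in> space M \<Longrightarrow> \<bar>f n x\<bar> \<le> K"
  shows "expectation (\<lambda>x. \<bar>\<Sum>n\<in>A. f n x - expectation (f n)\<bar>) \<le> 2 * K * sqrt (real (card A) * (2 * real m + 1))"
proof -
  define D where "D n x = f n x - expectation (f n)" for n x
  have [measurable]: "f n \<in> borel_measurable M" for n by (rule measurable_G_M[OF f])
  have DG [measurable]: "D n \<in> borel_measurable (G {n - int m..<n})" for n
    unfolding D_def using f by (intro borel_measurable_diff) auto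
  have [measurable]: "D n \<in> borel_measurable M" for n by (rule measurable_G_M[OF DG])
  have K0: "K \<ge> 0" using K[of _ 0] not_empty by fastforce
  have fint: "integrable M (f n)" for n by (rule integrable_const_bound[where B=K]) (auto simp: K)
  have Ef: "\<bar>expectation (f n)\<bar> \<le> K" for n
  proof -
    have "\<bar>expectation (f n)\<bar> \<le> expectation (\<lambda>x. \<bar>f n x\<bar>)" by (rule integral_abs_bound)
    also have "\<dots> \<le> expectation (\<lambda>x. K)" using fint K by (intro integral_mono) auto
    finally show ?thesis by (simp add: prob_space)
  qed
  have DK: "\<bar>D n x\<bar> \<le> 2 * K" if "x \<in> space M" for n x
    using K[OF that, of n] Ef[of n] by (simp add: D_def)
  have Dint: "integrable M (D n)" for n by (rule integrable_const_bound[where B="2*K"]) (auto simp: DK)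
  have D0: "expectation (D n) = 0" for n unfolding D_def using fint by (simp add: prob_space)
  have DDb: "\<bar>D n x * D k x\<bar> \<le> 4 * K\<^sup>2" if "x \<in> space M" for n k x
    using mult_mono[OF DK[OF that, of n] DK[OF that, of k]] K0 by (simp add: abs_mult power2_eq_square)
  have DDint: "integrable M (\<lambda>x. D n x * D k x)" for n k
    by (rule integrable_const_bound[where B="4*K\<^sup>2"]) (auto simp: DDb)
  have DDle: "expectation (\<lambda>x. D n x * D k x) \<le> 4 * K\<^sup>2" for n k
  proof -
    have "expectation (\<lambda>x. D n x * D k x) \<le> expectation (\<lambda>x. 4 * K\<^sup>2)"
      using DDint by (intro integral_mono) (auto intro: order_trans[OF abs_ge_self DDb])
    then show ?thesis by (simp add: prob_space)
  qed
  have DD0: "expectation (\<lambda>x. D n x * D k x) = 0" if "\<bar>n - k\<bar> > int m" for n k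
  proof -
    have "{n - int m..<n} \<inter> {k - int m..<k} = {}" using that by auto
    then have "indep_var borel (D n) borel (D k)" by (rule indep_var_G[OF _ DG DG])
    then show ?thesis using Dint D0 by (simp add: indep_var_lebesgue_integral)
  qed
  have "expectation (\<lambda>x. (\<Sum>n\<in>A. D n x)\<^sup>2) = (\<Sum>n\<in>A. \<Sum>k\<in>A. expectation (\<lambda>x. D n x * D k x))"
    unfolding power2_eq_square sum_product using DDint by (simp add: Bochner_Integration.integral_sum)
  also have "\<dots> \<le> (\<Sum>n\<in>A. (2 * real m + 1) * (4 * K\<^sup>2))"
  proof (rule sum_mono)
    fix n assume "n \<in> A"
    have "(\<Sum>k\<in>A. expectation (\<lambda>x. D n x * D k x)) = (\<Sum>k\<in>A \<inter> {n - int m..n + int m}. expectation (\<lambda>x. D n x * D k x))"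
    proof (rule sum.mono_neutral_right)
      show "\<forall>k\<in>A - A \<inter> {n - int m..n + int m}. expectation (\<lambda>x. D n x * D k x) = 0"
        by (intro ballI DD0) auto
    qed (use fin in auto)
    also have "\<dots> \<le> real (card (A \<inter> {n - int m..n + int m})) * (4 * K\<^sup>2)"
      by (rule sum_bounded_above) (rule DDle)
    also have "\<dots> \<le> real (card {n - int m..n + int m}) * (4 * K\<^sup>2)"
      by (intro mult_right_mono of_nat_mono card_mono) auto
    also have "real (card {n - int m..n + int m}) = 2 * real m + 1" by simp
    finally show "(\<Sum>k\<in>A. expectation (\<lambda>x. D n x * D k x)) \<le> (2 * real m + 1) * (4 * K\<^sup>2)" .
  qed
  also have "\<dots> = (2 * K)\<^sup>2 * (real (card A) * (2 * real m + 1))" by (simp add: power2_eq_square)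
  finally have E: "expectation (\<lambda>x. (\<Sum>n\<in>A. D n x)\<^sup>2) \<le> (2 * K)\<^sup>2 * (real (card A) * (2 * real m + 1))" .
  have "expectation (\<lambda>x. \<bar>\<Sum>n\<in>A. D n x\<bar>) \<le> sqrt (expectation (\<lambda>x. (\<Sum>n\<in>A. D n x)\<^sup>2))"
  proof (rule expectation_abs_le_sqrt)
    show "integrable M (\<lambda>x. (\<Sum>n\<in>A. D n x)\<^sup>2)"
      unfolding power2_eq_square sum_product by (intro integrable_linear DDint)
  qed measurable
  also have "\<dots> \<le> sqrt ((2 * K)\<^sup>2 * (real (card A) * (2 * real m + 1)))" using E by simp
  also have "\<dots> = 2 * K * sqrt (real (card A) * (2 * real m + 1))"
    using K0 by (simp add: real_sqrt_mult)
  finally show ?thesis by (simp add: D_def)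
qed

end

section \<open>Causal linear processes\<close>

context prob_space
begin

text \<open>The quadratic in \<open>t\<close> below is a mean square, hence nonnegative; its value
  at \<open>E / F\<close> is the claim.\<close>

lemma expectation_cauchy_schwarz:
  fixes f g :: "'a \<Rightarrow> real"
  assumes [measurable]: "f \<in> borel_measurable M" "g \<in> borel_measurable M"
    and f: "integrable M (\<lambda>x. (f x)\<^sup>2)" and g: "integrable M (\<lambda>x. (g x)\<^sup>2)"
  shows "expectation (\<lambda>x. \<bar>f x * g x\<bar>) \<le> sqrt (expectation (\<lambda>x. (f x)\<^sup>2)) * sqrt (expectation (\<lambda>x. (g x)\<^sup>2))"
proof -
  define F where "F = expectation (\<lambda>x. (f x)\<^sup>2)"
  define E where "E = expectation (\<lambda>x. \<bar>f x * g x\<bar>)"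
  define H where "H = expectation (\<lambda>x. (g x)\<^sup>2)"
  have int: "integrable M (\<lambda>x. \<bar>f x * g x\<bar>)" using integrable_product_of_squares[OF _ _ f g] by simp
  have quad: "0 \<le> t\<^sup>2 * F - 2 * t * E + H" for t
  proof -
    have "0 \<le> expectation (\<lambda>x. (t * \<bar>f x\<bar> - \<bar>g x\<bar>)\<^sup>2)" by simp
    also have "(\<lambda>x. (t * \<bar>f x\<bar> - \<bar>g x\<bar>)\<^sup>2) = (\<lambda>x. t\<^sup>2 * (f x)\<^sup>2 - 2 * t * \<bar>f x * g x\<bar> + (g x)\<^sup>2)"
      by (simp add: power2_diff power_mult_distrib abs_mult algebra_simps)
    also have "expectation \<dots> = t\<^sup>2 * F - 2 * t * E + H"
      unfolding F_def E_def H_def using f g int by simp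
    finally show ?thesis .
  qed
  have F0: "F \<ge> 0" and E0: "E \<ge> 0" and H0: "H \<ge> 0" unfolding F_def E_def H_def by auto
  have "E\<^sup>2 \<le> F * H"
  proof (cases "F = 0")
    case True
    have "E = 0"
    proof (rule ccontr)
      assume "E \<noteq> 0"
      then have "E > 0" using E0 by simp
      \<comment> \<open>For \<open>F = 0\<close> the quadratic degenerates to
        \<open>H - 2 * t * E\<close>, which is -1 at this \<open>t\<close>.\<close>
      then show False using quad[of "(H + 1) / (2 * E)"] True by (simp add: field_simps)
    qed
    then show ?thesis using True by simp
  next
    case False
    then have "F > 0" using F0 by simp
    then show ?thesis using quad[of "E / F"] by (simp add: field_simps power2_eq_square)
  qed
  then have "E \<le> sqrt (F * H)" by (rule real_le_rsqrt)
  then show ?thesis by (simp add: E_def F_def H_def real_sqrt_mult)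
qed

text \<open>Carries a uniform mean square bound to an almost sure limit, the mode in which the
  causal series converges.\<close>

lemma fatou_square:
  fixes f :: "nat \<Rightarrow> 'a \<Rightarrow> real"
  assumes [measurable]: "\<And>J. f J \<in> borel_measurable M" "g \<in> borel_measurable M"
    and lim: "AE x in M. (\<lambda>J. f J x) \<longlonglongrightarrow> g x"
    and f: "\<And>J. integrable M (\<lambda>x. (f J x)\<^sup>2)" "\<And>J. expectation (\<lambda>x. (f J x)\<^sup>2) \<le> R"
  shows "integrable M (\<lambda>x. (g x)\<^sup>2)" "expectation (\<lambda>x. (g x)\<^sup>2) \<le> R"
proof -
  have R0: "R \<ge> 0" using order_trans[OF _ f(2)[of 0]] by simp
  have "(\<integral>\<^sup>+x. ennreal ((g x)\<^sup>2) \<partial>M) = (\<integral>\<^sup>+x. liminf (\<lambda>J. ennreal ((f J x)\<^sup>2)) \<partial>M)"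
  proof (rule nn_integral_cong_AE)
    show "AE x in M. ennreal ((g x)\<^sup>2) = liminf (\<lambda>J. ennreal ((f J x)\<^sup>2))"
      using lim
    proof eventually_elim
      case (elim x)
      then have "(\<lambda>J. ennreal ((f J x)\<^sup>2)) \<longlonglongrightarrow> ennreal ((g x)\<^sup>2)" by (intro tendsto_ennrealI tendsto_power)
      then show ?case by (intro lim_imp_Liminf[symmetric]) auto
    qed
  qed
  also have "\<dots> \<le> liminf (\<lambda>J. \<integral>\<^sup>+x. ennreal ((f J x)\<^sup>2) \<partial>M)" by (rule nn_integral_liminf) measurable
  also have "\<dots> \<le> ennreal R"
  proof (rule Liminf_le)
    show "\<forall>\<^sub>F J in sequentially. (\<integral>\<^sup>+x. ennreal ((f J x)\<^sup>2) \<partial>M) \<le> ennreal R"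
      using f by (intro always_eventually allI) (subst nn_integral_eq_integral, auto intro: ennreal_leI)
  qed simp
  finally have le: "(\<integral>\<^sup>+x. ennreal ((g x)\<^sup>2) \<partial>M) \<le> ennreal R" .
  show int: "integrable M (\<lambda>x. (g x)\<^sup>2)"
    by (rule integrableI_nonneg) (use le_less_trans[OF le] in auto)
  show "expectation (\<lambda>x. (g x)\<^sup>2) \<le> R"
    using le R0 by (subst (asm) nn_integral_eq_integral[OF int]) auto
qed

end

text \<open>Cauchy-Schwarz after splitting \<open>\<bar>c i\<bar>\<close> into two equal roots. The
  sum of the \<open>\<bar>c i\<bar>\<close> comes out in front, and this is the quantity that
  causality controls.\<close>

lemma weighted_cauchy_schwarz:
  fixes a c :: "'i \<Rightarrow> real"
  shows "(\<Sum>i\<in>I. c i * a i)\<^sup>2 \<le> (\<Sum>i\<in>I. \<bar>c i\<bar>) * (\<Sum>i\<in>I. \<bar>c i\<bar> * (a i)\<^sup>2)"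
proof -
  have "(\<Sum>i\<in>I. c i * a i) = (\<Sum>i\<in>I. sqrt \<bar>c i\<bar> * (sqrt \<bar>c i\<bar> * sgn (c i) * a i))"
  proof (rule sum.cong[OF refl])
    fix i
    have "sqrt \<bar>c i\<bar> * (sqrt \<bar>c i\<bar> * sgn (c i) * a i) = (sqrt \<bar>c i\<bar> * sqrt \<bar>c i\<bar>) * sgn (c i) * a i"
      by (simp only: mult.assoc)
    then show "c i * a i = sqrt \<bar>c i\<bar> * (sqrt \<bar>c i\<bar> * sgn (c i) * a i)"
      by (auto simp: abs_mult_sgn)
  qed
  also have "\<dots>\<^sup>2 \<le> (\<Sum>i\<in>I. (sqrt \<bar>c i\<bar>)\<^sup>2) * (\<Sum>i\<in>I. (sqrt \<bar>c i\<bar> * sgn (c i) * a i)\<^sup>2)"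
    by (rule Cauchy_Schwarz_ineq_sum)
  also have "(\<Sum>i\<in>I. (sqrt \<bar>c i\<bar> * sgn (c i) * a i)\<^sup>2) = (\<Sum>i\<in>I. \<bar>c i\<bar> * (a i)\<^sup>2)"
    by (intro sum.cong refl) (auto simp: power_mult_distrib sgn_if)
  finally show ?thesis by simp
qed

locale causal_process = iid_noise M eps for M :: "'a measure" and eps +
  fixes L :: nat and Y :: "int \<Rightarrow> 'a \<Rightarrow> real" and c :: "nat \<Rightarrow> real" and mu0 :: real
  assumes Y_measurable [measurable]: "\<And>n. Y n \<in> borel_measurable M"
    and c_summable: "summable (\<lambda>j. \<bar>c j\<bar>)"
    and Y_sums: "\<And>n. AE x in M. (\<lambda>j. c j * eps (n - int j) x) sums (Y n x - mu0)"
    and Y_stationary: "strictly_stationary M Y"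
begin

text \<open>\<open>Yh n\<close> is a version of \<open>Y n\<close> measurable with respect to the noise up to time \<open>n\<close>;
  \<open>Yt m n\<close> is its bounded approximation depending only on the last \<open>m\<close> noises.\<close>

definition "C = (\<Sum>j. \<bar>c j\<bar>)"
definition "clip m u = max (- real m) (min (real m) u)"
definition "Yh n x = mu0 + (\<Sum>j. c j * eps (n - int j) x)"
definition "Yt m n x = mu0 + (\<Sum>j<m. c j * clip m (eps (n - int j) x))"
definition "tail m = expectation (\<lambda>x. (eps 0 x - clip m (eps 0 x))\<^sup>2)"
text \<open>Mean square error bound for \<open>Yt\<close>: the first \<open>m\<close> coefficients
  meet clipped noises and pay \<open>tail m\<close>, the later ones are dropped and pay
  \<open>s2\<close>. The outer \<open>C\<close> comes from the weighted Cauchy-Schwarz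
  inequality.\<close>

definition "rho m = C * (tail m * C + s2 * (C - (\<Sum>j<m. \<bar>c j\<bar>)))"

lemma clip_measurable [measurable]: "clip m \<in> borel_measurable borel"
  unfolding clip_def[abs_def] by measurable

lemma clip_diff_le: "\<bar>u - clip m u\<bar> \<le> \<bar>u\<bar>"
  by (auto simp: clip_def abs_if max_def min_def)

lemma C_nonneg: "C \<ge> 0" and sum_c_le: "finite I \<Longrightarrow> (\<Sum>j\<in>I. \<bar>c j\<bar>) \<le> C"
  unfolding C_def using c_summable by (auto intro!: suminf_nonneg sum_le_suminf)

lemma Y_eq_Yh: "AE x in M. Y n x = Yh n x"
  using Y_sums[of n] by eventually_elim (auto simp: Yh_def dest: sums_unique)

lemma Yh_past: "Yh n \<in> borel_measurable (G {..n})"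
  unfolding Yh_def
  by (intro borel_measurable_add borel_measurable_const borel_measurable_suminf borel_measurable_times eps_measurable_G) auto

lemma Yt_finite_past: "Yt m n \<in> borel_measurable (G {n - int m<..n})"
  unfolding Yt_def
proof (intro borel_measurable_add borel_measurable_const borel_measurable_sum borel_measurable_times)
  fix j assume "j \<in> {..<m}"
  then have [measurable]: "eps (n - int j) \<in> borel_measurable (G {n - int m<..n})"
    by (intro eps_measurable_G) auto
  show "(\<lambda>x. clip m (eps (n - int j) x)) \<in> borel_measurable (G {n - int m<..n})" by measurable
qed

lemma Yt_bound: "\<bar>Yt m n x\<bar> \<le> \<bar>mu0\<bar> + C * real m"
proof -
  have "\<bar>clip m u\<bar> \<le> real m" for u by (auto simp: clip_def)
  then have "\<bar>c j * clip m (eps (n - int j) x)\<bar> \<le> \<bar>c j\<bar> * real m" for j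
    unfolding abs_mult by (rule mult_left_mono) simp
  then have "\<bar>\<Sum>j<m. c j * clip m (eps (n - int j) x)\<bar> \<le> (\<Sum>j<m. \<bar>c j\<bar> * real m)"
    by (intro order_trans[OF sum_abs] sum_mono)
  also have "\<dots> \<le> C * real m" unfolding sum_distrib_right[symmetric] by (intro mult_right_mono sum_c_le) auto
  finally show ?thesis unfolding Yt_def using abs_triangle_ineq[of mu0] by (meson add_left_mono order_trans)
qed

lemma truncation_moment:
  "integrable M (\<lambda>x. (eps n x - clip m (eps n x))\<^sup>2)"
  "expectation (\<lambda>x. (eps n x - clip m (eps n x))\<^sup>2) = tail m"
proof -
  show "integrable M (\<lambda>x. (eps n x - clip m (eps n x))\<^sup>2)"
    by (rule Bochner_Integration.integrable_bound[OF eps_moments(1)[of n]])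
       (auto simp: abs_le_square_iff[symmetric] clip_diff_le)
  have "expectation (\<lambda>x. (eps n x - clip m (eps n x))\<^sup>2) = (\<integral>u. (u - clip m u)\<^sup>2 \<partial>distr M borel (eps n))"
    by (simp add: integral_distr)
  also have "\<dots> = tail m" unfolding eps_distr[of n] tail_def by (simp add: integral_distr)
  finally show "expectation (\<lambda>x. (eps n x - clip m (eps n x))\<^sup>2) = tail m" .
qed

lemma tail_nonneg: "tail m \<ge> 0" unfolding tail_def by simp

lemma tail_tendsto: "tail \<longlonglongrightarrow> 0"
proof -
  have "tail \<longlonglongrightarrow> expectation (\<lambda>x. 0)"
    unfolding tail_def
  proof (rule integral_dominated_convergence[where w="\<lambda>x. (eps 0 x)\<^sup>2"])
    show "AE x in M. (\<lambda>m. (eps 0 x - clip m (eps 0 x))\<^sup>2) \<longlonglongrightarrow> 0"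
    proof (rule AE_I2)
      fix x
      obtain N :: nat where N: "\<bar>eps 0 x\<bar> \<le> real N" using real_arch_simple by blast
      have "eventually (\<lambda>m. (eps 0 x - clip m (eps 0 x))\<^sup>2 = 0) sequentially"
        using eventually_ge_at_top[of N]
      proof eventually_elim
        case (elim m)
        then have "\<bar>eps 0 x\<bar> \<le> real m" using N by linarith
        then show ?case by (simp add: clip_def abs_le_iff min_def max_def)
      qed
      then show "(\<lambda>m. (eps 0 x - clip m (eps 0 x))\<^sup>2) \<longlonglongrightarrow> 0" by (rule tendsto_eventually)
    qed
    show "AE x in M. norm ((eps 0 x - clip m (eps 0 x))\<^sup>2) \<le> (eps 0 x)\<^sup>2" for m
      by (auto simp: abs_le_square_iff[symmetric] clip_diff_le)
  qed (use eps_moments(1) in auto)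
  then show ?thesis by simp
qed

lemma rho_nonneg: "rho m \<ge> 0"
  unfolding rho_def using C_nonneg s2_nonneg tail_nonneg sum_c_le[of "{..<m}"] by auto

lemma rho_tendsto: "rho \<longlonglongrightarrow> 0"
proof -
  have "(\<lambda>m. \<Sum>j<m. \<bar>c j\<bar>) \<longlonglongrightarrow> C" unfolding C_def by (rule summable_LIMSEQ[OF c_summable])
  then have "rho \<longlonglongrightarrow> C * (0 * C + s2 * (C - C))"
    unfolding rho_def by (intro tendsto_intros tail_tendsto)
  then show ?thesis by simp
qed

text \<open>\<open>Y n - Yt m n\<close> is a series in the clipped-off parts of the first
  \<open>m\<close> noises and the whole of the later ones. Weighted Cauchy-Schwarz bounds the
  partial sums, Fatou the limit.\<close>

lemma truncation_error:
  "integrable M (\<lambda>x. (Y n x - Yt m n x)\<^sup>2)" "expectation (\<lambda>x. (Y n x - Yt m n x)\<^sup>2) \<le> rho m"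
proof -
  define a where "a j u = (if j < m then u - clip m u else u)" for j u
  define e where "e j = (if j < m then tail m else s2)" for j
  have [measurable]: "a j \<in> borel_measurable borel" for j unfolding a_def[abs_def] by (cases "j < m") auto
  have ai: "integrable M (\<lambda>x. (a j (eps k x))\<^sup>2)" and ae: "expectation (\<lambda>x. (a j (eps k x))\<^sup>2) = e j" for j k
    unfolding a_def e_def by (cases "j < m"; simp add: truncation_moment eps_moments)+
  \<comment> \<open>Starting from \<open>m\<close> terms, every partial sum already subtracts the
    whole random part of \<open>Yt m n\<close>.\<close>
  define f where "f J x = (\<Sum>j<m+J. c j * a j (eps (n - int j) x))" for J x
  have [measurable]: "f J \<in> borel_measurable M" for J unfolding f_def by measurable
  have feq: "f J x = (\<Sum>j<m+J. c j * eps (n - int j) x) - (\<Sum>j<m. c j * clip m (eps (n - int j) x))" for J x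
  proof -
    have "f J x = (\<Sum>j<m+J. c j * eps (n - int j) x - (if j < m then c j * clip m (eps (n - int j) x) else 0))"
      unfolding f_def by (intro sum.cong) (auto simp: a_def right_diff_distrib)
    also have "\<dots> = (\<Sum>j<m+J. c j * eps (n - int j) x) - (\<Sum>j<m+J. if j < m then c j * clip m (eps (n - int j) x) else 0)"
      by (rule sum_subtractf)
    also have "(\<Sum>j<m+J. if j < m then c j * clip m (eps (n - int j) x) else 0) = (\<Sum>j<m. c j * clip m (eps (n - int j) x))"
      by (subst sum.inter_filter[symmetric]) (auto intro!: sum.cong)
    finally show ?thesis .
  qed
  have lim: "AE x in M. (\<lambda>J. f J x) \<longlonglongrightarrow> Y n x - Yt m n x"
    using Y_sums[of n]
  proof eventually_elim
    case (elim x)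
    then have "(\<lambda>J. \<Sum>j<J+m. c j * eps (n - int j) x) \<longlonglongrightarrow> Y n x - mu0"
      unfolding sums_def by (rule LIMSEQ_ignore_initial_segment)
    then have "(\<lambda>J. f J x) \<longlonglongrightarrow> Y n x - mu0 - (\<Sum>j<m. c j * clip m (eps (n - int j) x))"
      unfolding feq by (intro tendsto_diff tendsto_const) (simp add: add.commute)
    then show ?case by (simp add: Yt_def diff_diff_eq)
  qed
  have fb: "(f J x)\<^sup>2 \<le> C * (\<Sum>j<m+J. \<bar>c j\<bar> * (a j (eps (n - int j) x))\<^sup>2)" for J x
  proof -
    have "(f J x)\<^sup>2 \<le> (\<Sum>j<m+J. \<bar>c j\<bar>) * (\<Sum>j<m+J. \<bar>c j\<bar> * (a j (eps (n - int j) x))\<^sup>2)"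
      unfolding f_def by (rule weighted_cauchy_schwarz)
    also have "\<dots> \<le> C * (\<Sum>j<m+J. \<bar>c j\<bar> * (a j (eps (n - int j) x))\<^sup>2)"
      by (intro mult_right_mono sum_c_le sum_nonneg) auto
    finally show ?thesis .
  qed
  have bi: "integrable M (\<lambda>x. C * (\<Sum>j<m+J. \<bar>c j\<bar> * (a j (eps (n - int j) x))\<^sup>2))" for J
    by (intro integrable_mult_right integrable_linear ai)
  have fi: "integrable M (\<lambda>x. (f J x)\<^sup>2)" for J
    by (rule Bochner_Integration.integrable_bound[OF bi[of J]])
       (auto intro: order_trans[OF fb abs_ge_self])
  have split: "sum g {..<m+J} = sum g {..<m} + sum g {m..<m+J}" for g :: "nat \<Rightarrow> real" and J
    by (induction J) auto
  have fe: "expectation (\<lambda>x. (f J x)\<^sup>2) \<le> rho m" for J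
  proof -
    have "expectation (\<lambda>x. (f J x)\<^sup>2) \<le> expectation (\<lambda>x. C * (\<Sum>j<m+J. \<bar>c j\<bar> * (a j (eps (n - int j) x))\<^sup>2))"
      by (intro integral_mono fi bi fb)
    also have "\<dots> = C * (\<Sum>j<m+J. \<bar>c j\<bar> * e j)"
      by (simp add: Bochner_Integration.integral_sum ai ae)
    also have "(\<Sum>j<m+J. \<bar>c j\<bar> * e j) = (\<Sum>j<m. \<bar>c j\<bar> * tail m) + (\<Sum>j\<in>{m..<m+J}. \<bar>c j\<bar> * s2)"
      unfolding split[of _ J] by (simp add: e_def)
    also have "C * \<dots> \<le> rho m"
      unfolding rho_def
    proof (intro mult_left_mono add_mono C_nonneg)
      show "(\<Sum>j<m. \<bar>c j\<bar> * tail m) \<le> tail m * C"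
        using mult_right_mono[OF sum_c_le[OF finite_lessThan[of m]] tail_nonneg[of m]]
        by (simp only: sum_distrib_right[symmetric] mult.commute[of "tail m"])
      have "(\<Sum>j<m. \<bar>c j\<bar>) + (\<Sum>j\<in>{m..<m+J}. \<bar>c j\<bar>) = (\<Sum>j<m+J. \<bar>c j\<bar>)"
        by (rule split[symmetric])
      also have "\<dots> \<le> C" by (rule sum_c_le) simp
      finally have "(\<Sum>j\<in>{m..<m+J}. \<bar>c j\<bar>) \<le> C - (\<Sum>j<m. \<bar>c j\<bar>)" by simp
      then show "(\<Sum>j\<in>{m..<m+J}. \<bar>c j\<bar> * s2) \<le> s2 * (C - (\<Sum>j<m. \<bar>c j\<bar>))"
        unfolding sum_distrib_right[symmetric] mult.commute[of s2] by (rule mult_right_mono[OF _ s2_nonneg])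
    qed
    finally show ?thesis .
  qed
  have [measurable]: "Yt m n \<in> borel_measurable M" by (rule measurable_G_M[OF Yt_finite_past])
  show "integrable M (\<lambda>x. (Y n x - Yt m n x)\<^sup>2)" "expectation (\<lambda>x. (Y n x - Yt m n x)\<^sup>2) \<le> rho m"
    using fatou_square[OF _ _ lim fi fe] by auto
qed

lemma Yt_measurable [measurable]: "Yt m n \<in> borel_measurable M"
  by (rule measurable_G_M[OF Yt_finite_past])

lemma Yh_measurable [measurable]: "Yh n \<in> borel_measurable M"
  by (rule measurable_G_M[OF Yh_past])

lemma Y_square_integrable: "integrable M (\<lambda>x. (Y n x)\<^sup>2)"
proof -
  \<comment> \<open>At level 0 the approximation is the constant \<open>mu0\<close>.\<close>
  have "integrable M (\<lambda>x. (Yt 0 n x)\<^sup>2)" by (simp add: Yt_def)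
  from square_integrable_add[OF _ _ truncation_error(1)[of n 0] this]
  show ?thesis by simp
qed

end

definition l1 :: "nat \<Rightarrow> (nat \<Rightarrow> real) \<Rightarrow> real" where
  "l1 L s = (\<Sum>i\<le>L. \<bar>s i\<bar>)"

lemma l1_nonneg: "l1 L s \<ge> 0"
  unfolding l1_def by (simp add: sum_nonneg)

lemma lincomb_bound: "(\<And>i. i \<le> L \<Longrightarrow> \<bar>x i\<bar> \<le> K) \<Longrightarrow> \<bar>lincomb L s x\<bar> \<le> l1 L s * K"
  unfolding lincomb_def l1_def sum_distrib_right
  by (rule order_trans[OF sum_abs]) (auto simp: abs_mult intro!: sum_mono mult_left_mono)

lemma lincomb_square_le: "(lincomb L s x)\<^sup>2 \<le> l1 L s * (\<Sum>i\<le>L. \<bar>s i\<bar> * (x i)\<^sup>2)"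
  unfolding lincomb_def l1_def by (rule weighted_cauchy_schwarz)

lemma lincomb_square: "(lincomb L s x)\<^sup>2 = (\<Sum>i\<le>L. \<Sum>j\<le>L. s i * s j * (x i * x j))"
  unfolding lincomb_def power2_eq_square sum_product by (simp add: mult_ac)

lemma abs_le_l1: "i \<le> L \<Longrightarrow> \<bar>x i\<bar> \<le> l1 L x"
  unfolding l1_def by (rule member_le_sum) auto

lemma lincomb_abs_le_l1: "\<bar>lincomb L s x\<bar> \<le> l1 L s * l1 L x"
  by (rule lincomb_bound) (rule abs_le_l1)

lemma lincomb_diff_right: "lincomb L s x - lincomb L s y = lincomb L s (\<lambda>i. x i - y i)"
  by (simp add: lincomb_def sum_subtractf algebra_simps)

lemma abs_iexp_diff: "norm (iexp a - iexp b) \<le> \<bar>a - b\<bar>"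
proof -
  have "iexp a - iexp b = iexp b * (iexp (a - b) - 1)"
    by (simp add: right_diff_distrib exp_add[symmetric])
  then have "norm (iexp a - iexp b) = norm (iexp (a - b) - 1)" by (simp add: norm_mult)
  also have "\<dots> \<le> \<bar>a - b\<bar>" using iexp_approx1[of "a - b" 0] by simp
  finally show ?thesis .
qed

lemma sqrt_div_bound:
  fixes T :: real
  assumes "a \<le> T" "T > 0" "b \<ge> 0" "a \<ge> 0"
  shows "sqrt (a * b) / T \<le> sqrt b / sqrt T"
proof -
  have "sqrt (a * b) \<le> sqrt (T * b)" using assms by (intro real_sqrt_le_mono mult_right_mono) auto
  then have "sqrt (a * b) / T \<le> sqrt (T * b) / T" using assms by (intro divide_right_mono) auto
  also have "\<dots> = sqrt b / sqrt T"
    using assms by (simp add: real_sqrt_mult field_simps)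
  finally show ?thesis .
qed

text \<open>Both stretches share one index set, with the weight chosen by membership, so a single
  array theorem treats them jointly.\<close>

lemma sum_two_stretches:
  fixes f g :: "'i \<Rightarrow> real"
  assumes "finite A" "finite B" "A \<inter> B = {}"
  shows "(\<Sum>n\<in>A \<union> B. if n \<in> A then f n else g n) = sum f A + sum g B"
proof -
  have "(\<Sum>n\<in>B. if n \<in> A then f n else g n) = sum g B"
    using assms(3) by (intro sum.cong) auto
  then show ?thesis using assms by (subst sum.union_disjoint) auto
qed

section \<open>Regressors, their second moments and the law of large numbers\<close>

context causal_process
begin

text \<open>\<open>Z n x\<close> is the regressor vector at time \<open>n\<close>, with the intercept as coordinate 0.\<close>

definition "Z n x i = (if i = 0 then 1 else Y (n - int i) x)"
definition "Zh n x i = (if i = 0 then 1 else Yh (n - int i) x)"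
definition "Zt m n x i = (if i = 0 then 1 else Yt m (n - int i) x)"
definition "Gam i j = expectation (\<lambda>x. Z 0 x i * Z 0 x j)"
definition "quad s = (\<Sum>i\<le>L. \<Sum>j\<le>L. s i * s j * Gam i j)"
definition "Km m = 1 + \<bar>mu0\<bar> + C * real m"
text \<open>Mean error of replacing \<open>Z n x i * Z n x j\<close> by its truncated version: two
  cross terms by Cauchy-Schwarz and one product of errors. The sum of the \<open>Gam i i\<close>
  makes it uniform in the coordinates.\<close>

definition "err m = 2 * sqrt ((\<Sum>i\<le>L. Gam i i) * rho m) + rho m"

lemma Km_pos: "Km m > 0"
  unfolding Km_def using C_nonneg by (auto intro!: add_pos_nonneg)

lemma Z_measurable [measurable]: "(\<lambda>x. Z n x i) \<in> borel_measurable M"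
  and Zh_measurable [measurable]: "(\<lambda>x. Zh n x i) \<in> borel_measurable M"
  and Zt_measurable [measurable]: "(\<lambda>x. Zt m n x i) \<in> borel_measurable M"
  unfolding Z_def Zh_def Zt_def by (cases "i = 0"; simp)+

lemma Zt_bound: "\<bar>Zt m n x i\<bar> \<le> Km m"
  using Yt_bound[of m "n - int i" x] C_nonneg by (auto simp: Zt_def Km_def add_nonneg_nonneg)

text \<open>Coordinate \<open>i \<ge> 1\<close> looks back to time \<open>n - i\<close>, so the
  regressor is predictable and \<open>eps n\<close> is independent of it.\<close>

lemma Zh_past: "(\<lambda>x. Zh n x i) \<in> borel_measurable (G {..<n})"
  unfolding Zh_def
  by (cases "i = 0") (auto intro!: measurable_G_mono[OF _ Yh_past[of "n - int i"]])

text \<open>The window combines a regressor lag of at most \<open>L\<close> with the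
  \<open>m\<close> noises kept in \<open>Yt\<close>.\<close>

lemma Zt_finite_past: "i \<le> L \<Longrightarrow> (\<lambda>x. Zt m n x i) \<in> borel_measurable (G {n - int (L + m)..<n})"
  unfolding Zt_def
  by (cases "i = 0") (auto intro!: measurable_G_mono[OF _ Yt_finite_past[of m "n - int i"]])

lemma AE_Z_eq_Zh: "AE x in M. \<forall>n. Z n x = Zh n x"
proof -
  have "AE x in M. \<forall>n. Y n x = Yh n x" using Y_eq_Yh by (simp add: AE_all_countable)
  then show ?thesis by eventually_elim (auto simp: Z_def Zh_def fun_eq_iff)
qed

lemma Z_square_integrable: "integrable M (\<lambda>x. (Z n x i)\<^sup>2)"
  unfolding Z_def by (cases "i = 0") (auto intro: Y_square_integrable)

lemma ZZ_integrable: "integrable M (\<lambda>x. Z n x i * Z n x j)"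
  by (rule integrable_product_of_squares) (auto intro: Z_square_integrable)

lemma expectation_stationary:
  assumes [measurable]: "g \<in> borel_measurable (PiM I (\<lambda>_. borel))" and "finite I"
  shows "expectation (\<lambda>x. g (\<lambda>i\<in>I. Y (i + h) x)) = expectation (\<lambda>x. g (\<lambda>i\<in>I. Y i x) :: real)"
proof -
  have "expectation (\<lambda>x. g (\<lambda>i\<in>I. Y (i + h) x)) = (\<integral>y. g y \<partial>distr M (PiM I (\<lambda>_. borel)) (\<lambda>x. \<lambda>i\<in>I. Y (i + h) x))"
    by (subst integral_distr) (auto intro!: measurable_restrict)
  also have "\<dots> = (\<integral>y. g y \<partial>distr M (PiM I (\<lambda>_. borel)) (\<lambda>x. \<lambda>i\<in>I. Y i x))"
    using Y_stationary \<open>finite I\<close> unfolding strictly_stationary_def by metis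
  also have "\<dots> = expectation (\<lambda>x. g (\<lambda>i\<in>I. Y i x))"
    by (subst integral_distr) (auto intro!: measurable_restrict)
  finally show ?thesis .
qed

lemma ZZ_expectation: "expectation (\<lambda>x. Z n x i * Z n x j) = Gam i j"
proof -
  define I where "I = {- int i, - int j}"
  define g where "g y = (if i = 0 then 1 else y (- int i)) * (if j = 0 then 1 else y (- int j))" for y :: "int \<Rightarrow> real"
  have [measurable]: "g \<in> borel_measurable (PiM I (\<lambda>_. borel))"
    unfolding g_def[abs_def] I_def by (cases "i = 0"; cases "j = 0") simp_all
  have "expectation (\<lambda>x. g (\<lambda>k\<in>I. Y (k + n) x)) = expectation (\<lambda>x. g (\<lambda>k\<in>I. Y k x))"
    by (rule expectation_stationary) (measurable, simp add: I_def)
  moreover have "g (\<lambda>k\<in>I. Y (k + n) x) = Z n x i * Z n x j" for x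
    by (simp add: g_def I_def Z_def)
  moreover have "g (\<lambda>k\<in>I. Y k x) = Z 0 x i * Z 0 x j" for x
    by (simp add: g_def I_def Z_def)
  ultimately show ?thesis by (simp add: Gam_def)
qed

lemma Gam_sym: "Gam i j = Gam j i"
  unfolding Gam_def by (simp add: mult.commute)

lemma Z_second_moment: "expectation (\<lambda>x. (Z n x i)\<^sup>2) = Gam i i"
  using ZZ_expectation[of n i i] by (simp add: power2_eq_square)

lemma Gam_diag_nonneg: "Gam i i \<ge> 0"
  unfolding Z_second_moment[of 0, symmetric] by simp

lemma Z_truncation_error:
  "integrable M (\<lambda>x. (Z n x i - Zt m n x i)\<^sup>2)" "expectation (\<lambda>x. (Z n x i - Zt m n x i)\<^sup>2) \<le> rho m"
  unfolding Z_def Zt_def by (cases "i = 0"; simp add: rho_nonneg truncation_error)+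

lemma err_tendsto: "err \<longlonglongrightarrow> 0"
proof -
  have "err \<longlonglongrightarrow> 2 * sqrt ((\<Sum>i\<le>L. Gam i i) * 0) + 0"
    unfolding err_def by (intro tendsto_intros rho_tendsto)
  then show ?thesis by simp
qed

lemma ZtZt_integrable: "integrable M (\<lambda>x. Zt m n x i * Zt m n x j)"
proof (rule integrable_const_bound[where B="Km m * Km m"])
  show "AE x in M. norm (Zt m n x i * Zt m n x j) \<le> Km m * Km m"
    by (rule AE_I2) (auto simp: abs_mult intro!: mult_mono Zt_bound less_imp_le[OF Km_pos])
qed measurable

text \<open>With \<open>p\<close> the truncation error of a coordinate, the difference of products
  has two terms linear in \<open>p\<close> and one quadratic; Cauchy-Schwarz turns them into the two
  summands of \<open>err\<close>.\<close>

lemma ZZ_truncation_error: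
  assumes "i \<le> L" "j \<le> L"
  shows "expectation (\<lambda>x. \<bar>Z n x i * Z n x j - Zt m n x i * Zt m n x j\<bar>) \<le> err m"
proof -
  define p where "p i x = Z n x i - Zt m n x i" for i x
  have [measurable]: "p i \<in> borel_measurable M" for i unfolding p_def by measurable
  note pq = Z_truncation_error[of n _ m, folded p_def]
  have cs: "expectation (\<lambda>x. \<bar>Z n x k * p l x\<bar>) \<le> sqrt ((\<Sum>i\<le>L. Gam i i) * rho m)" if "k \<le> L" for k l
  proof -
    have "expectation (\<lambda>x. \<bar>Z n x k * p l x\<bar>) \<le> sqrt (Gam k k) * sqrt (expectation (\<lambda>x. (p l x)\<^sup>2))"
      using expectation_cauchy_schwarz[OF _ _ Z_square_integrable[of n k] pq(1)[of l]] by (simp add: Z_second_moment)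
    also have "\<dots> \<le> sqrt (\<Sum>i\<le>L. Gam i i) * sqrt (rho m)"
      using that by (intro mult_mono real_sqrt_le_mono pq(2) member_le_sum)
        (auto intro!: sum_nonneg Gam_diag_nonneg)
    finally show ?thesis by (simp add: real_sqrt_mult)
  qed
  have cs2: "expectation (\<lambda>x. \<bar>p i x * p j x\<bar>) \<le> rho m"
  proof -
    have "expectation (\<lambda>x. \<bar>p i x * p j x\<bar>) \<le> sqrt (expectation (\<lambda>x. (p i x)\<^sup>2)) * sqrt (expectation (\<lambda>x. (p j x)\<^sup>2))"
      by (rule expectation_cauchy_schwarz[OF _ _ pq(1) pq(1)]) measurable
    also have "\<dots> \<le> sqrt (rho m) * sqrt (rho m)"
      by (intro mult_mono real_sqrt_le_mono pq(2)) (auto simp: rho_nonneg)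
    finally show ?thesis by (simp add: rho_nonneg)
  qed
  have i1: "integrable M (\<lambda>x. \<bar>Z n x k * p l x\<bar>)" and i2: "integrable M (\<lambda>x. \<bar>p k x * p l x\<bar>)" for k l
    by (auto intro!: integrable_abs integrable_product_of_squares Z_square_integrable pq(1))
  have "expectation (\<lambda>x. \<bar>Z n x i * Z n x j - Zt m n x i * Zt m n x j\<bar>)
      \<le> expectation (\<lambda>x. \<bar>Z n x i * p j x\<bar> + \<bar>Z n x j * p i x\<bar> + \<bar>p i x * p j x\<bar>)"
  proof (rule integral_mono)
    show "integrable M (\<lambda>x. \<bar>Z n x i * Z n x j - Zt m n x i * Zt m n x j\<bar>)"
      by (intro integrable_abs integrable_linear ZZ_integrable ZtZt_integrable)
    show "integrable M (\<lambda>x. \<bar>Z n x i * p j x\<bar> + \<bar>Z n x j * p i x\<bar> + \<bar>p i x * p j x\<bar>)"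
      by (intro integrable_linear i1 i2)
    fix x
    have "Z n x i * Z n x j - Zt m n x i * Zt m n x j = Z n x i * p j x + Z n x j * p i x - p i x * p j x"
      unfolding p_def by (simp add: algebra_simps)
    then show "\<bar>Z n x i * Z n x j - Zt m n x i * Zt m n x j\<bar> \<le> \<bar>Z n x i * p j x\<bar> + \<bar>Z n x j * p i x\<bar> + \<bar>p i x * p j x\<bar>"
      by linarith
  qed
  also have "\<dots> = expectation (\<lambda>x. \<bar>Z n x i * p j x\<bar>) + expectation (\<lambda>x. \<bar>Z n x j * p i x\<bar>) + expectation (\<lambda>x. \<bar>p i x * p j x\<bar>)"
    by (subst Bochner_Integration.integral_add, (intro integrable_linear i1 i2)+)+ simp
  also have "\<dots> \<le> err m" unfolding err_def using cs[OF assms(1), of j] cs[OF assms(2), of i] cs2 by linarith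
  finally show ?thesis .
qed

lemma ZtZt_expectation: "i \<le> L \<Longrightarrow> j \<le> L \<Longrightarrow> \<bar>expectation (\<lambda>x. Zt m n x i * Zt m n x j) - Gam i j\<bar> \<le> err m"
proof -
  assume a: "i \<le> L" "j \<le> L"
  have "\<bar>expectation (\<lambda>x. Zt m n x i * Zt m n x j) - Gam i j\<bar> = \<bar>expectation (\<lambda>x. Z n x i * Z n x j - Zt m n x i * Zt m n x j)\<bar>"
    by (simp add: ZZ_integrable ZtZt_integrable ZZ_expectation abs_minus_commute)
  also have "\<dots> \<le> expectation (\<lambda>x. \<bar>Z n x i * Z n x j - Zt m n x i * Zt m n x j\<bar>)" by (rule integral_abs_bound)
  also have "\<dots> \<le> err m" by (rule ZZ_truncation_error[OF a])
  finally show ?thesis .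
qed

lemma err_nonneg: "err m \<ge> 0"
  using order_trans[OF abs_ge_zero ZtZt_expectation[of 0 0 m 0]] by simp

text \<open>Three errors: truncation, fluctuation of a finitely dependent sum, and bias of the
  truncated second moment; the first and the last cost \<open>err m\<close> each. \<open>T\<close>
  is kept apart from \<open>card A\<close> because the normalisation is the length of the stretch,
  whose first \<open>L\<close> times contribute no term.\<close>

lemma lln_bound:
  assumes "finite A" "real (card A) \<le> T" "T > 0" "i \<le> L" "j \<le> L"
  shows "expectation (\<lambda>x. \<bar>(\<Sum>n\<in>A. Z n x i * Z n x j - Gam i j) / T\<bar>)
    \<le> 2 * err m + 2 * (Km m)\<^sup>2 * sqrt (2 * real (L + m) + 1) / sqrt T"
proof -
  define f where "f n x = Zt m n x i * Zt m n x j" for n x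
  let ?a = "\<lambda>x. \<bar>(\<Sum>n\<in>A. Z n x i * Z n x j - Gam i j) / T\<bar>"
  let ?b = "\<lambda>x. ((\<Sum>n\<in>A. \<bar>Z n x i * Z n x j - f n x\<bar>) + \<bar>\<Sum>n\<in>A. f n x - expectation (f n)\<bar> + real (card A) * err m) / T"
  have fG: "f n \<in> borel_measurable (G {n - int (L + m)..<n})" for n
    unfolding f_def using assms Zt_finite_past by (intro borel_measurable_times) auto
  have fK: "\<bar>f n x\<bar> \<le> (Km m)\<^sup>2" for n x
    unfolding f_def abs_mult power2_eq_square by (intro mult_mono Zt_bound less_imp_le[OF Km_pos]) auto
  have fi: "integrable M (f n)" for n unfolding f_def by (rule ZtZt_integrable)
  have [measurable]: "f n \<in> borel_measurable M" for n using fi by auto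
  have dep: "expectation (\<lambda>x. \<bar>\<Sum>n\<in>A. f n x - expectation (f n)\<bar>) \<le> 2 * (Km m)\<^sup>2 * sqrt (real (card A) * (2 * real (L + m) + 1))"
    by (rule finitely_dependent_sum_bound[OF assms(1) fG fK])
  have i1: "integrable M (\<lambda>x. \<bar>Z n x i * Z n x j - f n x\<bar>)" for n
    by (intro integrable_abs integrable_linear ZZ_integrable fi)
  have i2: "integrable M (\<lambda>x. \<bar>\<Sum>n\<in>A. f n x - expectation (f n)\<bar>)"
    by (intro integrable_abs integrable_linear fi) auto
  have "expectation (\<lambda>x. ?a x)
      \<le> expectation (\<lambda>x. ?b x)"
  proof (rule integral_mono)
    show "integrable M (\<lambda>x. ?a x)"
      by (intro integrable_abs integrable_divide_zero integrable_linear ZZ_integrable) auto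
    show "integrable M (\<lambda>x. ?b x)"
      by (intro integrable_divide_zero integrable_linear i1 i2) auto
    fix x
    have "(\<Sum>n\<in>A. Z n x i * Z n x j - Gam i j) = (\<Sum>n\<in>A. Z n x i * Z n x j - f n x)
        + (\<Sum>n\<in>A. f n x - expectation (f n)) + (\<Sum>n\<in>A. expectation (f n) - Gam i j)"
      by (simp add: sum_subtractf)
    moreover have "\<bar>\<Sum>n\<in>A. Z n x i * Z n x j - f n x\<bar> \<le> (\<Sum>n\<in>A. \<bar>Z n x i * Z n x j - f n x\<bar>)" by (rule sum_abs)
    moreover have "\<bar>\<Sum>n\<in>A. expectation (f n) - Gam i j\<bar> \<le> real (card A) * err m"
    proof -
      have "\<bar>\<Sum>n\<in>A. expectation (f n) - Gam i j\<bar> \<le> (\<Sum>n\<in>A. \<bar>expectation (f n) - Gam i j\<bar>)" by (rule sum_abs)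
      also have "\<dots> \<le> real (card A) * err m"
        unfolding f_def using assms by (intro sum_bounded_above ZtZt_expectation)
      finally show ?thesis .
    qed
    ultimately have "\<bar>\<Sum>n\<in>A. Z n x i * Z n x j - Gam i j\<bar> \<le> (\<Sum>n\<in>A. \<bar>Z n x i * Z n x j - f n x\<bar>)
       + \<bar>\<Sum>n\<in>A. f n x - expectation (f n)\<bar> + real (card A) * err m" by linarith
    then show "?a x
      \<le> ?b x"
      using \<open>T > 0\<close> by (simp add: abs_divide divide_right_mono)
  qed
  also have "\<dots> = ((\<Sum>n\<in>A. expectation (\<lambda>x. \<bar>Z n x i * Z n x j - f n x\<bar>)) + expectation (\<lambda>x. \<bar>\<Sum>n\<in>A. f n x - expectation (f n)\<bar>) + real (card A) * err m) / T"
  proof -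
    have "integrable M (\<lambda>x. \<Sum>n\<in>A. \<bar>Z n x i * Z n x j - f n x\<bar>)" by (intro integrable_linear i1)
    then show ?thesis using i1 i2 by (simp add: Bochner_Integration.integral_sum prob_space)
  qed
  also have "\<dots> \<le> (real (card A) * err m + 2 * (Km m)\<^sup>2 * sqrt (real (card A) * (2 * real (L + m) + 1)) + real (card A) * err m) / T"
  proof (intro divide_right_mono add_mono dep order_refl)
    show "(\<Sum>n\<in>A. expectation (\<lambda>x. \<bar>Z n x i * Z n x j - f n x\<bar>)) \<le> real (card A) * err m"
      unfolding f_def using assms by (intro sum_bounded_above ZZ_truncation_error)
  qed (use assms in auto)
  also have "\<dots> = 2 * (real (card A) / T * err m) + 2 * (Km m)\<^sup>2 * (sqrt (real (card A) * (2 * real (L + m) + 1)) / T)"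
    by (simp add: add_divide_distrib)
  also have "\<dots> \<le> 2 * (1 * err m) + 2 * (Km m)\<^sup>2 * (sqrt (2 * real (L + m) + 1) / sqrt T)"
    using assms err_nonneg[of m]
    by (intro add_mono mult_left_mono mult_right_mono sqrt_div_bound) (auto simp: divide_le_eq)
  finally show ?thesis by simp
qed

text \<open>The level \<open>m\<close> is chosen to make \<open>err m\<close> small; then
  \<open>N\<close> grows with \<open>m\<close> fixed.\<close>

lemma lln:
  assumes A: "\<And>N. finite (A N)" "\<And>N. real (card (A N)) \<le> T N" and T: "filterlim T at_top sequentially"
    and ij: "i \<le> L" "j \<le> L"
  shows "(\<lambda>N. expectation (\<lambda>x. \<bar>(\<Sum>n\<in>A N. Z n x i * Z n x j - Gam i j) / T N\<bar>)) \<longlonglongrightarrow> 0"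
proof (rule LIMSEQ_I)
  fix r :: real assume r: "r > 0"
  let ?E = "\<lambda>N. expectation (\<lambda>x. \<bar>(\<Sum>n\<in>A N. Z n x i * Z n x j - Gam i j) / T N\<bar>)"
  from r have "eventually (\<lambda>m. err m < r / 4) sequentially" by (intro order_tendstoD[OF err_tendsto]) simp
  then obtain m where m: "err m < r / 4" unfolding eventually_sequentially by blast
  have "((\<lambda>N. 2 * (Km m)\<^sup>2 * sqrt (2 * real (L + m) + 1) / sqrt (T N)) \<longlongrightarrow> 0) sequentially"
    by (intro tendsto_divide_0[OF tendsto_const] filterlim_at_top_imp_at_infinity filterlim_compose[OF sqrt_at_top T])
  then have "eventually (\<lambda>N. 2 * (Km m)\<^sup>2 * sqrt (2 * real (L + m) + 1) / sqrt (T N) < r / 2) sequentially"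
    by (rule order_tendstoD) (use \<open>r > 0\<close> in simp)
  moreover have "eventually (\<lambda>N. T N > 0) sequentially"
    using T by (simp add: filterlim_at_top_dense)
  ultimately have "eventually (\<lambda>N. norm (?E N - 0) < r) sequentially"
  proof eventually_elim
    case (elim N)
    have "?E N < r"
      using lln_bound[OF A(1) A(2) elim(2) ij, of m] elim(1) m by linarith
    moreover have "?E N \<ge> 0" by simp
    ultimately show ?case unfolding real_norm_def diff_0_right by (subst abs_of_nonneg)
  qed
  then show "\<exists>no. \<forall>N\<ge>no. norm (?E N - 0) < r"
    by (simp add: eventually_sequentially)
qed

section \<open>Truncated sums of squares and the scores of the two stretches\<close>

definition "Ft s m n x = (lincomb L s (Zt m n x))\<^sup>2"

lemma lincomb_Zt_finite_past: "(\<lambda>x. lincomb L s (Zt m n x)) \<in> borel_measurable (G {n - int (L + m)..<n})"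
  unfolding lincomb_def by (intro borel_measurable_sum borel_measurable_times borel_measurable_const Zt_finite_past) simp

lemma lincomb_Zt_past: "(\<lambda>x. lincomb L s (Zt m n x)) \<in> borel_measurable (G {..<n})"
  by (rule measurable_G_mono[OF _ lincomb_Zt_finite_past]) auto

lemma lincomb_Zh_past: "(\<lambda>x. lincomb L s (Zh n x)) \<in> borel_measurable (G {..<n})"
  unfolding lincomb_def by (intro borel_measurable_sum borel_measurable_times borel_measurable_const Zh_past)

lemma lincomb_Zt_bound: "\<bar>lincomb L s (Zt m n x)\<bar> \<le> l1 L s * Km m"
  by (rule lincomb_bound) (rule Zt_bound)

lemma Ft_bound: "\<bar>Ft s m n x\<bar> \<le> (l1 L s * Km m)\<^sup>2"
  unfolding Ft_def using lincomb_Zt_bound[of s m n x] by (simp add: abs_le_square_iff[symmetric] abs_mult l1_nonneg less_imp_le[OF Km_pos])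

lemma Ft_finite_past: "Ft s m n \<in> borel_measurable (G {n - int (L + m)..<n})"
  unfolding Ft_def by (intro borel_measurable_power lincomb_Zt_finite_past)

lemma Ft_measurable [measurable]: "Ft s m n \<in> borel_measurable M"
  by (rule measurable_G_M[OF Ft_finite_past])

lemma Ft_integrable: "integrable M (Ft s m n)"
  by (rule integrable_const_bound[where B="(l1 L s * Km m)\<^sup>2"]) (use Ft_bound in auto)

lemma Ft_expectation: "\<bar>expectation (Ft s m n) - quad s\<bar> \<le> (l1 L s)\<^sup>2 * err m"
proof -
  have "expectation (Ft s m n) = (\<Sum>i\<le>L. \<Sum>j\<le>L. s i * s j * expectation (\<lambda>x. Zt m n x i * Zt m n x j))"
    unfolding Ft_def lincomb_square
    by (simp add: Bochner_Integration.integral_sum Bochner_Integration.integrable_sum ZtZt_integrable)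
  then have "expectation (Ft s m n) - quad s = (\<Sum>i\<le>L. \<Sum>j\<le>L. s i * s j * (expectation (\<lambda>x. Zt m n x i * Zt m n x j) - Gam i j))"
    by (simp add: quad_def sum_subtractf right_diff_distrib)
  also have "\<bar>\<dots>\<bar> \<le> (\<Sum>i\<le>L. \<Sum>j\<le>L. \<bar>s i\<bar> * \<bar>s j\<bar> * err m)"
    by (intro order_trans[OF sum_abs] sum_mono)
       (auto simp: abs_mult intro!: mult_left_mono ZtZt_expectation)
  also have "\<dots> = (l1 L s)\<^sup>2 * err m"
    unfolding l1_def power2_eq_square sum_product by (simp add: sum_distrib_right)
  finally show ?thesis .
qed

lemma Ft_fluctuation:
  assumes "finite A" "real (card A) \<le> T" "T > 0"
  shows "expectation (\<lambda>x. \<bar>(\<Sum>n\<in>A. Ft s m n x) / T - (\<Sum>n\<in>A. expectation (Ft s m n)) / T\<bar>)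
    \<le> 2 * (l1 L s * Km m)\<^sup>2 * (sqrt (2 * real (L + m) + 1) / sqrt T)"
proof -
  have "expectation (\<lambda>x. \<bar>(\<Sum>n\<in>A. Ft s m n x) / T - (\<Sum>n\<in>A. expectation (Ft s m n)) / T\<bar>)
      = expectation (\<lambda>x. \<bar>\<Sum>n\<in>A. Ft s m n x - expectation (Ft s m n)\<bar> / T)"
    using assms(3) by (simp add: sum_subtractf diff_divide_distrib[symmetric] abs_divide)
  also have "\<dots> \<le> 2 * (l1 L s * Km m)\<^sup>2 * sqrt (real (card A) * (2 * real (L + m) + 1)) / T"
    unfolding integral_divide_zero
    using assms finitely_dependent_sum_bound[OF assms(1) Ft_finite_past Ft_bound, of s m] by (intro divide_right_mono) auto
  also have "\<dots> = 2 * (l1 L s * Km m)\<^sup>2 * (sqrt (real (card A) * (2 * real (L + m) + 1)) / T)" by simp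
  also have "\<dots> \<le> 2 * (l1 L s * Km m)\<^sup>2 * (sqrt (2 * real (L + m) + 1) / sqrt T)"
    using assms by (intro mult_left_mono sqrt_div_bound) auto
  finally show ?thesis .
qed

lemma Ft_mean:
  assumes "finite A" "real (card A) \<le> T" "T > 0"
  shows "\<bar>(\<Sum>n\<in>A. expectation (Ft s m n)) / T - quad s\<bar> \<le> (l1 L s)\<^sup>2 * err m + \<bar>quad s\<bar> * \<bar>real (card A) / T - 1\<bar>"
proof -
  have "(\<Sum>n\<in>A. expectation (Ft s m n)) / T - quad s
      = (\<Sum>n\<in>A. expectation (Ft s m n) - quad s) / T + quad s * (real (card A) / T - 1)"
    using assms(3) by (simp add: sum_subtractf field_simps)
  also have "\<bar>\<dots>\<bar> \<le> \<bar>(\<Sum>n\<in>A. expectation (Ft s m n) - quad s) / T\<bar> + \<bar>quad s * (real (card A) / T - 1)\<bar>" by (rule abs_triangle_ineq)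
  also have "\<bar>(\<Sum>n\<in>A. expectation (Ft s m n) - quad s) / T\<bar> \<le> (real (card A) * ((l1 L s)\<^sup>2 * err m)) / T"
  proof -
    have "\<bar>\<Sum>n\<in>A. expectation (Ft s m n) - quad s\<bar> \<le> (\<Sum>n\<in>A. \<bar>expectation (Ft s m n) - quad s\<bar>)" by (rule sum_abs)
    also have "\<dots> \<le> real (card A) * ((l1 L s)\<^sup>2 * err m)" by (intro sum_bounded_above Ft_expectation)
    finally show ?thesis using assms(3) by (simp add: abs_divide divide_right_mono)
  qed
  also have "\<dots> = real (card A) / T * ((l1 L s)\<^sup>2 * err m)" by simp
  also have "\<dots> \<le> 1 * ((l1 L s)\<^sup>2 * err m)"
    using assms err_nonneg[of m] by (intro mult_right_mono) (auto simp: divide_le_eq)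
  finally show ?thesis by (simp add: abs_mult)
qed

lemma lincomb_truncation_error:
  "integrable M (\<lambda>x. (lincomb L s (Zh n x) - lincomb L s (Zt m n x))\<^sup>2)"
  "expectation (\<lambda>x. (lincomb L s (Zh n x) - lincomb L s (Zt m n x))\<^sup>2) \<le> (l1 L s)\<^sup>2 * rho m"
proof -
  have i: "integrable M (\<lambda>x. (Zh n x i - Zt m n x i)\<^sup>2)" and e: "expectation (\<lambda>x. (Zh n x i - Zt m n x i)\<^sup>2) \<le> rho m" for i
  proof -
    have ae: "AE x in M. (Z n x i - Zt m n x i)\<^sup>2 = (Zh n x i - Zt m n x i)\<^sup>2"
      using AE_Z_eq_Zh by eventually_elim simp
    show "integrable M (\<lambda>x. (Zh n x i - Zt m n x i)\<^sup>2)"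
      using Z_truncation_error(1)[of n i m] by (rule integrable_cong_AE_imp) (use ae in auto)
    have "expectation (\<lambda>x. (Z n x i - Zt m n x i)\<^sup>2) = expectation (\<lambda>x. (Zh n x i - Zt m n x i)\<^sup>2)"
      by (rule integral_cong_AE) (use ae in auto)
    then show "expectation (\<lambda>x. (Zh n x i - Zt m n x i)\<^sup>2) \<le> rho m" using Z_truncation_error(2)[of n i m] by simp
  qed
  have bi: "integrable M (\<lambda>x. l1 L s * (\<Sum>i\<le>L. \<bar>s i\<bar> * (Zh n x i - Zt m n x i)\<^sup>2))"
    by (intro integrable_mult_right integrable_linear i)
  have [measurable]: "(\<lambda>x. lincomb L s (Zh n x)) \<in> borel_measurable M" "(\<lambda>x. lincomb L s (Zt m n x)) \<in> borel_measurable M"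
    by (rule measurable_G_M[OF lincomb_Zh_past], rule measurable_G_M[OF lincomb_Zt_past])
  have le: "(lincomb L s (Zh n x) - lincomb L s (Zt m n x))\<^sup>2 \<le> l1 L s * (\<Sum>i\<le>L. \<bar>s i\<bar> * (Zh n x i - Zt m n x i)\<^sup>2)" for x
    unfolding lincomb_diff_right by (rule lincomb_square_le)
  show int: "integrable M (\<lambda>x. (lincomb L s (Zh n x) - lincomb L s (Zt m n x))\<^sup>2)"
    by (rule Bochner_Integration.integrable_bound[OF bi]) (auto intro: order_trans[OF le abs_ge_self])
  have "expectation (\<lambda>x. (lincomb L s (Zh n x) - lincomb L s (Zt m n x))\<^sup>2)
      \<le> expectation (\<lambda>x. l1 L s * (\<Sum>i\<le>L. \<bar>s i\<bar> * (Zh n x i - Zt m n x i)\<^sup>2))"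
    by (intro integral_mono int bi le)
  also have "\<dots> = l1 L s * (\<Sum>i\<le>L. \<bar>s i\<bar> * expectation (\<lambda>x. (Zh n x i - Zt m n x i)\<^sup>2))"
    using i by (simp add: Bochner_Integration.integral_sum)
  also have "\<dots> \<le> l1 L s * (\<Sum>i\<le>L. \<bar>s i\<bar> * rho m)"
    by (intro mult_left_mono sum_mono e l1_nonneg) auto
  also have "\<dots> = (l1 L s)\<^sup>2 * rho m" unfolding sum_distrib_right[symmetric] l1_def[symmetric] power2_eq_square by simp
  finally show "expectation (\<lambda>x. (lincomb L s (Zh n x) - lincomb L s (Zt m n x))\<^sup>2) \<le> (l1 L s)\<^sup>2 * rho m" .
qed

text \<open>Formed with \<open>Zh\<close>, not \<open>Z\<close>, so that the weights are exactly
  measurable with respect to the past; \<open>s\<close> and \<open>t\<close> are the test directions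
  for the two stretches.\<close>

definition "score s t A1 A2 T1 T2 x =
  (\<Sum>n\<in>A1. lincomb L s (Zh n x) * eps n x) / sqrt T1 + (\<Sum>n\<in>A2. lincomb L t (Zh n x) * eps n x) / sqrt T2"

lemma score_measurable [measurable]: "score s t A1 A2 T1 T2 \<in> borel_measurable M"
proof -
  have [measurable]: "(\<lambda>x. lincomb L s (Zh n x)) \<in> borel_measurable M" for s n
    by (rule measurable_G_M[OF lincomb_Zh_past])
  show ?thesis unfolding score_def[abs_def] by measurable
qed

text \<open>The error is again a sum of predictable weights times noises, so orthogonality gives its
  second moment. The bound does not involve the stretches, which lets \<open>m\<close> be sent to
  infinity after the sample size.\<close>

lemma score_truncation_error:
  fixes s t :: "nat \<Rightarrow> real" and m :: nat
  assumes A: "finite A1" "finite A2" "A1 \<inter> A2 = {}" "real (card A1) \<le> T1" "real (card A2) \<le> T2" and "T1 > 0" "T2 > 0"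
  defines "w \<equiv> (\<lambda>n x. if n \<in> A1 then lincomb L s (Zt m n x) / sqrt T1 else lincomb L t (Zt m n x) / sqrt T2)"
  shows "norm (expectation (\<lambda>x. iexp (score s t A1 A2 T1 T2 x)) - expectation (\<lambda>x. iexp (\<Sum>n\<in>A1 \<union> A2. w n x * eps n x)))
    \<le> sqrt (s2 * (((l1 L s)\<^sup>2 + (l1 L t)\<^sup>2) * rho m))"
proof -
  define d where "d n x = (if n \<in> A1 then (lincomb L s (Zh n x) - lincomb L s (Zt m n x)) / sqrt T1
    else (lincomb L t (Zh n x) - lincomb L t (Zt m n x)) / sqrt T2)" for n x
  let ?W = "\<lambda>x. \<Sum>n\<in>A1 \<union> A2. w n x * eps n x" and ?D = "\<lambda>x. \<Sum>n\<in>A1 \<union> A2. d n x * eps n x"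
  let ?S = "score s t A1 A2 T1 T2"
  let ?e = "expectation (\<lambda>x. iexp (?S x)) - expectation (\<lambda>x. iexp (?W x))"
  have dG: "d n \<in> borel_measurable (G {..<n})" for n
    unfolding d_def by (cases "n \<in> A1")
      (auto intro!: borel_measurable_divide borel_measurable_diff lincomb_Zh_past lincomb_Zt_past)
  have wG: "w n \<in> borel_measurable (G {..<n})" for n
    unfolding w_def by (cases "n \<in> A1") (auto intro!: borel_measurable_divide lincomb_Zt_past)
  have [measurable]: "d n \<in> borel_measurable M" "w n \<in> borel_measurable M" for n
    by (rule measurable_G_M[OF dG], rule measurable_G_M[OF wG])
  have di: "integrable M (\<lambda>x. (d n x)\<^sup>2)" for n
    unfolding d_def by (cases "n \<in> A1") (auto simp: power_divide intro!: lincomb_truncation_error)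
  have de: "expectation (\<lambda>x. (d n x)\<^sup>2) \<le> (if n \<in> A1 then (l1 L s)\<^sup>2 * rho m / T1 else (l1 L t)\<^sup>2 * rho m / T2)" for n
    unfolding d_def using \<open>T1 > 0\<close> \<open>T2 > 0\<close>
    by (cases "n \<in> A1") (auto simp: power_divide intro!: divide_right_mono lincomb_truncation_error)
  have eq: "?S x - ?W x = ?D x" for x
  proof -
    have "?S x = (\<Sum>n\<in>A1 \<union> A2. if n \<in> A1 then lincomb L s (Zh n x) * eps n x / sqrt T1 else lincomb L t (Zh n x) * eps n x / sqrt T2)"
      unfolding sum_two_stretches[OF A(1-3)] score_def by (simp add: sum_divide_distrib)
    then show ?thesis
      by (simp only: sum_subtractf[symmetric]) (intro sum.cong, auto simp: d_def w_def left_diff_distrib diff_divide_distrib)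
  qed
  have oi: "integrable M (\<lambda>x. (?D x)\<^sup>2)"
    and oe: "expectation (\<lambda>x. (?D x)\<^sup>2) = s2 * (\<Sum>n\<in>A1 \<union> A2. expectation (\<lambda>x. (d n x)\<^sup>2))"
    using orthogonal_increments[of "A1 \<union> A2" d] A dG di by auto
  have "(\<Sum>n\<in>A1 \<union> A2. expectation (\<lambda>x. (d n x)\<^sup>2)) \<le> real (card A1) * ((l1 L s)\<^sup>2 * rho m / T1) + real (card A2) * ((l1 L t)\<^sup>2 * rho m / T2)"
  proof -
    have "(\<Sum>n\<in>A1 \<union> A2. expectation (\<lambda>x. (d n x)\<^sup>2))
        \<le> (\<Sum>n\<in>A1 \<union> A2. if n \<in> A1 then (l1 L s)\<^sup>2 * rho m / T1 else (l1 L t)\<^sup>2 * rho m / T2)"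
      by (intro sum_mono de)
    then show ?thesis unfolding sum_two_stretches[OF A(1-3)] by simp
  qed
  also have "\<dots> = real (card A1) / T1 * ((l1 L s)\<^sup>2 * rho m) + real (card A2) / T2 * ((l1 L t)\<^sup>2 * rho m)" by simp
  also have "\<dots> \<le> 1 * ((l1 L s)\<^sup>2 * rho m) + 1 * ((l1 L t)\<^sup>2 * rho m)"
    using A \<open>T1 > 0\<close> \<open>T2 > 0\<close> rho_nonneg[of m] by (intro add_mono mult_right_mono) (auto simp: divide_le_eq)
  finally have sum_le: "(\<Sum>n\<in>A1 \<union> A2. expectation (\<lambda>x. (d n x)\<^sup>2)) \<le> ((l1 L s)\<^sup>2 + (l1 L t)\<^sup>2) * rho m"
    by (simp add: distrib_right)
  have ii: "integrable M (\<lambda>x. iexp (?S x))" "integrable M (\<lambda>x. iexp (?W x))"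
    by (rule integrable_const_bound[where B=1], (auto)[2])+
  have i1: "integrable M (\<lambda>x. ?D x)"
    using square_integrable_imp_integrable[OF _ oi] by simp
  have "norm (?e)
      = norm (expectation (\<lambda>x. iexp (?S x) - iexp (?W x)))"
    using ii by (subst Bochner_Integration.integral_diff) auto
  also have "\<dots> \<le> expectation (\<lambda>x. norm (iexp (?S x) - iexp (?W x)))"
    by (rule integral_norm_bound)
  also have "\<dots> \<le> expectation (\<lambda>x. \<bar>?D x\<bar>)"
  proof (rule integral_mono)
    show "integrable M (\<lambda>x. norm (iexp (?S x) - iexp (?W x)))"
      by (intro integrable_norm integrable_linear ii)
    show "integrable M (\<lambda>x. \<bar>?D x\<bar>)" using i1 by simp
    show "norm (iexp (?S x) - iexp (?W x)) \<le> \<bar>?D x\<bar>" for x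
      using abs_iexp_diff[of "?S x" "?W x"] unfolding eq .
  qed
  also have "\<dots> \<le> sqrt (s2 * (\<Sum>n\<in>A1 \<union> A2. expectation (\<lambda>x. (d n x)\<^sup>2)))"
    unfolding oe[symmetric] by (rule expectation_abs_le_sqrt[OF _ oi]) measurable
  also have "\<dots> \<le> sqrt (s2 * (((l1 L s)\<^sup>2 + (l1 L t)\<^sup>2) * rho m))"
    by (intro real_sqrt_le_mono mult_left_mono sum_le s2_nonneg)
  finally show ?thesis .
qed

lemma quad_eq: "quad v = expectation (\<lambda>x. (lincomb L v (Z 0 x))\<^sup>2)"
  unfolding quad_def lincomb_square by (simp add: Bochner_Integration.integral_sum Bochner_Integration.integrable_sum ZZ_integrable ZZ_expectation)

text \<open>For fixed \<open>m\<close> the truncated weights meet the array theorem with variance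
  \<open>VV m N\<close>, which differs from \<open>quad s + quad t\<close> by a multiple of
  \<open>err m\<close> and by the deviation of the cardinality ratios from 1.\<close>

lemma score_clt:
  assumes A: "\<And>N. finite (A1 N)" "\<And>N. finite (A2 N)" "\<And>N. A1 N \<inter> A2 N = {}"
    and card: "\<And>N. real (card (A1 N)) \<le> T1 N" "\<And>N. real (card (A2 N)) \<le> T2 N"
    and T: "filterlim T1 at_top sequentially" "filterlim T2 at_top sequentially"
    and ratio: "(\<lambda>N. real (card (A1 N)) / T1 N) \<longlonglongrightarrow> 1" "(\<lambda>N. real (card (A2 N)) / T2 N) \<longlonglongrightarrow> 1"
  shows "(\<lambda>N. expectation (\<lambda>x. iexp (score s t (A1 N) (A2 N) (T1 N) (T2 N) x)))
    \<longlonglongrightarrow> complex_of_real (exp (- s2 * (quad s + quad t) / 2))"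
proof -
  define w where "w m N n x = (if n \<in> A1 N then lincomb L s (Zt m n x) / sqrt (T1 N) else lincomb L t (Zt m n x) / sqrt (T2 N))" for m N n x
  \<comment> \<open>The mean of the sum of squared truncated weights; its distance to
    \<open>quad s + quad t\<close> becomes small only when both \<open>m\<close> and
    \<open>N\<close> are large.\<close>
  define VV where "VV m N = (\<Sum>n\<in>A1 N. expectation (Ft s m n)) / T1 N + (\<Sum>n\<in>A2 N. expectation (Ft t m n)) / T2 N" for m N
  have T0: "T1 N \<ge> 0" "T2 N \<ge> 0" for N using card[of N] by (auto intro: order_trans[OF of_nat_0_le_iff])
  have Tpos: "eventually (\<lambda>N. T1 N > 0 \<and> T2 N > 0) sequentially"
    using T by (auto simp: filterlim_at_top_dense intro: eventually_conj)
  have lim_inv: "(\<lambda>N. k / sqrt (T1 N)) \<longlonglongrightarrow> 0" "(\<lambda>N. k / sqrt (T2 N)) \<longlonglongrightarrow> 0" for k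
    by (intro tendsto_divide_0[OF tendsto_const] filterlim_at_top_imp_at_infinity filterlim_compose[OF sqrt_at_top] T)+
  have Qeq: "(\<Sum>n\<in>A1 N \<union> A2 N. (w m N n x)\<^sup>2) = (\<Sum>n\<in>A1 N. Ft s m n x) / T1 N + (\<Sum>n\<in>A2 N. Ft t m n x) / T2 N" for m N x
  proof -
    have "(\<Sum>n\<in>A1 N \<union> A2 N. (w m N n x)\<^sup>2) = (\<Sum>n\<in>A1 N \<union> A2 N. if n \<in> A1 N then Ft s m n x / T1 N else Ft t m n x / T2 N)"
      using T0 by (intro sum.cong) (auto simp: w_def Ft_def power_divide)
    then show ?thesis unfolding sum_two_stretches[OF A] by (simp add: sum_divide_distrib)
  qed
  have Fle: "(\<Sum>n\<in>A. Ft s m n x) / T \<le> (l1 L s * Km m)\<^sup>2" if "real (card A) \<le> T" for A :: "int set" and T s m x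
  proof (cases "T > 0")
    case True
    have "(\<Sum>n\<in>A. Ft s m n x) \<le> real (card A) * (l1 L s * Km m)\<^sup>2"
      by (rule sum_bounded_above) (rule order_trans[OF abs_ge_self Ft_bound])
    also have "\<dots> \<le> T * (l1 L s * Km m)\<^sup>2" using that by (intro mult_right_mono) auto
    finally show ?thesis using True by (simp add: divide_le_eq mult.commute)
  next
    case False
    then have "T = 0" using order_trans[OF of_nat_0_le_iff that] by simp
    \<comment> \<open>Division by 0 has the value 0, so an empty stretch is harmless.\<close>
    then show ?thesis by simp
  qed
  have VV0: "VV m N \<ge> 0" for m N
    unfolding VV_def using T0 by (auto intro!: add_nonneg_nonneg divide_nonneg_nonneg sum_nonneg simp: Ft_def)
  have trunc_clt: "(\<lambda>N. expectation (\<lambda>x. iexp (\<Sum>n\<in>A1 N \<union> A2 N. w m N n x * eps n x)) - exp (- s2 * VV m N / 2)) \<longlonglongrightarrow> 0" for m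
  proof (rule clt_bounded_array[where eta="\<lambda>N. (l1 L s * Km m) / sqrt (T1 N) + (l1 L t * Km m) / sqrt (T2 N)"
        and B="(l1 L s * Km m)\<^sup>2 + (l1 L t * Km m)\<^sup>2"])
    show "finite (A1 N \<union> A2 N)" for N using A by simp
    show "w m N n \<in> borel_measurable (G {..<n})" for N n
      unfolding w_def by (cases "n \<in> A1 N") (auto intro!: borel_measurable_divide lincomb_Zt_past)
    show "\<bar>w m N n x\<bar> \<le> (l1 L s * Km m) / sqrt (T1 N) + (l1 L t * Km m) / sqrt (T2 N)" for N n x
    proof -
      have p: "l1 L u * Km m / sqrt a \<ge> 0" if "a \<ge> 0" for u a
        using that l1_nonneg[of L u] Km_pos[of m] by simp
      have "\<bar>w m N n x\<bar> \<le> (if n \<in> A1 N then (l1 L s * Km m) / sqrt (T1 N) else (l1 L t * Km m) / sqrt (T2 N))"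
        unfolding w_def using T0 by (auto simp: abs_divide intro!: divide_right_mono lincomb_Zt_bound)
      then show ?thesis using p[of "T1 N" s] p[of "T2 N" t] T0 by (auto split: if_splits)
    qed
    show "(\<lambda>N. (l1 L s * Km m) / sqrt (T1 N) + (l1 L t * Km m) / sqrt (T2 N)) \<longlonglongrightarrow> 0"
      using tendsto_add[OF lim_inv(1) lim_inv(2)] by simp
    show "(\<Sum>n\<in>A1 N \<union> A2 N. (w m N n x)\<^sup>2) \<le> (l1 L s * Km m)\<^sup>2 + (l1 L t * Km m)\<^sup>2" for N x
      unfolding Qeq by (intro add_mono Fle card)
    show "VV m N \<ge> 0" for N by (rule VV0)
    show "(\<lambda>N. expectation (\<lambda>x. \<bar>(\<Sum>n\<in>A1 N \<union> A2 N. (w m N n x)\<^sup>2) - VV m N\<bar>)) \<longlonglongrightarrow> 0"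
    proof (rule tendsto_sandwich[OF _ _ tendsto_const])
      let ?q = "\<lambda>N. expectation (\<lambda>x. \<bar>(\<Sum>n\<in>A1 N \<union> A2 N. (w m N n x)\<^sup>2) - VV m N\<bar>)"
      let ?b = "\<lambda>u T. 2 * (l1 L u * Km m)\<^sup>2 * (sqrt (2 * real (L + m) + 1) / sqrt T)"
      show "\<forall>\<^sub>F N in sequentially. 0 \<le> ?q N" by simp
      show "\<forall>\<^sub>F N in sequentially. ?q N \<le> ?b s (T1 N) + ?b t (T2 N)"
        using Tpos
      proof eventually_elim
        case (elim N)
        define a where "a x = (\<Sum>n\<in>A1 N. Ft s m n x) / T1 N - (\<Sum>n\<in>A1 N. expectation (Ft s m n)) / T1 N" for x
        define b where "b x = (\<Sum>n\<in>A2 N. Ft t m n x) / T2 N - (\<Sum>n\<in>A2 N. expectation (Ft t m n)) / T2 N" for x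
        have "integrable M a" "integrable M b"
          unfolding a_def b_def by (intro integrable_linear integrable_divide_zero Ft_integrable integrable_const)+
        note i = this
        have "?q N = expectation (\<lambda>x. \<bar>a x + b x\<bar>)"
          unfolding Qeq VV_def a_def b_def by (simp add: algebra_simps)
        also have "\<dots> \<le> expectation (\<lambda>x. \<bar>a x\<bar> + \<bar>b x\<bar>)" using i by (intro integral_mono) auto
        also have "\<dots> = expectation (\<lambda>x. \<bar>a x\<bar>) + expectation (\<lambda>x. \<bar>b x\<bar>)" using i by simp
        also have "\<dots> \<le> ?b s (T1 N) + ?b t (T2 N)"
          unfolding a_def b_def using elim by (intro add_mono Ft_fluctuation A card) auto
        finally show ?case .
      qed
      have "(\<lambda>N. ?b s (T1 N) + ?b t (T2 N)) \<longlonglongrightarrow> 2 * (l1 L s * Km m)\<^sup>2 * 0 + 2 * (l1 L t * Km m)\<^sup>2 * 0"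
        by (intro tendsto_intros lim_inv)
      then show "(\<lambda>N. ?b s (T1 N) + ?b t (T2 N)) \<longlonglongrightarrow> 0" by simp
    qed
  qed
  define K where "K = (l1 L s)\<^sup>2 + (l1 L t)\<^sup>2"
  have quad_nonneg: "quad u \<ge> 0" for u unfolding quad_eq by simp
  let ?S = "\<lambda>N. expectation (\<lambda>x. iexp (score s t (A1 N) (A2 N) (T1 N) (T2 N) x))" and ?l = "complex_of_real (exp (- s2 * (quad s + quad t) / 2))"
  show ?thesis
  proof (rule LIMSEQ_I)
    fix r :: real assume r: "r > 0"
    have "(\<lambda>m. sqrt (s2 * (K * rho m))) \<longlonglongrightarrow> sqrt (s2 * (K * 0))" by (intro tendsto_intros rho_tendsto)
    then have e1: "eventually (\<lambda>m. sqrt (s2 * (K * rho m)) < r / 4) sequentially" by (rule order_tendstoD) (use r in simp)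
    have "(\<lambda>m. s2 / 2 * (K * err m)) \<longlonglongrightarrow> s2 / 2 * (K * 0)" by (intro tendsto_intros err_tendsto)
    then have e2: "eventually (\<lambda>m. s2 / 2 * (K * err m) < r / 4) sequentially" by (rule order_tendstoD) (use r in simp)
    \<comment> \<open>\<open>m\<close> is fixed before \<open>N\<close>; truncation of the score and
      bias of the variance take \<open>r / 4\<close> each, the two limits in \<open>N\<close> the
      rest.\<close>
    obtain m where m: "sqrt (s2 * (K * rho m)) < r / 4" "s2 / 2 * (K * err m) < r / 4"
      using eventually_conj[OF e1 e2] unfolding eventually_sequentially by blast
    let ?R = "\<lambda>N. \<bar>quad s\<bar> * \<bar>real (card (A1 N)) / T1 N - 1\<bar> + \<bar>quad t\<bar> * \<bar>real (card (A2 N)) / T2 N - 1\<bar>"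
    have "(\<lambda>N. s2 / 2 * ?R N) \<longlonglongrightarrow> s2 / 2 * (\<bar>quad s\<bar> * \<bar>1 - 1\<bar> + \<bar>quad t\<bar> * \<bar>1 - 1\<bar>)"
      by (intro tendsto_intros ratio)
    then have e3: "eventually (\<lambda>N. s2 / 2 * ?R N < r / 4) sequentially" by (rule order_tendstoD) (use r in simp)
    have e4: "eventually (\<lambda>N. norm (expectation (\<lambda>x. iexp (\<Sum>n\<in>A1 N \<union> A2 N. w m N n x * eps n x)) - exp (- s2 * VV m N / 2)) < r / 4) sequentially"
      using tendstoD[OF trunc_clt[of m], of "r/4"] r by (simp add: dist_norm)
    from e3 e4 Tpos
    have "eventually (\<lambda>N. norm (?S N - ?l) < r) sequentially"
    proof eventually_elim
      case (elim N)
      let ?W = "expectation (\<lambda>x. iexp (\<Sum>n\<in>A1 N \<union> A2 N. w m N n x * eps n x))"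
      let ?v = "complex_of_real (exp (- s2 * VV m N / 2))"
      have 1: "norm (?S N - ?W) < r / 4"
        using score_truncation_error[OF A(1)[of N] A(2)[of N] A(3)[of N] card(1)[of N] card(2)[of N], where s=s and t=t and m=m] elim m(1) unfolding w_def K_def by auto
      have 2: "norm (?W - ?v) < r / 4" using elim by simp
      have "norm (?v - ?l) = \<bar>exp (- (s2 * VV m N / 2)) - exp (- (s2 * (quad s + quad t) / 2))\<bar>"
        unfolding of_real_diff[symmetric] norm_of_real by simp
      also have "\<dots> \<le> \<bar>s2 * VV m N / 2 - s2 * (quad s + quad t) / 2\<bar>"
        by (rule abs_exp_minus_diff_le) (auto simp: s2_nonneg VV0 quad_nonneg)
      also have "\<dots> = s2 / 2 * \<bar>VV m N - (quad s + quad t)\<bar>"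
        using s2_nonneg by (simp add: abs_mult right_diff_distrib[symmetric] diff_divide_distrib[symmetric])
      also have "\<dots> \<le> s2 / 2 * (K * err m + ?R N)"
      proof (rule mult_left_mono)
        show "\<bar>VV m N - (quad s + quad t)\<bar> \<le> K * err m + ?R N"
        proof -
          have "T1 N > 0" "T2 N > 0" using elim by auto
          from Ft_mean[OF A(1) card(1) this(1), of s m] Ft_mean[OF A(2) card(2) this(2), of t m]
          show ?thesis unfolding VV_def K_def distrib_right by linarith
        qed
      qed (use s2_nonneg in simp)
      also have "\<dots> = s2 / 2 * (K * err m) + s2 / 2 * ?R N" by (rule distrib_left)
      also have "\<dots> < r / 2" using m(2) elim by linarith
      finally have 3: "norm (?v - ?l) < r / 2" .
      have "norm (?S N - ?l) \<le> norm (?S N - ?W) + norm (?W - ?v) + norm (?v - ?l)"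
        using norm_triangle_ineq[of "?S N - ?W" "?W - ?v"] norm_triangle_ineq[of "?S N - ?v" "?v - ?l"] by simp
      then show ?case using 1 2 3 by linarith
    qed
    then show "\<exists>no. \<forall>N\<ge>no. norm (?S N - ?l) < r"
      by (simp add: eventually_sequentially)
  qed
qed

text \<open>Orthogonality bounds the second moment of the normalised score by
  \<open>s2 * Gam i i\<close>, whatever the stretch. This uniformity later gives tightness.\<close>

lemma Zh_eps_sum_bound:
  assumes "finite A" "real (card A) \<le> T"
  shows "integrable M (\<lambda>x. \<bar>(\<Sum>n\<in>A. Zh n x i * eps n x) / sqrt T\<bar>)"
    and "expectation (\<lambda>x. \<bar>(\<Sum>n\<in>A. Zh n x i * eps n x) / sqrt T\<bar>) \<le> sqrt (s2 * Gam i i)"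
proof -
  have ae: "AE x in M. (Z n x i)\<^sup>2 = (Zh n x i)\<^sup>2" for n
    using AE_Z_eq_Zh by eventually_elim simp
  have zi: "integrable M (\<lambda>x. (Zh n x i)\<^sup>2)" for n
    using Z_square_integrable[of n i] by (rule integrable_cong_AE_imp) (use ae in auto)
  have ze: "expectation (\<lambda>x. (Zh n x i)\<^sup>2) = Gam i i" for n
  proof -
    have "expectation (\<lambda>x. (Z n x i)\<^sup>2) = expectation (\<lambda>x. (Zh n x i)\<^sup>2)"
      by (rule integral_cong_AE) (use ae in auto)
    then show ?thesis by (simp add: Z_second_moment)
  qed
  have oi: "integrable M (\<lambda>x. (\<Sum>n\<in>A. Zh n x i * eps n x)\<^sup>2)"
    and oe: "expectation (\<lambda>x. (\<Sum>n\<in>A. Zh n x i * eps n x)\<^sup>2) = s2 * (real (card A) * Gam i i)"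
    using orthogonal_increments[of A "\<lambda>n x. Zh n x i"] assms(1) Zh_past zi by (auto simp: ze)
  have i1: "integrable M (\<lambda>x. \<Sum>n\<in>A. Zh n x i * eps n x)"
    using square_integrable_imp_integrable[OF _ oi] by simp
  then show "integrable M (\<lambda>x. \<bar>(\<Sum>n\<in>A. Zh n x i * eps n x) / sqrt T\<bar>)" by simp
  have T0: "T \<ge> 0" using order_trans[OF of_nat_0_le_iff assms(2)] .
  have "expectation (\<lambda>x. \<bar>(\<Sum>n\<in>A. Zh n x i * eps n x) / sqrt T\<bar>) = expectation (\<lambda>x. \<bar>\<Sum>n\<in>A. Zh n x i * eps n x\<bar>) / sqrt T"
    using T0 by (simp add: abs_divide)
  also have "\<dots> \<le> sqrt (s2 * (real (card A) * Gam i i)) / sqrt T"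
    unfolding oe[symmetric] using T0 by (intro divide_right_mono expectation_abs_le_sqrt oi) auto
  also have "\<dots> \<le> sqrt (s2 * Gam i i)"
  proof (cases "T = 0")
    case False
    have "sqrt (s2 * (real (card A) * Gam i i)) \<le> sqrt (s2 * (T * Gam i i))"
      using assms s2_nonneg Gam_diag_nonneg by (intro real_sqrt_le_mono mult_left_mono mult_right_mono) auto
    also have "\<dots> = sqrt (s2 * Gam i i) * sqrt T" by (simp add: real_sqrt_mult)
    finally show ?thesis using False T0 by (simp add: divide_le_eq)
  qed (use s2_nonneg Gam_diag_nonneg in simp)
  finally show "expectation (\<lambda>x. \<bar>(\<Sum>n\<in>A. Zh n x i * eps n x) / sqrt T\<bar>) \<le> sqrt (s2 * Gam i i)" .
qed

end

section \<open>Positive definiteness of the second moment matrix\<close>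

locale ar_process = causal_process M eps L Y c mu0
  for M :: "'a measure" and eps L Y c mu0 +
  fixes psi :: "nat \<Rightarrow> real"
  assumes ar: "\<And>n. AE x in M. Y n x = psi 0 + (\<Sum>j=1..L. psi j * Y (n - int j) x) + eps n x"
    and s2_pos: "s2 > 0"
begin

lemma lincomb_Z_square_integrable: "integrable M (\<lambda>x. (lincomb L v (Z 0 x))\<^sup>2)"
  unfolding lincomb_square by (intro integrable_linear integrable_mult_right ZZ_integrable)

text \<open>The newest observation with a nonzero coefficient carries an innovation that is independent
  of everything else in the combination.\<close>

lemma quad_pos:
  assumes "i \<le> L" "v i \<noteq> 0"
  shows "quad v > 0"
proof (cases "\<exists>j. 1 \<le> j \<and> j \<le> L \<and> v j \<noteq> 0")
  case True
  define j where "j = (LEAST j. 1 \<le> j \<and> j \<le> L \<and> v j \<noteq> 0)"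
  have j: "1 \<le> j" "j \<le> L" "v j \<noteq> 0" using LeastI_ex[OF True] unfolding j_def by auto
  have least: "v k = 0" if "1 \<le> k" "k < j" for k
    using not_less_Least[of k "\<lambda>j. 1 \<le> j \<and> j \<le> L \<and> v j \<noteq> 0"] that j(2) unfolding j_def by auto
  \<comment> \<open>What remains of the linear form after the autoregression is substituted for
    \<open>Y (- int j)\<close> and its innovation is split off; it depends on strictly earlier
    noises only.\<close>
  define R where "R x = v 0 + v j * (psi 0 + (\<Sum>k=1..L. psi k * Yh (- int j - int k) x)) + (\<Sum>i\<in>{j<..L}. v i * Yh (- int i) x)" for x
  have RG: "R \<in> borel_measurable (G {..<- int j})"
    unfolding R_def
    by (intro borel_measurable_add borel_measurable_times borel_measurable_const borel_measurable_sum measurable_G_mono[OF _ Yh_past]) auto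
  have RM [measurable]: "R \<in> borel_measurable M" by (rule measurable_G_M[OF RG])
  have split: "lincomb L v y = v 0 * y 0 + v j * y j + (\<Sum>i\<in>{j<..L}. v i * y i)" for y
  proof -
    have s: "{..L} = {0} \<union> ({1..<j} \<union> ({j} \<union> {j<..L}))" using j by auto
    have "lincomb L v y = (\<Sum>i\<in>{0} \<union> ({1..<j} \<union> ({j} \<union> {j<..L})). v i * y i)" unfolding lincomb_def s ..
    also have "\<dots> = v 0 * y 0 + ((\<Sum>i\<in>{1..<j}. v i * y i) + (v j * y j + (\<Sum>i\<in>{j<..L}. v i * y i)))"
      using j by (subst sum.union_disjoint; (simp; fail)?)+ auto
    also have "(\<Sum>i\<in>{1..<j}. v i * y i) = 0" using least by (intro sum.neutral) auto
    finally show ?thesis by simp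
  qed
  have AEY: "AE x in M. \<forall>n. Y n x = Yh n x" using Y_eq_Yh by (simp add: AE_all_countable)
  have ae: "AE x in M. lincomb L v (Z 0 x) = R x + v j * eps (- int j) x"
    using AEY ar[of "- int j"]
  proof eventually_elim
    case (elim x)
    have "lincomb L v (Z 0 x) = v 0 + v j * Y (- int j) x + (\<Sum>i\<in>{j<..L}. v i * Y (- int i) x)"
      unfolding split using j by (auto simp: Z_def)
    also have "\<dots> = R x + v j * eps (- int j) x"
      unfolding R_def using elim(2) by (simp add: elim(1) distrib_left algebra_simps)
    finally show ?case .
  qed
  have [measurable]: "(\<lambda>x. lincomb L v (Z 0 x)) \<in> borel_measurable M" unfolding lincomb_def by measurable
  have R2: "integrable M (\<lambda>x. (R x)\<^sup>2)"
  proof -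
    have "integrable M (\<lambda>x. (- v j * eps (- int j) x)\<^sup>2)" by (simp add: power_mult_distrib eps_moments)
    from square_integrable_add[OF _ _ lincomb_Z_square_integrable this]
    have "integrable M (\<lambda>x. (lincomb L v (Z 0 x) + - v j * eps (- int j) x)\<^sup>2)" by simp
    then show ?thesis by (rule integrable_cong_AE_imp) (use ae in \<open>auto elim!: eventually_mono\<close>)
  qed
  have R1: "integrable M R" using square_integrable_imp_integrable[OF _ R2] by simp
  have iv: "indep_var borel R borel (eps (- int j))" by (rule indep_var_past_eps[OF RG])
  note Re = indep_var_lebesgue_integral[OF iv R1 eps_moments(3)] indep_var_integrable[OF iv R1 eps_moments(3)]
  have "quad v = expectation (\<lambda>x. (R x + v j * eps (- int j) x)\<^sup>2)"
    unfolding quad_eq by (rule integral_cong_AE) (use ae in auto)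
  also have "\<dots> = expectation (\<lambda>x. (R x)\<^sup>2 + 2 * v j * (R x * eps (- int j) x) + (v j)\<^sup>2 * (eps (- int j) x)\<^sup>2)"
    by (simp add: power2_sum power_mult_distrib algebra_simps)
  also have "\<dots> = expectation (\<lambda>x. (R x)\<^sup>2) + (v j)\<^sup>2 * s2"
  proof -
    have "integrable M (\<lambda>x. (R x)\<^sup>2 + 2 * v j * (R x * eps (- int j) x))"
      by (intro Bochner_Integration.integrable_add R2 integrable_mult_right Re(2))
    then show ?thesis using R2 Re eps_moments(1,2,4)[of "- int j"] by simp
  qed
  also have "\<dots> > 0" using j(3) s2_pos by (intro add_nonneg_pos) auto
  finally show ?thesis .
next
  case False
  \<comment> \<open>Only the intercept is left, and its regressor is the constant 1.\<close>
  then have i0: "i = 0" and v0: "\<And>j. 1 \<le> j \<Longrightarrow> j \<le> L \<Longrightarrow> v j = 0" using assms by (auto simp: Suc_le_eq)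
  have "lincomb L v y = v 0 * y 0" for y
    unfolding lincomb_def by (rule sum.mono_neutral_cong_right[of _ "{0}", simplified]) (use v0 in \<open>auto simp: Suc_le_eq\<close>)
  then show ?thesis unfolding quad_eq using assms i0 by (simp add: Z_def prob_space)
qed

end

section \<open>Least squares estimates\<close>

lemma rss_lincomb:
  "rss L y a b phi = (\<Sum>n\<in>{a + int L..b}. (y n - lincomb L phi (\<lambda>i. if i = 0 then 1 else y (n - int i)))\<^sup>2)"
proof -
  have s: "{..L} = insert 0 {1..L}" by auto
  have "lincomb L phi (\<lambda>i. if i = 0 then 1 else y (n - int i)) = phi 0 + (\<Sum>j=1..L. phi j * y (n - int j))" for n
    unfolding lincomb_def s by (subst sum.insert) (auto intro!: sum.cong)
  then show ?thesis by (simp add: rss_def)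
qed

text \<open>Moving coordinate \<open>i\<close> of a minimiser by \<open>h\<close> changes the
  residual sum by \<open>h\<^sup>2 * q - 2 * h * p\<close>, which stays nonnegative for all
  \<open>h\<close> only if \<open>p\<close> vanishes.\<close>

lemma lse_normal_equations:
  fixes y :: "int \<Rightarrow> real"
  assumes phi: "phi \<in> lse L y a b" and i: "i \<le> L"
  defines "z \<equiv> (\<lambda>n i. if i = 0 then 1 else y (n - int i))"
  shows "(\<Sum>n\<in>{a + int L..b}. z n i * (y n - lincomb L phi (z n))) = 0"
proof -
  let ?A = "{a + int L..b}"
  define e where "e n = y n - lincomb L phi (z n)" for n
  define p where "p = (\<Sum>n\<in>?A. z n i * e n)"
  define q where "q = (\<Sum>n\<in>?A. (z n i)\<^sup>2)"
  have q0: "q \<ge> 0" by (simp add: q_def sum_nonneg)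
  have ineq: "0 \<le> h\<^sup>2 * q - 2 * h * p" for h
  proof -
    define phi' where "phi' = (\<lambda>j. phi j + (if j = i then h else 0))"
    have "supp_le L phi'" using phi i by (auto simp: lse_def supp_le_def phi'_def)
    then have "rss L y a b phi \<le> rss L y a b phi'" using phi by (auto simp: lse_def)
    moreover have "rss L y a b phi = (\<Sum>n\<in>?A. (e n)\<^sup>2)"
      unfolding rss_lincomb e_def z_def ..
    moreover have "rss L y a b phi' = (\<Sum>n\<in>?A. (e n - h * z n i)\<^sup>2)"
      unfolding rss_lincomb e_def phi'_def lincomb_add lincomb_single[OF i] z_def by (simp add: diff_diff_eq)
    moreover have "(\<Sum>n\<in>?A. (e n - h * z n i)\<^sup>2) = (\<Sum>n\<in>?A. (e n)\<^sup>2) - 2 * h * p + h\<^sup>2 * q"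
      unfolding p_def q_def sum_distrib_left sum_subtractf[symmetric] sum.distrib[symmetric]
      by (intro sum.cong) (auto simp: power2_eq_square algebra_simps)
    ultimately show ?thesis by simp
  qed
  have "p = 0"
  proof (rule ccontr)
    assume "p \<noteq> 0"
    \<comment> \<open>At this \<open>h\<close> the change equals
      \<open>- h\<^sup>2 * (q + 2)\<close>; the added 1 covers \<open>q = 0\<close>.\<close>
    define h where "h = p / (q + 1)"
    have p: "p = h * (q + 1)" using q0 by (simp add: h_def)
    have "h\<^sup>2 * q - 2 * h * p = h\<^sup>2 * (- q - 2)"
      unfolding p by (simp add: power2_eq_square algebra_simps)
    also have "\<dots> < 0" using q0 \<open>p \<noteq> 0\<close> p by (intro mult_pos_neg) (auto simp: zero_less_power2)
    finally show False using ineq[of h] by linarith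
  qed
  then show ?thesis by (simp add: p_def e_def)
qed

text \<open>\<open>V\<close> is \<open>B\<close> applied to \<open>H U\<close> while
  \<open>U\<close> is \<open>B\<close> applied to \<open>A U\<close>, so the error is
  \<open>B\<close> applied to \<open>(A - H) U\<close>. If the weighted discrepancy is below
  \<open>d\<close>, at most half of the error reappears on the right and is absorbed; otherwise the
  cap 1 is at most the discrepancy over \<open>d\<close>, a pointwise Markov inequality. Singular
  \<open>H\<close> are thereby covered.\<close>

lemma perturbation_bound:
  fixes B H :: "nat \<Rightarrow> nat \<Rightarrow> real"
  assumes BA: "\<And>i j. i \<le> L \<Longrightarrow> j \<le> L \<Longrightarrow> (\<Sum>k\<le>L. B i k * A k j) = (if i = j then 1 else 0)"
    and HU: "\<And>k. k \<le> L \<Longrightarrow> (\<Sum>j\<le>L. H k j * U j) = S k"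
    and d: "0 < d" "d \<le> 1/2"
  defines "V \<equiv> (\<lambda>i. \<Sum>k\<le>L. B i k * S k)"
  shows "min 1 (l1 L (\<lambda>i. U i - V i)) \<le> (\<Sum>i\<le>L. \<Sum>j\<le>L. \<Sum>k\<le>L. \<bar>B i k\<bar> * \<bar>H k j - A k j\<bar>) / d + 2 * d * l1 L V"
proof -
  define h where "h = (\<Sum>i\<le>L. \<Sum>j\<le>L. \<Sum>k\<le>L. \<bar>B i k\<bar> * \<bar>H k j - A k j\<bar>)"
  define D where "D = l1 L (\<lambda>i. U i - V i)"
  have D0: "D \<ge> 0" unfolding D_def by (rule l1_nonneg)
  have h0: "h \<ge> 0" unfolding h_def by (intro sum_nonneg mult_nonneg_nonneg) auto
  have UV: "U i - V i = - (\<Sum>j\<le>L. \<Sum>k\<le>L. B i k * (H k j - A k j) * U j)" if i: "i \<le> L" for i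
  proof -
    have "V i = (\<Sum>k\<le>L. \<Sum>j\<le>L. B i k * H k j * U j)"
      unfolding V_def by (intro sum.cong refl) (simp add: HU[symmetric] sum_distrib_left mult.assoc)
    also have "\<dots> = (\<Sum>j\<le>L. \<Sum>k\<le>L. B i k * H k j * U j)" by (rule sum.swap)
    finally have 1: "V i = (\<Sum>j\<le>L. \<Sum>k\<le>L. B i k * H k j * U j)" .
    have "(\<Sum>j\<le>L. \<Sum>k\<le>L. B i k * A k j * U j) = (\<Sum>j\<le>L. (if i = j then 1 else 0) * U j)"
      using i by (intro sum.cong refl) (simp add: BA[symmetric] sum_distrib_right)
    also have "\<dots> = U i" using i by (simp add: if_distrib[of "\<lambda>z. z * _"] cong: if_cong)
    finally have 2: "U i = (\<Sum>j\<le>L. \<Sum>k\<le>L. B i k * A k j * U j)" by simp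
    show ?thesis unfolding 1 by (subst 2) (simp add: sum_subtractf[symmetric] sum_negf[symmetric] algebra_simps)
  qed
  have "D \<le> (\<Sum>i\<le>L. \<Sum>j\<le>L. \<Sum>k\<le>L. \<bar>B i k\<bar> * \<bar>H k j - A k j\<bar> * l1 L U)"
    unfolding D_def l1_def[of L "\<lambda>i. U i - V i"]
  proof (rule sum_mono)
    fix i assume "i \<in> {..L}"
    then have "\<bar>U i - V i\<bar> = \<bar>\<Sum>j\<le>L. \<Sum>k\<le>L. B i k * (H k j - A k j) * U j\<bar>" using UV[of i] by simp
    also have "\<dots> \<le> (\<Sum>j\<le>L. \<Sum>k\<le>L. \<bar>B i k * (H k j - A k j) * U j\<bar>)"
      by (rule order_trans[OF sum_abs]) (intro sum_mono sum_abs)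
    also have "\<dots> \<le> (\<Sum>j\<le>L. \<Sum>k\<le>L. \<bar>B i k\<bar> * \<bar>H k j - A k j\<bar> * l1 L U)"
      by (intro sum_mono) (auto simp: abs_mult intro!: mult_left_mono abs_le_l1)
    finally show "\<bar>U i - V i\<bar> \<le> (\<Sum>j\<le>L. \<Sum>k\<le>L. \<bar>B i k\<bar> * \<bar>H k j - A k j\<bar> * l1 L U)" .
  qed
  also have "\<dots> = h * l1 L U" unfolding h_def by (simp add: sum_distrib_right)
  finally have Dh: "D \<le> h * l1 L U" .
  have "l1 L U \<le> (\<Sum>i\<le>L. \<bar>V i\<bar> + \<bar>U i - V i\<bar>)" unfolding l1_def by (intro sum_mono) linarith
  then have U: "l1 L U \<le> l1 L V + D" by (simp add: l1_def D_def sum.distrib)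
  have V0: "l1 L V \<ge> 0" by (rule l1_nonneg)
  have "min 1 D \<le> h / d + 2 * d * l1 L V"
  proof (cases "h \<ge> d")
    case True
    then have "1 \<le> h / d" using d by simp
    moreover have "0 \<le> 2 * d * l1 L V" using d V0 by simp
    ultimately show ?thesis by linarith
  next
    case False
    have "D \<le> d * l1 L U" using Dh False l1_nonneg[of L U] by (meson less_imp_le linorder_not_le mult_right_mono order_trans)
    also have "\<dots> \<le> d * (l1 L V + D)" using U d by (intro mult_left_mono) auto
    also have "\<dots> = d * l1 L V + d * D" by (rule distrib_left)
    also have "d * D \<le> 1/2 * D" using d D0 by (intro mult_right_mono) auto
    finally have "D \<le> 2 * d * l1 L V" by simp
    moreover have "h / d \<ge> 0" using h0 d by simp
    ultimately show ?thesis by linarith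
  qed
  then show ?thesis by (simp add: D_def h_def)
qed

section \<open>Linearisation of the least squares estimate\<close>

context ar_process
begin

text \<open>The linearised estimation error: \<open>B\<close>, intended as the inverse of
  \<open>Gam\<close>, applied to the normalised score.\<close>

definition "proj B A T x i = (\<Sum>k\<le>L. B i k * ((\<Sum>n\<in>A. Zh n x k * eps n x) / sqrt T))"

lemma proj_measurable [measurable]: "(\<lambda>x. proj B A T x i) \<in> borel_measurable M"
  unfolding proj_def by measurable

lemma proj_l1:
  assumes "finite A" "real (card A) \<le> T"
  shows "integrable M (\<lambda>x. l1 L (proj B A T x))"
    and "expectation (\<lambda>x. l1 L (proj B A T x)) \<le> (\<Sum>i\<le>L. \<Sum>k\<le>L. \<bar>B i k\<bar> * sqrt (s2 * Gam k k))"
proof -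
  note b = Zh_eps_sum_bound[OF assms]
  let ?f = "\<lambda>x. \<Sum>i\<le>L. \<Sum>k\<le>L. \<bar>B i k\<bar> * \<bar>(\<Sum>n\<in>A. Zh n x k * eps n x) / sqrt T\<bar>"
  have fi: "integrable M ?f" by (intro integrable_linear integrable_mult_right b)
  have le: "l1 L (proj B A T x) \<le> ?f x" for x
    unfolding l1_def proj_def by (intro sum_mono order_trans[OF sum_abs]) (simp add: abs_mult)
  have [measurable]: "(\<lambda>x. l1 L (proj B A T x)) \<in> borel_measurable M" unfolding l1_def by measurable
  show i: "integrable M (\<lambda>x. l1 L (proj B A T x))"
  proof (rule Bochner_Integration.integrable_bound[OF fi])
    show "AE x in M. norm (l1 L (proj B A T x)) \<le> norm (?f x)"
    proof (rule AE_I2)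
      fix x show "norm (l1 L (proj B A T x)) \<le> norm (?f x)"
        unfolding real_norm_def using le[of x] l1_nonneg[of L "proj B A T x"] by linarith
    qed
  qed measurable
  have "expectation (\<lambda>x. l1 L (proj B A T x)) \<le> expectation ?f" by (intro integral_mono i fi le)
  also have "\<dots> = (\<Sum>i\<le>L. \<Sum>k\<le>L. \<bar>B i k\<bar> * expectation (\<lambda>x. \<bar>(\<Sum>n\<in>A. Zh n x k * eps n x) / sqrt T\<bar>))"
    using b(1) by (simp add: Bochner_Integration.integral_sum Bochner_Integration.integrable_sum del: abs_divide)
  also have "\<dots> \<le> (\<Sum>i\<le>L. \<Sum>k\<le>L. \<bar>B i k\<bar> * sqrt (s2 * Gam k k))"
    by (intro sum_mono mult_left_mono b) auto
  finally show "expectation (\<lambda>x. l1 L (proj B A T x)) \<le> (\<Sum>i\<le>L. \<Sum>k\<le>L. \<bar>B i k\<bar> * sqrt (s2 * Gam k k))" .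
qed

text \<open>Transposing \<open>B\<close> onto the test direction turns a linear form of
  \<open>proj\<close> into a score.\<close>

lemma lincomb_proj:
  "lincomb L s (proj B A T x) = (\<Sum>n\<in>A. lincomb L (\<lambda>k. \<Sum>i\<le>L. s i * B i k) (Zh n x) * eps n x) / sqrt T"
proof -
  have "lincomb L s (proj B A T x) = (\<Sum>i\<le>L. \<Sum>k\<le>L. \<Sum>n\<in>A. s i * B i k * Zh n x k * eps n x / sqrt T)"
    unfolding lincomb_def proj_def by (simp add: sum_distrib_left sum_divide_distrib mult.assoc)
  also have "\<dots> = (\<Sum>i\<le>L. \<Sum>n\<in>A. \<Sum>k\<le>L. s i * B i k * Zh n x k * eps n x / sqrt T)"
    by (intro sum.cong refl sum.swap)
  also have "\<dots> = (\<Sum>n\<in>A. \<Sum>i\<le>L. \<Sum>k\<le>L. s i * B i k * Zh n x k * eps n x / sqrt T)"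
    by (rule sum.swap)
  also have "\<dots> = (\<Sum>n\<in>A. \<Sum>k\<le>L. \<Sum>i\<le>L. s i * B i k * Zh n x k * eps n x / sqrt T)"
    by (intro sum.cong refl sum.swap)
  finally show ?thesis
    unfolding lincomb_def by (simp add: sum_distrib_right sum_divide_distrib)
qed

text \<open>Convergence in probability, phrased as an expectation capped at 1. The normal equations
  take the form required by \<open>perturbation_bound\<close> with \<open>H\<close> the empirical
  second moments over \<open>T N\<close>, and the law of large numbers makes \<open>H\<close> close
  to \<open>Gam\<close> in mean.\<close>

lemma lse_linearization:
  assumes A: "\<And>N. A N = {a N + int L..b N}" and card: "\<And>N. real (card (A N)) \<le> T N"
    and T: "filterlim T at_top sequentially" and ratio: "(\<lambda>N. real (card (A N)) / T N) \<longlonglongrightarrow> 1"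
    and est_meas [measurable]: "\<And>N i. (\<lambda>x. est N x i) \<in> borel_measurable M"
    and est: "\<And>N x. x \<in> space M \<Longrightarrow> est N x \<in> lse L (\<lambda>n. Y n x) (a N) (b N)"
    and B: "\<And>i j. i \<le> L \<Longrightarrow> j \<le> L \<Longrightarrow> (\<Sum>k\<le>L. B i k * Gam k j) = (if i = j then 1 else 0)"
  shows "(\<lambda>N. expectation (\<lambda>x. min 1 (l1 L (\<lambda>i. sqrt (T N) * (est N x i - psi i) - proj B (A N) (T N) x i)))) \<longlonglongrightarrow> 0"
    (is "(\<lambda>N. expectation (\<lambda>x. min 1 (?D N x))) \<longlonglongrightarrow> 0")
proof -
  define H where "H N x k j = (\<Sum>n\<in>A N. Z n x k * Z n x j) / T N" for N x k j
  define h where "h N x = (\<Sum>i\<le>L. \<Sum>j\<le>L. \<Sum>k\<le>L. \<bar>B i k\<bar> * \<bar>H N x k j - Gam k j\<bar>)" for N x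
  define Cv where "Cv = (\<Sum>i\<le>L. \<Sum>k\<le>L. \<bar>B i k\<bar> * sqrt (s2 * Gam k k))"
  have fin: "finite (A N)" for N by (simp add: A)
  have Tpos: "eventually (\<lambda>N. T N > 0) sequentially" using T by (simp add: filterlim_at_top_dense)
  have Hint: "integrable M (\<lambda>x. \<bar>H N x k j - Gam k j\<bar>)" for N k j
    unfolding H_def by (intro integrable_abs integrable_linear integrable_divide_zero ZZ_integrable integrable_const)
  have hint: "integrable M (h N)" for N
    unfolding h_def by (intro integrable_linear integrable_mult_right Hint)
  have H0: "(\<lambda>N. expectation (\<lambda>x. \<bar>H N x k j - Gam k j\<bar>)) \<longlonglongrightarrow> 0" if kj: "k \<le> L" "j \<le> L" for k j
  proof (rule tendsto_sandwich[OF _ _ tendsto_const])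
    let ?f = "\<lambda>N. expectation (\<lambda>x. \<bar>(\<Sum>n\<in>A N. Z n x k * Z n x j - Gam k j) / T N\<bar>) + \<bar>Gam k j\<bar> * \<bar>real (card (A N)) / T N - 1\<bar>"
    show "\<forall>\<^sub>F N in sequentially. 0 \<le> expectation (\<lambda>x. \<bar>H N x k j - Gam k j\<bar>)" by simp
    have "?f \<longlonglongrightarrow> 0 + \<bar>Gam k j\<bar> * \<bar>1 - 1\<bar>"
      by (intro tendsto_intros lln[OF fin card T kj] ratio)
    then show "?f \<longlonglongrightarrow> 0" by simp
    show "\<forall>\<^sub>F N in sequentially. expectation (\<lambda>x. \<bar>H N x k j - Gam k j\<bar>) \<le> ?f N"
      using Tpos
    proof eventually_elim
      case (elim N)
      have i: "integrable M (\<lambda>x. \<bar>(\<Sum>n\<in>A N. Z n x k * Z n x j - Gam k j) / T N\<bar>)"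
        by (intro integrable_abs integrable_divide_zero integrable_linear ZZ_integrable integrable_const)
      have "expectation (\<lambda>x. \<bar>H N x k j - Gam k j\<bar>)
          \<le> expectation (\<lambda>x. \<bar>(\<Sum>n\<in>A N. Z n x k * Z n x j - Gam k j) / T N\<bar> + \<bar>Gam k j\<bar> * \<bar>real (card (A N)) / T N - 1\<bar>)"
      proof (rule integral_mono)
        fix x
        have "H N x k j - Gam k j = (\<Sum>n\<in>A N. Z n x k * Z n x j - Gam k j) / T N + Gam k j * (real (card (A N)) / T N - 1)"
          using elim by (simp add: H_def sum_subtractf field_simps)
        then show "\<bar>H N x k j - Gam k j\<bar> \<le> \<bar>(\<Sum>n\<in>A N. Z n x k * Z n x j - Gam k j) / T N\<bar> + \<bar>Gam k j\<bar> * \<bar>real (card (A N)) / T N - 1\<bar>"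
          by (simp only: abs_mult[symmetric] abs_triangle_ineq)
      qed (intro Hint integrable_linear i integrable_const)+
      also have "\<dots> = ?f N" using i by (simp add: prob_space)
      finally show ?case .
    qed
  qed
  have "(\<lambda>N. \<Sum>i\<le>L. \<Sum>j\<le>L. \<Sum>k\<le>L. \<bar>B i k\<bar> * expectation (\<lambda>x. \<bar>H N x k j - Gam k j\<bar>)) \<longlonglongrightarrow> (\<Sum>i\<le>L. \<Sum>j\<le>L. \<Sum>k\<le>L. \<bar>B i k\<bar> * 0)"
    by (intro tendsto_sum tendsto_mult tendsto_const H0) auto
  moreover have "expectation (h N) = (\<Sum>i\<le>L. \<Sum>j\<le>L. \<Sum>k\<le>L. \<bar>B i k\<bar> * expectation (\<lambda>x. \<bar>H N x k j - Gam k j\<bar>))" for N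
    unfolding h_def using Hint by (simp add: Bochner_Integration.integral_sum Bochner_Integration.integrable_sum)
  ultimately have Eh: "(\<lambda>N. expectation (h N)) \<longlonglongrightarrow> 0" by simp
  have Dm [measurable]: "?D N \<in> borel_measurable M" for N
    unfolding l1_def by measurable
  have Dint: "integrable M (\<lambda>x. min 1 (?D N x))" for N
    by (rule integrable_const_bound[where B=1]) (auto simp: l1_nonneg)
  have AEar: "AE x in M. \<forall>n. Y n x = lincomb L psi (Z n x) + eps n x"
  proof -
    have "lincomb L psi (Z n x) = psi 0 + (\<Sum>j=1..L. psi j * Y (n - int j) x)" for n x
    proof -
      have s: "{..L} = insert 0 {1..L}" by auto
      show ?thesis unfolding lincomb_def s by (subst sum.insert) (auto intro!: sum.cong simp: Z_def)
    qed
    then show ?thesis using ar by (simp add: AE_all_countable)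
  qed
  have main: "AE x in M. min 1 (?D N x) \<le> h N x / d + 2 * d * l1 L (proj B (A N) (T N) x)"
    if N: "T N > 0" and d: "0 < d" "d \<le> 1/2" for N d
    using AEar AE_Z_eq_Zh AE_space
  proof eventually_elim
    case (elim x)
    define U where "U = (\<lambda>i. sqrt (T N) * (est N x i - psi i))"
    define S where "S k = (\<Sum>n\<in>A N. Zh n x k * eps n x) / sqrt (T N)" for k
    \<comment> \<open>Inserting the autoregression into the normal equations replaces the residual
      by the noise minus a linear form in the estimation error; scaling by \<open>T N\<close> and
      its root yields the linear system.\<close>
    have HU: "(\<Sum>j\<le>L. H N x k j * U j) = S k" if k: "k \<le> L" for k
    proof -
      have zeq: "Z n x = (\<lambda>i. if i = 0 then 1 else Y (n - int i) x)" for n by (simp add: Z_def fun_eq_iff)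
      have "(\<Sum>n\<in>A N. Z n x k * (Y n x - lincomb L (est N x) (Z n x))) = 0"
        unfolding A zeq by (rule lse_normal_equations[OF est[OF elim(3)] k])
      moreover have "Y n x - lincomb L (est N x) (Z n x) = eps n x - lincomb L (\<lambda>i. est N x i - psi i) (Z n x)" for n
        using elim(1) by (simp add: lincomb_diff)
      ultimately have "(\<Sum>n\<in>A N. Z n x k * lincomb L (\<lambda>i. est N x i - psi i) (Z n x)) = (\<Sum>n\<in>A N. Z n x k * eps n x)"
        by (simp add: right_diff_distrib sum_subtractf)
      moreover have "(\<Sum>n\<in>A N. Z n x k * lincomb L (\<lambda>i. est N x i - psi i) (Z n x))
          = (\<Sum>j\<le>L. (\<Sum>n\<in>A N. Z n x k * Z n x j) * (est N x j - psi j))"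
        unfolding lincomb_def sum_distrib_left sum_distrib_right
        by (subst sum.swap) (simp add: mult_ac)
      moreover have "(\<Sum>j\<le>L. H N x k j * U j) = (\<Sum>j\<le>L. (\<Sum>n\<in>A N. Z n x k * Z n x j) * (est N x j - psi j)) / sqrt (T N)"
      proof -
        have "a / T N * (sqrt (T N) * c) = a * c / sqrt (T N)" for a c
          using N by (simp add: field_simps)
        then have "H N x k j * U j = (\<Sum>n\<in>A N. Z n x k * Z n x j) * (est N x j - psi j) / sqrt (T N)" for j
          unfolding H_def U_def .
        then show ?thesis by (simp only: sum_divide_distrib)
      qed
      ultimately show ?thesis using elim(2) by (simp add: S_def)
    qed
    have "min 1 (l1 L (\<lambda>i. U i - (\<Sum>k\<le>L. B i k * S k))) \<le> h N x / d + 2 * d * l1 L (\<lambda>i. \<Sum>k\<le>L. B i k * S k)"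
      unfolding h_def by (rule perturbation_bound[OF B HU d])
    then show ?case by (simp add: U_def S_def proj_def[abs_def])
  qed
  have bound: "\<forall>\<^sub>F N in sequentially. expectation (\<lambda>x. min 1 (?D N x)) \<le> expectation (h N) / d + 2 * d * Cv"
    if d: "0 < d" "d \<le> 1/2" for d
    using Tpos
  proof eventually_elim
    case (elim N)
    note pl = proj_l1[OF fin[of N] card[of N], of B]
    have "expectation (\<lambda>x. min 1 (?D N x)) \<le> expectation (\<lambda>x. h N x / d + 2 * d * l1 L (proj B (A N) (T N) x))"
      by (intro integral_mono_AE Dint main[OF elim d] integrable_linear integrable_divide_zero hint integrable_mult_right pl)
    also have "\<dots> = expectation (h N) / d + 2 * d * expectation (\<lambda>x. l1 L (proj B (A N) (T N) x))"
      using hint pl(1) by simp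
    also have "\<dots> \<le> expectation (h N) / d + 2 * d * Cv"
      using pl(2) d unfolding Cv_def by (intro add_left_mono mult_left_mono) auto
    finally show ?case .
  qed
  show ?thesis
  proof (rule LIMSEQ_I)
    fix r :: real assume r: "r > 0"
    have Cv0: "Cv \<ge> 0" unfolding Cv_def using s2_nonneg Gam_diag_nonneg by (intro sum_nonneg mult_nonneg_nonneg) auto
    \<comment> \<open>Chosen free of \<open>N\<close> so that the term with \<open>Cv\<close> is at
      most \<open>r / 2\<close>; the discrepancy over this fixed \<open>d\<close> then tends to
      0.\<close>
    define d where "d = min (1/2) (r / (4 * (Cv + 1)))"
    have d: "0 < d" "d \<le> 1/2" unfolding d_def using r Cv0 by (simp, intro min.cobounded1)
    have "2 * d * Cv \<le> 2 * (r / (4 * (Cv + 1))) * Cv" using Cv0 by (intro mult_right_mono mult_left_mono) (auto simp: d_def)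
    also have "\<dots> \<le> r / 2" using Cv0 r by (simp add: field_simps)
    finally have d2: "2 * d * Cv \<le> r / 2" .
    have "(\<lambda>N. expectation (h N) / d) \<longlonglongrightarrow> 0 / d" by (intro tendsto_intros Eh) (use d in auto)
    then have "\<forall>\<^sub>F N in sequentially. expectation (h N) / d < r / 2" by (rule order_tendstoD) (use r in simp)
    with bound[OF d] have "\<forall>\<^sub>F N in sequentially. norm (expectation (\<lambda>x. min 1 (?D N x)) - 0) < r"
    proof eventually_elim
      case (elim N)
      have "0 \<le> expectation (\<lambda>x. min 1 (?D N x))" by (intro integral_nonneg_AE AE_I2) (simp add: l1_nonneg)
      then show ?case unfolding real_norm_def diff_0_right using elim d2 by linarith
    qed
    then show "\<exists>no. \<forall>N\<ge>no. norm (expectation (\<lambda>x. min 1 (?D N x)) - 0) < r"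
      by (simp add: eventually_sequentially)
  qed
qed

end

text \<open>Positive definiteness of \<open>Gam\<close> feeds Gram-Schmidt. The second property says
  that the quadratic form of the inverse is a sum of squares in \<open>w\<close>, which matches the
  variance of a score in the transposed direction with that of the Gaussian law built from
  \<open>w\<close>.\<close>

lemma (in ar_process) Gam_inverse_exists:
  obtains w B where
    "\<And>i j. i \<le> L \<Longrightarrow> j \<le> L \<Longrightarrow> (\<Sum>k\<le>L. B i k * Gam k j) = (if i = j then 1 else 0)"
    "\<And>s. quad (\<lambda>k. \<Sum>i\<le>L. s i * B i k) = (\<Sum>k\<le>L. (\<Sum>i\<le>L. s i * w k i)\<^sup>2)"
proof -
  have pos: "(\<Sum>i\<le>k. \<Sum>j\<le>k. v i * v j * Gam i j) > 0" if "k < Suc L" "v k = 1" for k v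
  proof -
    \<comment> \<open>Padding with zeros makes a vector on a leading block subject to
      \<open>quad_pos\<close>.\<close>
    define v' where "v' i = (if i \<le> k then v i else 0)" for i
    have "quad v' > 0" by (rule quad_pos[of k]) (use that in \<open>auto simp: v'_def\<close>)
    also have "quad v' = (\<Sum>i\<le>L. \<Sum>j\<le>k. v' i * v' j * Gam i j)"
      unfolding quad_def using that by (intro sum.cong refl sum.mono_neutral_right) (auto simp: v'_def)
    also have "\<dots> = (\<Sum>i\<le>k. \<Sum>j\<le>k. v' i * v' j * Gam i j)"
      using that by (intro sum.mono_neutral_right) (auto simp: v'_def)
    also have "\<dots> = (\<Sum>i\<le>k. \<Sum>j\<le>k. v i * v j * Gam i j)"
      by (intro sum.cong refl) (auto simp: v'_def)
    finally show ?thesis .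
  qed
  obtain w where w: "\<forall>i<Suc L. \<forall>l<Suc L. (\<Sum>j<Suc L. (\<Sum>k<Suc L. w k i * w k j) * Gam j l) = (if i = l then 1 else 0)"
    using gram_schmidt_inverse[of Gam "Suc L", OF Gam_sym pos] by blast
  define B where "B i j = (\<Sum>k\<le>L. w k i * w k j)" for i j
  have B: "(\<Sum>k\<le>L. B i k * Gam k j) = (if i = j then 1 else 0)" if "i \<le> L" "j \<le> L" for i j
    using w that unfolding lessThan_Suc_atMost B_def less_Suc_eq_le by blast
  have "quad (\<lambda>k. \<Sum>i\<le>L. s i * B i k) = (\<Sum>k\<le>L. (\<Sum>i\<le>L. s i * w k i)\<^sup>2)" for s
  proof -
    define s' where "s' k = (\<Sum>i\<le>L. s i * B i k)" for k
    have s'G: "(\<Sum>k\<le>L. s' k * Gam k l) = s l" if "l \<le> L" for l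
    proof -
      have "(\<Sum>k\<le>L. s' k * Gam k l) = (\<Sum>i\<le>L. \<Sum>k\<le>L. s i * (B i k * Gam k l))"
        unfolding s'_def sum_distrib_right by (subst sum.swap) (simp add: mult.assoc)
      also have "\<dots> = (\<Sum>i\<le>L. s i * (if i = l then 1 else 0))"
        using that by (intro sum.cong refl) (simp add: sum_distrib_left[symmetric] B)
      also have "\<dots> = s l" using that by (simp add: if_distrib[of "\<lambda>z. _ * z"] cong: if_cong)
      finally show ?thesis .
    qed
    have "quad s' = (\<Sum>j\<le>L. \<Sum>i\<le>L. s' i * s' j * Gam i j)" unfolding quad_def by (rule sum.swap)
    also have "\<dots> = (\<Sum>j\<le>L. s' j * (\<Sum>i\<le>L. s' i * Gam i j))"
      by (simp add: sum_distrib_left mult_ac)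
    also have "\<dots> = (\<Sum>j\<le>L. s' j * s j)" by (intro sum.cong refl) (simp add: s'G)
    also have "\<dots> = (\<Sum>j\<le>L. \<Sum>i\<le>L. \<Sum>k\<le>L. (s i * w k i) * (s j * w k j))"
      unfolding s'_def B_def by (simp add: sum_distrib_left sum_distrib_right mult_ac)
    also have "\<dots> = (\<Sum>j\<le>L. \<Sum>k\<le>L. \<Sum>i\<le>L. (s i * w k i) * (s j * w k j))"
      by (intro sum.cong refl sum.swap)
    also have "\<dots> = (\<Sum>k\<le>L. \<Sum>j\<le>L. \<Sum>i\<le>L. (s i * w k i) * (s j * w k j))" by (rule sum.swap)
    also have "\<dots> = (\<Sum>k\<le>L. (\<Sum>i\<le>L. s i * w k i)\<^sup>2)"
      unfolding power2_eq_square sum_product by (simp add: mult_ac)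
    finally show ?thesis by (simp add: s'_def[abs_def])
  qed
  with B show ?thesis using that by blast
qed

text \<open>The trivial bound 2 serves when an error reaches 1, the Lipschitz bound otherwise; the
  constants \<open>2 + c1\<close> and \<open>2 + c2\<close> cover both regimes with capped
  errors.\<close>

lemma iexp_perturbation:
  assumes "d1 \<ge> 0" "d2 \<ge> 0" "c1 \<ge> 0" "c2 \<ge> 0" and "\<bar>u - v\<bar> \<le> c1 * d1 + c2 * d2"
  shows "norm (iexp u - iexp v) \<le> (2 + c1) * min 1 d1 + (2 + c2) * min 1 d2"
proof (cases "d1 \<ge> 1 \<or> d2 \<ge> 1")
  case True
  have "norm (iexp u - iexp v) \<le> 2" using norm_triangle_ineq4[of "iexp u" "iexp v"] by simp
  also have "2 \<le> (2 + c1) * min 1 d1 + (2 + c2) * min 1 d2"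
  proof -
    have "0 \<le> (2 + c1) * min 1 d1" "0 \<le> (2 + c2) * min 1 d2" using assms by auto
    then show ?thesis using True assms by (auto simp: min_def split: if_splits)
  qed
  finally show ?thesis .
next
  case False
  then have "c1 * d1 + c2 * d2 \<le> (2 + c1) * min 1 d1 + (2 + c2) * min 1 d2"
    using assms by (simp add: min_def distrib_right)
  then show ?thesis using abs_iexp_diff[of u v] assms(5) by linarith
qed

text \<open>Losing the first \<open>L\<close> times of a stretch is asymptotically negligible.
  Natural subtraction stops at 0, so the formula used holds only eventually.\<close>

lemma interval_card_ratio:
  assumes f: "filterlim f at_top sequentially"
  shows "(\<lambda>N. real (f N - L) / real (f N)) \<longlonglongrightarrow> 1"
proof -
  have lim: "(\<lambda>k. 1 - real L / real k) \<longlonglongrightarrow> 1 - 0"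
    by (intro tendsto_diff tendsto_const lim_const_over_n)
  have "(\<lambda>k. real (k - L) / real k) \<longlonglongrightarrow> 1"
  proof (rule Lim_transform_eventually)
    show "(\<lambda>k. 1 - real L / real k) \<longlonglongrightarrow> 1" using lim by simp
    show "\<forall>\<^sub>F k in sequentially. 1 - real L / real k = real (k - L) / real k"
      using eventually_ge_at_top[of "Suc L"]
      by eventually_elim (simp add: of_nat_diff diff_divide_distrib)
  qed
  from filterlim_compose[OF this f] show ?thesis .
qed

section \<open>Joint limit of the two normalised estimation errors\<close>

theorem theorem1:
  fixes M :: "'a measure"
    and L :: nat
    and psi :: "nat \<Rightarrow> real"
    and Y eps :: "int \<Rightarrow> 'a \<Rightarrow> real"
    and N1 :: "nat \<Rightarrow> nat"
    and psi1 psi2 :: "nat \<Rightarrow> 'a \<Rightarrow> (nat \<Rightarrow> real)"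
  assumes "prob_space M"
    and "supp_le L psi"
    and "\<And>n. Y n \<in> borel_measurable M"
    and "\<And>n. eps n \<in> borel_measurable M"
    and "prob_space.indep_vars M (\<lambda>_. borel) eps UNIV"
    and "\<And>n. distr M borel (eps n) = distr M borel (eps 0)"
    and "integrable M (\<lambda>x. (eps 0 x)\<^sup>2)"
    and "prob_space.expectation M (eps 0) = 0"
    and "prob_space.variance M (eps 0) > 0"
    and "\<And>n. AE x in M. Y n x = psi 0 + (\<Sum>j=1..L. psi j * Y (n - int j) x) + eps n x"
    and "causal M Y eps"
    and "strictly_stationary M Y"
    and "integrable M (\<lambda>x. ln (max \<bar>eps 0 x\<bar> 1))"
    and "has_nontrivial_ac_component (distr M borel (eps 0))"
    and "\<And>N. N1 N \<le> N"
    and "filterlim N1 at_top at_top"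
    and "filterlim (\<lambda>N. N - N1 N) at_top at_top"
    and "\<And>N. psi1 N \<in> borel_measurable M"
    and "\<And>N. psi2 N \<in> borel_measurable M"
    and "\<And>N x. x \<in> space M \<Longrightarrow> psi1 N x \<in> lse L (\<lambda>n. Y n x) 1 (int (N1 N))"
    and "\<And>N x. x \<in> space M \<Longrightarrow> psi2 N x \<in> lse L (\<lambda>n. Y n x) (int (N1 N) + 1) (int N)"
  shows "\<exists>mu. conv_distr M
                 (\<lambda>N x. ((\<lambda>i. sqrt (real (N1 N)) * (psi1 N x i - psi i)),
                         (\<lambda>i. sqrt (real (N - N1 N)) * (psi2 N x i - psi i)))) mu
            \<and> gaussian_vec L (distr mu borel fst)
            \<and> gaussian_vec L (distr mu borel snd)
            \<and> prob_space.indep_var mu borel fst borel snd"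
proof -
  interpret iid_noise M eps
    using assms(1,4-8) by (simp add: iid_noise_def iid_noise_axioms_def)
  obtain c mu0 where c: "summable (\<lambda>j. \<bar>c j\<bar>)"
      "\<And>n. AE x in M. (\<lambda>j. c j * eps (n - int j) x) sums (Y n x - mu0)"
    using assms(11) unfolding causal_def by blast
  interpret ar_process M eps L Y c mu0 psi
  proof (unfold_locales)
    show "Y n \<in> borel_measurable M" for n by (rule assms(3))
    show "summable (\<lambda>j. \<bar>c j\<bar>)" by (rule c(1))
    show "AE x in M. (\<lambda>j. c j * eps (n - int j) x) sums (Y n x - mu0)" for n by (rule c(2))
    show "strictly_stationary M Y" by (rule assms(12))
    show "AE x in M. Y n x = psi 0 + (\<Sum>j=1..L. psi j * Y (n - int j) x) + eps n x" for n by (rule assms(10))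
    show "s2 > 0" using assms(9) unfolding assms(8) by (simp add: s2_def)
  qed
  obtain w B where B: "\<And>i j. i \<le> L \<Longrightarrow> j \<le> L \<Longrightarrow> (\<Sum>k\<le>L. B i k * Gam k j) = (if i = j then 1 else 0)"
    and Bw: "\<And>s. quad (\<lambda>k. \<Sum>i\<le>L. s i * B i k) = (\<Sum>k\<le>L. (\<Sum>i\<le>L. s i * w k i)\<^sup>2)"
    by (rule Gam_inverse_exists) blast
  \<comment> \<open>The factor \<open>sqrt s2\<close> turns the inverse of \<open>Gam\<close> into
    the limit covariance, \<open>s2\<close> times that inverse.\<close>
  define q where "q s = (\<Sum>k\<le>L. (\<Sum>i\<le>L. s i * (sqrt s2 * w k i))\<^sup>2)" for s
  obtain nu where nu: "prob_space nu" "sets nu = sets borel" "AE y in nu. supp_le L y"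
    and nu_char: "\<And>s. (\<integral>y. iexp (lincomb L s y) \<partial>nu) = complex_of_real (exp (- q s / 2))"
    using gaussian_law_exists[of L "\<lambda>k i. sqrt s2 * w k i"] unfolding q_def by auto
  have q_quad: "q s = s2 * quad (\<lambda>k. \<Sum>i\<le>L. s i * B i k)" for s
  proof -
    have eq: "(\<Sum>i\<le>L. s i * (sqrt s2 * w k i)) = sqrt s2 * (\<Sum>i\<le>L. s i * w k i)" for k
      by (simp add: sum_distrib_left mult_ac)
    have "(\<Sum>i\<le>L. s i * (sqrt s2 * w k i))\<^sup>2 = s2 * (\<Sum>i\<le>L. s i * w k i)\<^sup>2" for k
      unfolding eq power_mult_distrib using s2_nonneg by simp
    then show ?thesis unfolding q_def Bw sum_distrib_left[of s2] by simp
  qed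
  have q0: "q s \<ge> 0" for s unfolding q_def by (intro sum_nonneg) auto
  have q_scale: "q (\<lambda>i. r * s i) = r\<^sup>2 * q s" for r s
    unfolding q_def sum_distrib_left[of "r\<^sup>2"]
    by (intro sum.cong refl) (simp add: power_mult_distrib[symmetric] sum_distrib_left mult.assoc)
  have gauss: "gaussian_vec L nu" by (rule gaussian_vecI[OF nu nu_char q0 q_scale])
  note pair = gaussian_pair_law[OF nu]
  define mu where "mu = nu \<Otimes>\<^sub>M nu"
  \<comment> \<open>The summation ranges of \<open>rss\<close>: the offset \<open>L\<close> keeps
    all regressors inside the stretch.\<close>
  define A1 where "A1 N = {1 + int L..int (N1 N)}" for N
  define A2 where "A2 N = {int (N1 N) + 1 + int L..int N}" for N
  define T1 where "T1 N = real (N1 N)" for N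
  define T2 where "T2 N = real (N - N1 N)" for N
  define U1 where "U1 N x i = sqrt (T1 N) * (psi1 N x i - psi i)" for N x i
  define U2 where "U2 N x i = sqrt (T2 N) * (psi2 N x i - psi i)" for N x i
  define D1 where "D1 N x = min 1 (l1 L (\<lambda>i. U1 N x i - proj B (A1 N) (T1 N) x i))" for N x
  define D2 where "D2 N x = min 1 (l1 L (\<lambda>i. U2 N x i - proj B (A2 N) (T2 N) x i))" for N x
  have cardA: "card (A1 N) = N1 N - L" "card (A2 N) = (N - N1 N) - L" for N
    using assms(15)[of N] by (auto simp: A1_def A2_def)
  have card: "real (card (A1 N)) \<le> T1 N" "real (card (A2 N)) \<le> T2 N" for N
    unfolding cardA T1_def T2_def by auto
  have fin: "finite (A1 N)" "finite (A2 N)" "A1 N \<inter> A2 N = {}" for N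
    by (auto simp: A1_def A2_def)
  have T: "filterlim T1 at_top sequentially" "filterlim T2 at_top sequentially"
    unfolding T1_def T2_def
    using filterlim_compose[OF filterlim_real_sequentially assms(16)] filterlim_compose[OF filterlim_real_sequentially assms(17)] .
  have ratio: "(\<lambda>N. real (card (A1 N)) / T1 N) \<longlonglongrightarrow> 1" "(\<lambda>N. real (card (A2 N)) / T2 N) \<longlonglongrightarrow> 1"
    unfolding cardA T1_def T2_def using interval_card_ratio[OF assms(16)] interval_card_ratio[OF assms(17)] .
  have psi_meas [measurable]: "(\<lambda>x. psi1 N x i) \<in> borel_measurable M" "(\<lambda>x. psi2 N x i) \<in> borel_measurable M" for N i
    using assms(18,19) by (auto intro: measurable_product_then_coordinatewise)
  have D1: "(\<lambda>N. expectation (D1 N)) \<longlonglongrightarrow> 0"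
    unfolding D1_def[abs_def] U1_def
    by (rule lse_linearization[where a="\<lambda>N. 1" and b="\<lambda>N. int (N1 N)"])
       (use card T ratio B assms(20) in \<open>auto simp: A1_def\<close>)
  have D2: "(\<lambda>N. expectation (D2 N)) \<longlonglongrightarrow> 0"
    unfolding D2_def[abs_def] U2_def
    by (rule lse_linearization[where a="\<lambda>N. int (N1 N) + 1" and b="\<lambda>N. int N"])
       (use card T ratio B assms(21) in \<open>auto simp: A2_def\<close>)
  have Um [measurable]: "(\<lambda>x. U1 N x i) \<in> borel_measurable M" "(\<lambda>x. U2 N x i) \<in> borel_measurable M" for N i
    unfolding U1_def U2_def by measurable
  have Dm [measurable]: "D1 N \<in> borel_measurable M" "D2 N \<in> borel_measurable M" for N
    unfolding D1_def D2_def l1_def by measurable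
  have D01: "0 \<le> D1 N x" "D1 N x \<le> 1" "0 \<le> D2 N x" "D2 N x \<le> 1" for N x
    by (auto simp: D1_def D2_def l1_nonneg)
  have Di: "integrable M (D1 N)" "integrable M (D2 N)" for N
    by (rule integrable_const_bound[where B=1]; simp add: D01)+
  define X where "X N x = (U1 N x, U2 N x)" for N x
  have Xm [measurable]: "X N \<in> borel_measurable M" for N
    unfolding X_def[abs_def]
    by (intro borel_measurable_Pair measurable_coordinatewise_then_product Um)
  \<comment> \<open>\<open>lse\<close> and the assumption on \<open>psi\<close> force the
    coordinates above \<open>L\<close> to vanish, which puts the pair where the trigonometric
    approximation is valid.\<close>
  have supp: "supp_le L (fst (X N x)) \<and> supp_le L (snd (X N x))" if "x \<in> space M" for N x
    using assms(2) assms(20)[OF that, of N] assms(21)[OF that, of N]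
    by (auto simp: X_def U1_def U2_def lse_def supp_le_def)
  have char: "(\<lambda>N. \<integral>x. iexp (lincomb L s (fst (X N x)) + lincomb L t (snd (X N x))) \<partial>M)
      \<longlonglongrightarrow> (\<integral>p. iexp (lincomb L s (fst p) + lincomb L t (snd p)) \<partial>mu)" for s t
  proof -
    \<comment> \<open>With the directions transposed by \<open>B\<close>, both linearised errors
      together form one score, so \<open>score_clt\<close> applies; the true errors differ from it
      by terms controlled by \<open>D1\<close> and \<open>D2\<close>.\<close>
    let ?S = "\<lambda>N x. score (\<lambda>k. \<Sum>i\<le>L. s i * B i k) (\<lambda>k. \<Sum>i\<le>L. t i * B i k) (A1 N) (A2 N) (T1 N) (T2 N) x"
    let ?W = "\<lambda>N x. lincomb L s (U1 N x) + lincomb L t (U2 N x)"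
    have Seq: "?S N x = lincomb L s (proj B (A1 N) (T1 N) x) + lincomb L t (proj B (A2 N) (T2 N) x)" for N x
      unfolding score_def lincomb_proj ..
    have lim: "(\<lambda>N. expectation (\<lambda>x. iexp (?S N x))) \<longlonglongrightarrow> (\<integral>p. iexp (lincomb L s (fst p) + lincomb L t (snd p)) \<partial>mu)"
      using score_clt[OF fin card T ratio, of "\<lambda>k. \<Sum>i\<le>L. s i * B i k" "\<lambda>k. \<Sum>i\<le>L. t i * B i k"]
      unfolding mu_def pair(7) nu_char q_quad
      by (simp add: exp_add[symmetric] of_real_mult[symmetric] distrib_left add_divide_distrib diff_divide_distrib del: of_real_mult of_real_exp)
    have [measurable]: "(\<lambda>x. lincomb L s (U1 N x)) \<in> borel_measurable M" "(\<lambda>x. lincomb L t (U2 N x)) \<in> borel_measurable M" for N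
      unfolding lincomb_def by measurable
    have ii: "integrable M (\<lambda>x. iexp (?W N x))" "integrable M (\<lambda>x. iexp (?S N x))" for N
      by (rule integrable_const_bound[where B=1], (auto)[2])+
    have bound: "norm (expectation (\<lambda>x. iexp (?W N x)) - expectation (\<lambda>x. iexp (?S N x)))
        \<le> (2 + l1 L s) * expectation (D1 N) + (2 + l1 L t) * expectation (D2 N)" for N
    proof -
      have "norm (expectation (\<lambda>x. iexp (?W N x)) - expectation (\<lambda>x. iexp (?S N x))) = norm (expectation (\<lambda>x. iexp (?W N x) - iexp (?S N x)))"
        using ii[of N] by (subst Bochner_Integration.integral_diff) auto
      also have "\<dots> \<le> expectation (\<lambda>x. norm (iexp (?W N x) - iexp (?S N x)))" by (rule integral_norm_bound)
      also have "\<dots> \<le> expectation (\<lambda>x. (2 + l1 L s) * D1 N x + (2 + l1 L t) * D2 N x)"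
      proof (rule integral_mono)
        show "integrable M (\<lambda>x. norm (iexp (?W N x) - iexp (?S N x)))"
          by (intro integrable_norm integrable_linear ii)
        show "integrable M (\<lambda>x. (2 + l1 L s) * D1 N x + (2 + l1 L t) * D2 N x)"
          by (intro integrable_linear integrable_mult_right Di)
        fix x
        let ?d1 = "l1 L (\<lambda>i. U1 N x i - proj B (A1 N) (T1 N) x i)"
        let ?d2 = "l1 L (\<lambda>i. U2 N x i - proj B (A2 N) (T2 N) x i)"
        have "?W N x - ?S N x = lincomb L s (\<lambda>i. U1 N x i - proj B (A1 N) (T1 N) x i) + lincomb L t (\<lambda>i. U2 N x i - proj B (A2 N) (T2 N) x i)"
          unfolding Seq lincomb_diff_right[symmetric] by simp
        then have "\<bar>?W N x - ?S N x\<bar> \<le> l1 L s * ?d1 + l1 L t * ?d2"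
          using lincomb_abs_le_l1[of L s "\<lambda>i. U1 N x i - proj B (A1 N) (T1 N) x i"]
            lincomb_abs_le_l1[of L t "\<lambda>i. U2 N x i - proj B (A2 N) (T2 N) x i"] by linarith
        then show "norm (iexp (?W N x) - iexp (?S N x)) \<le> (2 + l1 L s) * D1 N x + (2 + l1 L t) * D2 N x"
          unfolding D1_def D2_def by (intro iexp_perturbation l1_nonneg)
      qed
      also have "\<dots> = (2 + l1 L s) * expectation (D1 N) + (2 + l1 L t) * expectation (D2 N)"
        using Di[of N] by simp
      finally show ?thesis .
    qed
    have "(\<lambda>N. (2 + l1 L s) * expectation (D1 N) + (2 + l1 L t) * expectation (D2 N)) \<longlonglongrightarrow> (2 + l1 L s) * 0 + (2 + l1 L t) * 0"
      by (intro tendsto_intros D1 D2)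
    then have z: "(\<lambda>N. (2 + l1 L s) * expectation (D1 N) + (2 + l1 L t) * expectation (D2 N)) \<longlonglongrightarrow> 0" by simp
    have "(\<lambda>N. expectation (\<lambda>x. iexp (?W N x)) - expectation (\<lambda>x. iexp (?S N x))) \<longlonglongrightarrow> 0"
      by (rule Lim_null_comparison[OF _ z]) (intro always_eventually allI bound)
    from tendsto_add[OF this lim] show ?thesis by (simp add: X_def)
  qed
  have tight: "\<exists>R. \<forall>\<^sub>F N in sequentially. measure M {x\<in>space M. X N x \<in> box_compl L R} \<le> e" if e: "e > 0" for e
  proof -
    define Cv where "Cv = (\<Sum>i\<le>L. \<Sum>k\<le>L. \<bar>B i k\<bar> * sqrt (s2 * Gam k k))"
    have Cv0: "Cv \<ge> 0" unfolding Cv_def using s2_nonneg Gam_diag_nonneg by (intro sum_nonneg mult_nonneg_nonneg) auto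
    \<comment> \<open>A coordinate beyond \<open>1 + r\<close> forces a capped linearisation error
      of 1 or a linearised error of size \<open>r\<close>. Markov's inequality bounds the latter by
      \<open>2 * Cv / r\<close>, at most \<open>e / 2\<close> for this \<open>r\<close>.\<close>
    define r where "r = 4 * (Cv + 1) / e"
    have r: "r > 0" using Cv0 e by (simp add: r_def)
    have rC: "2 * Cv / r \<le> e / 2" using Cv0 e by (simp add: r_def field_simps)
    have bound: "measure M {x\<in>space M. X N x \<in> box_compl L (1 + r)} \<le> expectation (D1 N) + expectation (D2 N) + 2 * Cv / r" for N
    proof -
      let ?v1 = "\<lambda>x. l1 L (proj B (A1 N) (T1 N) x)" and ?v2 = "\<lambda>x. l1 L (proj B (A2 N) (T2 N) x)"
      note p1 = proj_l1[OF fin(1) card(1), of B N] and p2 = proj_l1[OF fin(2) card(2), of B N]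
      let ?E = "{x\<in>space M. X N x \<in> box_compl L (1 + r)}"
      have E: "?E \<in> sets M" by measurable
      have "measure M ?E = expectation (indicator ?E)" using E by simp
      also have "\<dots> \<le> expectation (\<lambda>x. D1 N x + D2 N x + (?v1 x + ?v2 x) / r)"
      proof (rule integral_mono)
        show "integrable M (indicator ?E :: 'a \<Rightarrow> real)" using E by (intro integrable_real_indicator) (auto simp: less_top[symmetric])
        show "integrable M (\<lambda>x. D1 N x + D2 N x + (?v1 x + ?v2 x) / r)"
          by (intro integrable_linear integrable_divide_zero Di p1 p2)
        fix x
        have aux: "1 \<le> min 1 (l1 L (\<lambda>i. u i - v i)) + l1 L v / r" if "i \<le> L" "\<bar>u i\<bar> > 1 + r" for u v i
        proof -
          have "\<bar>u i\<bar> \<le> l1 L (\<lambda>i. u i - v i) + l1 L v"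
            using abs_le_l1[OF that(1), of "\<lambda>i. u i - v i"] abs_le_l1[OF that(1), of v] by linarith
          then have "1 \<le> l1 L (\<lambda>i. u i - v i) \<or> r \<le> l1 L v" using that(2) by linarith
          then show ?thesis
          proof
            assume "1 \<le> l1 L (\<lambda>i. u i - v i)"
            moreover have "0 \<le> l1 L v / r" using r l1_nonneg[of L v] by simp
            ultimately show ?thesis by simp
          next
            assume "r \<le> l1 L v"
            then have "1 \<le> l1 L v / r" using r by simp
            moreover have "0 \<le> min 1 (l1 L (\<lambda>i. u i - v i))" by (simp add: l1_nonneg)
            ultimately show ?thesis by linarith
          qed
        qed
        have n1: "0 \<le> D1 N x + ?v1 x / r" and n2: "0 \<le> D2 N x + ?v2 x / r"
          using D01 r l1_nonneg by auto
        show "indicator ?E x \<le> D1 N x + D2 N x + (?v1 x + ?v2 x) / r"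
        proof (cases "X N x \<in> box_compl L (1 + r)")
          case True
          then obtain i where i: "i \<le> L" "\<bar>U1 N x i\<bar> > 1 + r \<or> \<bar>U2 N x i\<bar> > 1 + r"
            by (auto simp: box_compl_def X_def)
          then have "1 \<le> D1 N x + ?v1 x / r \<or> 1 \<le> D2 N x + ?v2 x / r"
            unfolding D1_def D2_def using aux[of i "U1 N x"] aux[of i "U2 N x"] by blast
          then have "1 \<le> D1 N x + D2 N x + (?v1 x + ?v2 x) / r" using n1 n2 by (auto simp: add_divide_distrib)
          then show ?thesis by (simp add: indicator_def)
        next
          case False
          then have "indicator ?E x = (0::real)" by (simp add: indicator_def)
          then show ?thesis using n1 n2 by (simp add: add_divide_distrib)
        qed
      qed
      also have "\<dots> = expectation (D1 N) + expectation (D2 N) + (expectation ?v1 + expectation ?v2) / r"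
        using Di[of N] p1(1) p2(1) by simp
      also have "\<dots> \<le> expectation (D1 N) + expectation (D2 N) + 2 * Cv / r"
        using p1(2) p2(2) r unfolding Cv_def by (intro add_left_mono divide_right_mono) auto
      finally show ?thesis .
    qed
    have "(\<lambda>N. expectation (D1 N) + expectation (D2 N)) \<longlonglongrightarrow> 0 + 0" by (intro tendsto_intros D1 D2)
    then have "\<forall>\<^sub>F N in sequentially. expectation (D1 N) + expectation (D2 N) < e / 2"
      by (rule order_tendstoD) (use e in simp)
    then have "\<forall>\<^sub>F N in sequentially. measure M {x\<in>space M. X N x \<in> box_compl L (1 + r)} \<le> e"
    proof eventually_elim
      case (elim N)
      then show ?case using bound[of N] rC by linarith
    qed
    then show ?thesis by blast
  qed
  have "conv_distr M X mu"
    unfolding conv_distr_def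
  proof (intro conjI allI impI)
    show "prob_space mu" "sets mu = sets borel" unfolding mu_def by (rule pair)+
    show "X N \<in> borel_measurable M" for N by (rule Xm)
    fix g :: "(nat \<Rightarrow> real) \<times> (nat \<Rightarrow> real) \<Rightarrow> real"
    assume "continuous_on UNIV g \<and> bounded (range g)"
    then have g: "continuous_on UNIV g" "bounded (range g)" by auto
    show "(\<lambda>N. \<integral>x. g (X N x) \<partial>M) \<longlonglongrightarrow> (\<integral>y. g y \<partial>mu)"
    proof (rule levy_continuity_pairs[where L=L])
      show "prob_space M" by (rule prob_space_axioms)
      show "prob_space mu" "sets mu = sets borel" "AE p in mu. supp_le L (fst p) \<and> supp_le L (snd p)"
        unfolding mu_def by (rule pair)+
    qed (fact Xm supp char tight g)+
  qed
  moreover have "X = (\<lambda>N x. ((\<lambda>i. sqrt (real (N1 N)) * (psi1 N x i - psi i)),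
                         (\<lambda>i. sqrt (real (N - N1 N)) * (psi2 N x i - psi i))))"
    by (simp add: fun_eq_iff X_def U1_def U2_def T1_def T2_def)
  moreover have "gaussian_vec L (distr mu borel fst)" "gaussian_vec L (distr mu borel snd)"
    unfolding mu_def pair by (rule gauss)+
  moreover have "prob_space.indep_var mu borel fst borel snd" unfolding mu_def by (rule pair)
  ultimately show ?thesis by auto
qed

end
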